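(* Let $S:\mathbb N\to[0,\infty)$ be the clock process of the randomly trapped random walk on $\mathbb Z^d$ with step distribution $\nu$ and trap law $\mu$. Suppose that the function $r_n=\mathbb P[Y(k)\neq Y(0)\text{ for }k=1,\dots,n]$ can be written as $r_n=1/\ell^*(n)$ for a slowly varying function $\ell^*:\mathbb N\to[1,\infty)$. Suppose further that there is a sequence $a_N\nearrow\infty$ such that for all but countably many $t\in[0,\infty)$ $$S_N(t):=\frac1{a_N}S(\lfloor Nt\rfloor)\xrightarrow{N\to\infty}\mathcal S(t)\qquad\text{in $\mathbb P$-distribution},$$ where $\mathcal S:[0,\infty)\to[0,\infty)$ is a cadlag process satisfying the non-triviality assumption $\limsup_{t\to\infty}\mathcal S(t)=\infty$ $\mathbb P$-a.s. Then one of the following two cases occurs: (i) The limit clock process is linear, $\mathcal S(t)=Mt$ for some constant $M>0$, and the normalizing sequence satisfies $a_N=N\ell(N)$ for some slowly varying function $\ell$. (ii) The limit clock process is an $\alpha$-stable subordinator, $\mathcal S=V_\alpha$, $\alpha\in(0,1)$, and the normalizing sequence satisfies $a_N=N^{1/\alpha}\ell(N)$ for some slowly varying function $\ell$.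
   Context: Randomly trapped random walk (RTRW). Let $d\ge1$, let $\nu$ be a probability measure on $\mathbb Z^d$ with $\nu\ne\delta_0$, and let $\mu$ be a probability measure on the space of probability measures on $(0,\infty)$. On a probability space $(\Omega,\mathcal F,\mathbb P)$ let $\pi=(\pi_x)_{x\in\mathbb Z^d}$ be i.i.d. random probability measures with law $\mu$, and let $\xi=(\xi_i)_{i\ge1}$ be i.i.d. with law $\nu$, independent of $\pi$. Put $Y(0)=0$, $Y(n)=\xi_1+\dots+\xi_n$, and $L(x,n)=\sum_{k=0}^n\mathbf 1\{Y(k)=x\}$. Given $\pi$, let $(\tau_x^i)_{x\in\mathbb Z^d,i\ge1}$ be independent random variables, independent of $\xi$, such that $\tau_x^i$ has distribution $\pi_x$. The clock process is $S(0)=0$, $S(n)=\sum_{x\in\mathbb Z^d}\sum_{i=1}^{L(x,n-1)}\tau_x^i=\sum_{k=0}^{n-1}\tau_{Y(k)}^{L(Y(k),k)}$ for $n\ge1$. $\mathbb P$ is the annealed law (averaged over the environment $\pi$).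
   Formalization: In (ii), convergence for single t fixes only the laws of each S(t), so t^{1/α}V_α(1) is a counterexample; proved: each S(t) has the law of V_α(t), and S is an α-stable subordinator if the finite-dimensional distributions of S_N converge to those of S off a countable set of times. *)

theory Defs
  imports "HOL-Probability.Probability"
begin

section \<open>Slowly varying sequences\<close>

definition slowly_varying :: "(nat \<Rightarrow> real) \<Rightarrow> bool" where
  "slowly_varying l \<longleftrightarrow>
     (\<forall>\<^sub>F n in sequentially. l n > 0) \<and>
     (\<forall>c>0. (\<lambda>n. l (nat \<lfloor>c * real n\<rfloor>) / l n) \<longlonglongrightarrow> 1)"

section \<open>The randomly trapped random walk\<close>

text \<open>
  The lattice is the type \<^typ>\<open>int ^ 'd\<close> with its discrete sigma-algebra. Measures on the open
  half-line live on \<open>pos_borel\<close>, and \<^const>\<open>prob_algebra\<close> (from the Giry monad) is the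
  measurable space of all probability measures on a given measurable space.
\<close>

definition pos_borel :: "real measure" where
  "pos_borel = restrict_space borel {0<..}"

definition walk :: "(nat \<Rightarrow> 'w \<Rightarrow> int ^ 'd) \<Rightarrow> nat \<Rightarrow> 'w \<Rightarrow> int ^ 'd::finite" where
  "walk \<xi> n \<omega> = (\<Sum>i=1..n. \<xi> i \<omega>)"

definition local_time ::
  "(nat \<Rightarrow> 'w \<Rightarrow> int ^ 'd) \<Rightarrow> int ^ 'd \<Rightarrow> nat \<Rightarrow> 'w \<Rightarrow> nat" where
  "local_time \<xi> x n \<omega> = card {k \<in> {0..n}. walk \<xi> k \<omega> = (x :: int ^ 'd::finite)}"

definition clock ::
  "(nat \<Rightarrow> 'w \<Rightarrow> int ^ 'd) \<Rightarrow> (int ^ 'd \<Rightarrow> nat \<Rightarrow> 'w \<Rightarrow> real) \<Rightarrow> nat \<Rightarrow> 'w \<Rightarrow> real" where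
  "clock \<xi> \<tau> n \<omega> =
     (\<Sum>k<n. \<tau> (walk \<xi> k \<omega>) (local_time \<xi> (walk \<xi> k \<omega> :: int ^ 'd::finite) k \<omega>) \<omega>)"

lemma local_time_Suc:
  "local_time \<xi> x (Suc n) \<omega> = local_time \<xi> x n \<omega> + (if walk \<xi> (Suc n) \<omega> = x then 1 else 0)"
proof -
  have "{k \<in> {0..Suc n}. walk \<xi> k \<omega> = x} =
        (if walk \<xi> (Suc n) \<omega> = x then {Suc n} else {}) \<union> {k \<in> {0..n}. walk \<xi> k \<omega> = x}"
    by (auto simp: le_Suc_eq)
  then show ?thesis by (auto simp: local_time_def)
qed

text \<open>
  The clock as a sum over lattice sites; only sites visited up to time \<open>n\<close> contribute.
\<close>

lemma clock_eq_sum_sites: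
  assumes "finite A" "(\<lambda>k. walk \<xi> k \<omega>) ` {..n} \<subseteq> A"
  shows "clock \<xi> \<tau> (Suc n) \<omega> = (\<Sum>x\<in>A. \<Sum>i=1..local_time \<xi> x n \<omega>. \<tau> x i \<omega>)"
  using assms(2)
proof (induction n)
  case 0
  have lt: "local_time \<xi> x 0 \<omega> = (if x = walk \<xi> 0 \<omega> then 1 else 0)" for x
    by (auto simp: local_time_def Collect_conv_if conj_commute)
  have "(\<Sum>x\<in>A. \<Sum>i=1..local_time \<xi> x 0 \<omega>. \<tau> x i \<omega>) =
        (\<Sum>x\<in>A. if x = walk \<xi> 0 \<omega> then \<tau> x 1 \<omega> else 0)"
    by (intro sum.cong) (auto simp: lt)
  also have "\<dots> = \<tau> (walk \<xi> 0 \<omega>) 1 \<omega>"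
    using 0 assms(1) by (simp add: sum.delta)
  finally show ?case by (simp add: clock_def lt)
next
  case (Suc n)
  let ?y = "walk \<xi> (Suc n) \<omega>"
  have y: "?y \<in> A" using Suc.prems by auto
  have "(\<Sum>x\<in>A. \<Sum>i=1..local_time \<xi> x (Suc n) \<omega>. \<tau> x i \<omega>) =
        (\<Sum>x\<in>A. (\<Sum>i=1..local_time \<xi> x n \<omega>. \<tau> x i \<omega>) +
               (if x = ?y then \<tau> x (local_time \<xi> x (Suc n) \<omega>) \<omega> else 0))"
    by (intro sum.cong) (auto simp: local_time_Suc)
  also have "\<dots> = (\<Sum>x\<in>A. \<Sum>i=1..local_time \<xi> x n \<omega>. \<tau> x i \<omega>)
                 + \<tau> ?y (local_time \<xi> ?y (Suc n) \<omega>) \<omega>"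
    using y assms(1) by (simp add: sum.distrib sum.delta)
  also have "(\<Sum>x\<in>A. \<Sum>i=1..local_time \<xi> x n \<omega>. \<tau> x i \<omega>) = clock \<xi> \<tau> (Suc n) \<omega>"
    using Suc by (subst Suc.IH) auto
  finally show ?case by (simp add: clock_def)
qed

definition env_sigma :: "'w measure \<Rightarrow> (int ^ 'd::finite \<Rightarrow> 'w \<Rightarrow> real measure) \<Rightarrow> 'w measure" where
  "env_sigma M \<pi> =
     vimage_algebra (space M) (\<lambda>\<omega> x. \<pi> x \<omega>) (PiM UNIV (\<lambda>_. prob_algebra pos_borel))"

definition step_sigma :: "'w measure \<Rightarrow> (nat \<Rightarrow> 'w \<Rightarrow> int ^ 'd::finite) \<Rightarrow> 'w measure" where
  "step_sigma M \<xi> =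
     vimage_algebra (space M) (\<lambda>\<omega>. \<lambda>i\<in>{1..}. \<xi> i \<omega>) (PiM {1..} (\<lambda>_. count_space UNIV))"

text \<open>
  The last clause says that, conditionally on the sigma-algebra generated by the environment
  \<open>\<pi>\<close>, the \<open>\<tau> x i\<close> are independent with laws \<open>\<pi> x\<close> and are independent of \<open>\<xi>\<close>. (As \<open>\<xi>\<close> and
  \<open>\<pi>\<close> are independent, the conditional law of \<open>\<xi>\<close> is its unconditional law.)
\<close>

definition rtrw ::
  "'w measure \<Rightarrow> (int ^ 'd::finite) pmf \<Rightarrow> real measure measure \<Rightarrow> (int ^ 'd \<Rightarrow> 'w \<Rightarrow> real measure)
    \<Rightarrow> (nat \<Rightarrow> 'w \<Rightarrow> int ^ 'd) \<Rightarrow> (int ^ 'd \<Rightarrow> nat \<Rightarrow> 'w \<Rightarrow> real) \<Rightarrow> bool" where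
  "rtrw M \<nu> \<mu> \<pi> \<xi> \<tau> \<longleftrightarrow>
     prob_space M \<and>
     \<mu> \<in> space (prob_algebra (prob_algebra pos_borel)) \<and>
     prob_space.indep_vars M (\<lambda>_. prob_algebra pos_borel) \<pi> UNIV \<and>
     (\<forall>x. distr M (prob_algebra pos_borel) (\<pi> x) = \<mu>) \<and>
     prob_space.indep_vars M (\<lambda>_. count_space UNIV) \<xi> {1..} \<and>
     (\<forall>i\<ge>1. distr M (count_space UNIV) (\<xi> i) = measure_pmf \<nu>) \<and>
     prob_space.indep_set M (sets (env_sigma M \<pi>)) (sets (step_sigma M \<xi>)) \<and>
     (\<forall>x. \<forall>i\<ge>1. \<tau> x i \<in> M \<rightarrow>\<^sub>M pos_borel) \<and>
     (\<forall>J B C. finite J \<and> J \<subseteq> UNIV \<times> {1..} \<and> (\<forall>j\<in>J. B j \<in> sets pos_borel) \<and>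
        C \<in> sets (PiM {1..} (\<lambda>_. count_space UNIV)) \<longrightarrow>
        (AE \<omega> in M.
           real_cond_exp M (env_sigma M \<pi>)
             (indicator {\<omega> \<in> space M. (\<lambda>i\<in>{1..}. \<xi> i \<omega>) \<in> C \<and> (\<forall>(x, i)\<in>J. \<tau> x i \<omega> \<in> B (x, i))})
             \<omega>
           = measure M {\<omega> \<in> space M. (\<lambda>i\<in>{1..}. \<xi> i \<omega>) \<in> C}
             * (\<Prod>(x, i)\<in>J. measure (\<pi> x \<omega>) (B (x, i)))))"

definition no_return_prob :: "'w measure \<Rightarrow> (nat \<Rightarrow> 'w \<Rightarrow> int ^ 'd::finite) \<Rightarrow> nat \<Rightarrow> real" where
  "no_return_prob M \<xi> n =
     measure M {\<omega> \<in> space M. \<forall>k\<in>{1..n}. walk \<xi> k \<omega> \<noteq> walk \<xi> 0 \<omega>}"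

definition rescaled_clock ::
  "(nat \<Rightarrow> real) \<Rightarrow> (nat \<Rightarrow> 'w \<Rightarrow> int ^ 'd::finite) \<Rightarrow> (int ^ 'd \<Rightarrow> nat \<Rightarrow> 'w \<Rightarrow> real)
    \<Rightarrow> nat \<Rightarrow> real \<Rightarrow> 'w \<Rightarrow> real" where
  "rescaled_clock a \<xi> \<tau> N t \<omega> = clock \<xi> \<tau> (nat \<lfloor>real N * t\<rfloor>) \<omega> / a N"

section \<open>Processes indexed by the half-line\<close>

text \<open>Processes have type \<open>real \<Rightarrow> 'v \<Rightarrow> real\<close>; only times \<open>t \<ge> 0\<close> are meaningful.\<close>

definition cadlag :: "(real \<Rightarrow> real) \<Rightarrow> bool" where
  "cadlag f \<longleftrightarrow> (\<forall>t\<ge>0. (f \<longlongrightarrow> f t) (at_right t)) \<and> (\<forall>t>0. \<exists>l. (f \<longlongrightarrow> l) (at_left t))"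

definition cadlag_process :: "'v measure \<Rightarrow> (real \<Rightarrow> 'v \<Rightarrow> real) \<Rightarrow> bool" where
  "cadlag_process M X \<longleftrightarrow>
     (\<forall>t\<ge>0. X t \<in> borel_measurable M) \<and> (AE \<omega> in M. cadlag (\<lambda>t. X t \<omega>))"

text \<open>
  Convergence in distribution of \<open>(X N t)\<^sub>t\<close>, \<open>t \<in> T\<close>, as a process, i.e. of all
  finite-dimensional distributions. The vector \<open>(X N t)\<^sub>t\<close>, \<open>t \<in> I\<close>, is extended by zero
  outside \<open>I\<close>, and continuity of test functions refers to the product topology.
\<close>

definition fdd_conv ::
  "real set \<Rightarrow> 'w measure \<Rightarrow> (nat \<Rightarrow> real \<Rightarrow> 'w \<Rightarrow> real) \<Rightarrow> 'v measure \<Rightarrow> (real \<Rightarrow> 'v \<Rightarrow> real) \<Rightarrow> bool"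
  where
  "fdd_conv T M X M' Y \<longleftrightarrow>
     (\<forall>I (f :: (real \<Rightarrow> real) \<Rightarrow> real).
        finite I \<and> I \<subseteq> T \<and> continuous_on UNIV f \<and> bounded (range f) \<longrightarrow>
        (\<lambda>N. \<integral>\<omega>. f (\<lambda>t. if t \<in> I then X N t \<omega> else 0) \<partial>M)
          \<longlonglongrightarrow> (\<integral>\<omega>. f (\<lambda>t. if t \<in> I then Y t \<omega> else 0) \<partial>M'))"

definition subordinator :: "'v measure \<Rightarrow> (real \<Rightarrow> 'v \<Rightarrow> real) \<Rightarrow> bool" where
  "subordinator M V \<longleftrightarrow>
     prob_space M \<and>
     cadlag_process M V \<and>
     (AE \<omega> in M. V 0 \<omega> = 0) \<and>
     (AE \<omega> in M. mono_on {0..} (\<lambda>t. V t \<omega>)) \<and>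
     (\<forall>n (t :: nat \<Rightarrow> real). 0 \<le> t 0 \<and> mono t \<longrightarrow>
        prob_space.indep_vars M (\<lambda>_. borel) (\<lambda>i \<omega>. V (t (Suc i)) \<omega> - V (t i) \<omega>) {..<n}) \<and>
     (\<forall>s\<ge>0. \<forall>t\<ge>0. distr M borel (\<lambda>\<omega>. V (s + t) \<omega> - V s \<omega>) = distr M borel (V t))"

text \<open>
  The one-dimensional distributions of an \<open>\<alpha>\<close>-stable subordinator, given by its Laplace exponent
  \<open>c \<theta>\<^sup>\<alpha>\<close>.
\<close>

definition stable_marginals :: "real \<Rightarrow> 'v measure \<Rightarrow> (real \<Rightarrow> 'v \<Rightarrow> real) \<Rightarrow> bool" where
  "stable_marginals \<alpha> M V \<longleftrightarrow>
     (\<exists>c>0. \<forall>t\<ge>0. \<forall>\<theta>\<ge>0. (\<integral>\<omega>. exp (- \<theta> * V t \<omega>) \<partial>M) = exp (- c * t * \<theta> powr \<alpha>))"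

text \<open>
  Convergence of one-dimensional distributions identifies only the one-dimensional distributions
  of the limit: \<open>t\<^sup>1\<^sup>/\<^sup>\<alpha> V 1\<close> has the same \<open>stable_marginals\<close> as the \<open>\<alpha>\<close>-stable subordinator \<open>V\<close>, but
  does not have independent increments. Hence the separate notion.
\<close>

definition stable_subordinator :: "real \<Rightarrow> 'v measure \<Rightarrow> (real \<Rightarrow> 'v \<Rightarrow> real) \<Rightarrow> bool" where
  "stable_subordinator \<alpha> M V \<longleftrightarrow> subordinator M V \<and> stable_marginals \<alpha> M V"

end

theory Submission
  imports Defs
begin

text \<open>
  Given the walk, the Laplace transform of the clock is a product over the visited sites of averages
  \<open>Phi\<close> over the environment of one site. Splitting the path at a time \<open>n\<close> changes this product only
  at sites visited both before and after \<open>n\<close>, by at most \<open>g\<close> of the number of visits before \<open>n\<close>.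
  Decomposing at the last visit before \<open>n\<close> bounds the expected error by \<open>h n * (\<Sum>j<n. r j - r (j + m))\<close>,
  where \<open>h\<close> depends only on the past and the non-return probabilities \<open>r\<close> only on the future of
  that visit. The same decomposition bounds \<open>h n\<close> by the mean of \<open>G\<close>, the sum of \<open>g\<close> over all sites;
  a second moment bound shows that this mean stays bounded, as otherwise the Laplace transform of the
  rescaled clock could not have a limit near \<open>1\<close>. Since \<open>r\<close> is monotone and slowly varying, the error
  vanishes: increments of the rescaled clock are asymptotically independent. The limit therefore has
  Laplace transforms \<open>exp (- t * \<psi> \<theta>)\<close>, and convergence of types forces \<open>\<psi> \<theta> = \<psi> 1 * \<theta> powr \<alpha>\<close>
  with \<open>\<alpha> \<le> 1\<close> and regular variation of \<open>a\<close> with index \<open>1 / \<alpha>\<close>; \<open>\<alpha> = 1\<close> is the deterministic case.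
\<close>

section \<open>Expectations over finitely many steps\<close>

text \<open>The error estimate closes because both of its factors are measured against the same
  quantity \<open>N * r N\<close>. A bound \<open>B\<close> for the mean of \<open>G\<close> up to
  time \<open>2 * T * N\<close> gives \<open>h n * T * N * r (2 * T * N) \<le> B\<close> for all
  \<open>n \<le> T * N\<close>, while slow variation makes the sum of the differences of
  \<open>r\<close> of smaller order than \<open>N * r N\<close>. The size of \<open>r\<close> itself
  cancels, so recurrent and transient walks are treated alike; and since only bounded functionals
  occur, no moment of a holding time is ever required. The assumed convergence is spent on
  tightness: the limit transform tends to \<open>1\<close> at small arguments, which bounds the mean
  of \<open>G\<close> there, and doubling the argument at most doubles \<open>G\<close>. Convergence
  is given at single times outside a countable set, whereas the functional equation has to be solved
  at all times. This is why a grid of good times and right continuity accompany every limit. Single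
  times also determine only the marginals; for independent increments, joint convergence is combined
  with a splitting of the path into several blocks.\<close>

abbreviation expect_steps :: "'a pmf \<Rightarrow> nat \<Rightarrow> ('a list \<Rightarrow> real) \<Rightarrow> real" where
  "expect_steps \<nu> n f \<equiv> measure_pmf.expectation (replicate_pmf n \<nu>) f"

lemma length_replicate_pmf: "xs \<in> set_pmf (replicate_pmf n p) \<Longrightarrow> length xs = n"
  by (simp add: set_replicate_pmf)

lemma integrable_steps:
  assumes "\<And>xs. length xs = n \<Longrightarrow> \<bar>f xs\<bar> \<le> (B::real)"
  shows "integrable (measure_pmf (replicate_pmf n p)) f"
  by (rule measure_pmf.integrable_const_bound[where B = B])
     (auto simp: AE_measure_pmf_iff assms dest: length_replicate_pmf)

lemma expect_steps_cong:
  assumes "\<And>xs. length xs = n \<Longrightarrow> f xs = g xs"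
  shows "expect_steps p n f = expect_steps p n g"
  by (rule integral_cong_AE) (auto simp: AE_measure_pmf_iff assms dest: length_replicate_pmf)

lemma expect_steps_mono_integrable:
  assumes "integrable (replicate_pmf n p) f" "integrable (replicate_pmf n p) g"
    and "\<And>xs. length xs = n \<Longrightarrow> f xs \<le> g xs"
  shows "expect_steps p n f \<le> expect_steps p n g"
  using assms(1,2)
  by (rule integral_mono_AE) (use assms(3) in \<open>simp add: AE_measure_pmf_iff set_replicate_pmf\<close>)

lemma expect_steps_mono:
  assumes "\<And>xs. length xs = n \<Longrightarrow> f xs \<le> g xs"
    and "\<And>xs. length xs = n \<Longrightarrow> \<bar>f xs\<bar> \<le> B" "\<And>xs. length xs = n \<Longrightarrow> \<bar>g xs\<bar> \<le> C"
  shows "expect_steps p n f \<le> expect_steps p n g"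
  by (rule integral_mono_AE)
     (auto simp: AE_measure_pmf_iff intro: assms integrable_steps dest: length_replicate_pmf)

lemma expect_steps_bounds:
  assumes "\<And>xs. length xs = n \<Longrightarrow> 0 \<le> f xs" "\<And>xs. length xs = n \<Longrightarrow> f xs \<le> B"
  shows "0 \<le> expect_steps p n f" "expect_steps p n f \<le> B"
proof -
  show "0 \<le> expect_steps p n f"
    by (rule integral_nonneg_AE) (auto simp: AE_measure_pmf_iff assms dest: length_replicate_pmf)
  have "expect_steps p n f \<le> expect_steps p n (\<lambda>_. B)"
    by (rule expect_steps_mono[where B = B and C = "\<bar>B\<bar>"]) (auto simp: assms)
  then show "expect_steps p n f \<le> B" by simp
qed

text \<open>Past and future of an i.i.d. path are independent. The computation runs in nonnegative
  integrals, where integrating over two successive draws needs no integrability; the bounds on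
  \<open>f\<close> serve to return to real expectations.\<close>

lemma expect_steps_append:
  assumes "\<And>xs. length xs = n + m \<Longrightarrow> 0 \<le> f xs" "\<And>xs. length xs = n + m \<Longrightarrow> f xs \<le> (B::real)"
  shows "expect_steps p (n + m) f = expect_steps p n (\<lambda>xs. expect_steps p m (\<lambda>ys. f (xs @ ys)))"
proof -
  have B: "\<bar>f xs\<bar> \<le> B" if "length xs = n + m" for xs
    using assms(1)[OF that] assms(2)[OF that] by auto
  have bnd: "0 \<le> expect_steps p m (\<lambda>ys. f (xs @ ys))"
      "expect_steps p m (\<lambda>ys. f (xs @ ys)) \<le> B" "- expect_steps p m (\<lambda>ys. f (xs @ ys)) \<le> B" if "length xs = n" for xs
    using expect_steps_bounds[of m "\<lambda>ys. f (xs @ ys)" B p] assms that by auto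
  have inner: "ennreal (expect_steps p m (\<lambda>ys. f (xs @ ys)))
      = (\<integral>\<^sup>+ys. ennreal (f (xs @ ys)) \<partial>replicate_pmf m p)" if "length xs = n" for xs
    by (rule nn_integral_eq_integral[symmetric])
       (auto simp: AE_measure_pmf_iff intro!: integrable_steps[where B = B] assms B that
         dest: length_replicate_pmf)
  have "ennreal (expect_steps p (n + m) f) = (\<integral>\<^sup>+xs. ennreal (f xs) \<partial>replicate_pmf (n + m) p)"
    by (rule nn_integral_eq_integral[symmetric])
       (auto simp: AE_measure_pmf_iff intro!: integrable_steps[where B = B] assms B
         dest: length_replicate_pmf)
  also have "\<dots> = (\<integral>\<^sup>+xs. (\<integral>\<^sup>+ys. ennreal (f (xs @ ys)) \<partial>replicate_pmf m p) \<partial>replicate_pmf n p)"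
    by (simp add: replicate_pmf_distrib)
  also have "\<dots> = (\<integral>\<^sup>+xs. ennreal (expect_steps p m (\<lambda>ys. f (xs @ ys))) \<partial>replicate_pmf n p)"
    by (intro nn_integral_cong_AE) (auto simp: AE_measure_pmf_iff inner dest: length_replicate_pmf)
  also have "\<dots> = ennreal (expect_steps p n (\<lambda>xs. expect_steps p m (\<lambda>ys. f (xs @ ys))))"
    by (rule nn_integral_eq_integral)
       (auto simp: AE_measure_pmf_iff bnd intro!: integrable_steps[where B = B]
         dest!: length_replicate_pmf)
  finally show ?thesis
    by (subst (asm) ennreal_inj) (auto intro!: expect_steps_bounds assms)
qed

text \<open>I.i.d. steps are exchangeable: the induction moves the first step to the end by
  commuting two draws. This invariance is what makes \<open>h\<close> monotone.\<close>

lemma expect_steps_rev: "expect_steps p n (\<lambda>xs. f (rev xs)) = expect_steps p n f"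
proof -
  have "map_pmf rev (replicate_pmf n p) = replicate_pmf n p"
  proof (induction n)
    case (Suc n)
    have "replicate_pmf (n + 1) p = replicate_pmf n p \<bind> (\<lambda>xs. p \<bind> (\<lambda>x. return_pmf (xs @ [x])))"
      unfolding replicate_pmf_distrib replicate_pmf_1 by (simp add: bind_map_pmf)
    also have "\<dots> = p \<bind> (\<lambda>x. replicate_pmf n p \<bind> (\<lambda>xs. return_pmf (xs @ [x])))"
      by (rule bind_commute_pmf)
    also have "\<dots> = p \<bind> (\<lambda>x. map_pmf rev (replicate_pmf n p) \<bind> (\<lambda>xs. return_pmf (xs @ [x])))"
      by (simp add: Suc.IH)
    also have "\<dots> = map_pmf rev (replicate_pmf (Suc n) p)"
      by (simp add: map_bind_pmf bind_map_pmf)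
    finally show ?case by simp
  qed simp
  then show ?thesis by (metis integral_map_pmf)
qed

section \<open>Laplace functionals of a walk in a random trapping environment\<close>

lemma expect_steps_prod:
  assumes f: "\<And>xs. length xs = n \<Longrightarrow> 0 \<le> f xs" "\<And>xs. length xs = n \<Longrightarrow> f xs \<le> B"
    and h: "\<And>xs. length xs = m \<Longrightarrow> 0 \<le> h xs" "\<And>xs. length xs = m \<Longrightarrow> h xs \<le> C"
  shows "expect_steps p (n + m) (\<lambda>xs. f (take n xs) * h (drop n xs))
    = expect_steps p n f * expect_steps p m h"
proof -
  have "0 \<le> B"
    using f[of "replicate n undefined"] by (meson length_replicate order_trans)
  then have "expect_steps p (n + m) (\<lambda>xs. f (take n xs) * h (drop n xs))
      = expect_steps p n (\<lambda>xs. expect_steps p m (\<lambda>ys. f (take n (xs @ ys)) * h (drop n (xs @ ys))))"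
    by (intro expect_steps_append[where B = "B * C"]) (auto intro!: f h mult_mono mult_nonneg_nonneg)
  also have "\<dots> = expect_steps p n (\<lambda>xs. f xs * expect_steps p m h)"
    by (intro expect_steps_cong) simp
  finally show ?thesis by simp
qed

lemma expect_steps_take:
  assumes "m \<le> n" and f: "\<And>xs. length xs = m \<Longrightarrow> 0 \<le> f xs" "\<And>xs. length xs = m \<Longrightarrow> f xs \<le> B"
  shows "expect_steps p n (\<lambda>xs. f (take m xs)) = expect_steps p m f"
  using expect_steps_prod[of m f B "n - m" "\<lambda>_. 1" 1 p] assms by simp

section \<open>Paths as lists of steps: positions, visits and visited sites\<close>

definition pos :: "'a::monoid_add list \<Rightarrow> nat \<Rightarrow> 'a" where
  "pos xs k = sum_list (take k xs)"

text \<open>The end point of the path is excluded: a list of \<open>n\<close> steps stands for the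
  times \<open>0\<close> to \<open>n - 1\<close> that enter the clock at \<open>n\<close>, and
  concatenation then splits the visits disjointly.\<close>

definition visits :: "'a::monoid_add list \<Rightarrow> 'a \<Rightarrow> nat set" where
  "visits xs x = {k. k < length xs \<and> pos xs k = x}"

definition sites :: "'a::monoid_add list \<Rightarrow> 'a set" where
  "sites xs = pos xs ` {..<length xs}"

lemma finite_visits [simp]: "finite (visits xs x)" and finite_sites [simp]: "finite (sites xs)"
  by (auto simp: visits_def sites_def)

lemma visits_eq_empty: "visits xs x = {} \<longleftrightarrow> x \<notin> sites xs"
  by (auto simp: visits_def sites_def)

lemma pos_append_left: "k \<le> length xs \<Longrightarrow> pos (xs @ ys) k = pos xs k"
  by (simp add: pos_def)

lemma pos_append_right: "pos (xs @ ys) (length xs + k) = sum_list xs + pos ys k"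
  by (simp add: pos_def)

lemma visits_append:
  fixes xs :: "'a::ab_group_add list"
  shows "visits (xs @ ys) x = visits xs x \<union> (+) (length xs) ` visits ys (x - sum_list xs)"
proof (intro set_eqI iffI)
  fix k assume k: "k \<in> visits (xs @ ys) x"
  show "k \<in> visits xs x \<union> (+) (length xs) ` visits ys (x - sum_list xs)"
  proof (cases "k < length xs")
    case True
    then show ?thesis using k by (auto simp: visits_def pos_append_left)
  next
    case False
    then obtain j where j: "k = length xs + j" using le_Suc_ex not_less by blast
    then have "j \<in> visits ys (x - sum_list xs)"
      using k by (auto simp: visits_def pos_append_right)
    then show ?thesis using j by blast
  qed
qed (auto simp: visits_def pos_append_left pos_append_right)

lemma visits_append_disjoint: "visits xs x \<inter> (+) (length xs) ` B = {}"
  by (auto simp: visits_def)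

lemma card_visits_append:
  fixes xs :: "'a::ab_group_add list"
  shows "card (visits (xs @ ys) x) = card (visits xs x) + card (visits ys (x - sum_list xs))"
  by (simp add: visits_append card_Un_disjoint visits_append_disjoint card_image)

lemma sites_append:
  fixes xs :: "'a::ab_group_add list"
  shows "sites (xs @ ys) = sites xs \<union> (+) (sum_list xs) ` sites ys"
proof -
  have "x \<in> sites (xs @ ys) \<longleftrightarrow> x \<in> sites xs \<or> x - sum_list xs \<in> sites ys" for x
    using visits_eq_empty[of "xs @ ys" x] visits_eq_empty[of xs x]
      visits_eq_empty[of ys "x - sum_list xs"] by (auto simp: visits_append)
  moreover have "x \<in> (+) (sum_list xs) ` sites ys \<longleftrightarrow> x - sum_list xs \<in> sites ys" for x
    by (force simp: image_iff)
  ultimately show ?thesis by blast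
qed

text \<open>The product \<open>(1 - x + x\<^sup>2 / 2) * (1 + x + x\<^sup>2 / 2)\<close> equals
  \<open>1 + x ^ 4 / 4\<close>, hence is at least \<open>1\<close>, and its second factor is at most
  \<open>exp x\<close>.\<close>

lemma exp_minus_le_quadratic:
  fixes x :: real
  assumes "0 \<le> x"
  shows "exp (- x) \<le> 1 - x + x\<^sup>2 / 2"
proof -
  have "1 \<le> 1 + x ^ 4 / 4" by simp
  also have "\<dots> = (1 - x + x\<^sup>2 / 2) * (1 + x + x\<^sup>2 / 2)"
    by (simp add: power2_eq_square power4_eq_xxxx field_simps)
  also have "\<dots> \<le> (1 - x + x\<^sup>2 / 2) * exp x"
  proof (rule mult_left_mono)
    show "0 \<le> 1 - x + x\<^sup>2 / 2" using zero_le_power2[of "1 - x"] by (simp add: power2_eq_square algebra_simps)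
  qed (use exp_lower_Taylor_quadratic[OF assms] in simp)
  finally show ?thesis by (simp add: exp_minus field_simps)
qed

text \<open>A random environment at one site enters only through \<open>q \<theta>\<close>, the Laplace transform at \<open>\<theta>\<close> of
  its trapping law; \<open>Phi w K\<close> averages the joint Laplace transform of the holding times of the
  visits \<open>k \<in> K\<close> to one site, with arguments \<open>w k\<close>.\<close>

locale trap_walk = prob_space E for E :: "'e measure" +
  fixes q :: "real \<Rightarrow> 'e \<Rightarrow> real" and \<nu> :: "'a::ab_group_add pmf"
  assumes q_measurable [measurable]: "\<And>\<theta>. q \<theta> \<in> borel_measurable E"
    and q_nonneg: "\<And>\<theta> e. e \<in> space E \<Longrightarrow> 0 \<le> q \<theta> e"
    and q_le_1: "\<And>\<theta> e. e \<in> space E \<Longrightarrow> 0 \<le> \<theta> \<Longrightarrow> q \<theta> e \<le> 1"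
    and q_antimono: "\<And>\<theta> \<theta>' e. e \<in> space E \<Longrightarrow> 0 \<le> \<theta> \<Longrightarrow> \<theta> \<le> \<theta>' \<Longrightarrow> q \<theta>' e \<le> q \<theta> e"
    and q_double: "\<And>\<theta> e. e \<in> space E \<Longrightarrow> 0 \<le> \<theta> \<Longrightarrow> (q \<theta> e)\<^sup>2 \<le> q (2 * \<theta>) e"
    and q_0: "\<And>e. e \<in> space E \<Longrightarrow> q 0 e = 1"
begin

definition Phi :: "(nat \<Rightarrow> real) \<Rightarrow> nat set \<Rightarrow> real" where
  "Phi w K = (\<integral>e. (\<Prod>k\<in>K. q (w k) e) \<partial>E)"

definition W :: "(nat \<Rightarrow> real) \<Rightarrow> 'a list \<Rightarrow> real" where
  "W w xs = (\<Prod>x\<in>sites xs. Phi w (visits xs x))"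

definition Z :: "(nat \<Rightarrow> real) \<Rightarrow> nat \<Rightarrow> real" where
  "Z w n = expect_steps \<nu> n (W w)"

text \<open>For a Laplace transform \<open>q\<close> and \<theta> > 0, this is the probability that
  an independent exponential clock of rate \<theta> rings during \<open>j\<close> visits to one
  site: a bounded substitute for the possibly infinite mean holding time.\<close>

definition g :: "real \<Rightarrow> nat \<Rightarrow> real" where
  "g \<theta> j = 1 - (\<integral>e. q \<theta> e ^ j \<partial>E)"

definition G :: "real \<Rightarrow> 'a list \<Rightarrow> real" where
  "G \<theta> xs = (\<Sum>x\<in>sites xs. g \<theta> (card (visits xs x)))"

lemma integrable_01:
  assumes [measurable]: "f \<in> borel_measurable E"
    and "\<And>e. e \<in> space E \<Longrightarrow> 0 \<le> f e" "\<And>e. e \<in> space E \<Longrightarrow> f e \<le> (1::real)"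
  shows "integrable E f"
  by (rule integrable_const_bound[where B = 1]) (auto simp: assms)

lemma prod_q_bounds:
  assumes "e \<in> space E" "\<And>k. k \<in> K \<Longrightarrow> 0 \<le> w k"
  shows "0 \<le> (\<Prod>k\<in>K. q (w k) e)" "(\<Prod>k\<in>K. q (w k) e) \<le> 1"
  using assms by (auto intro!: prod_nonneg prod_le_1 q_nonneg q_le_1)

lemma integrable_prod_q:
  assumes "\<And>k. k \<in> K \<Longrightarrow> 0 \<le> w k"
  shows "integrable E (\<lambda>e. \<Prod>k\<in>K. q (w k) e)"
  using assms by (intro integrable_01 prod_q_bounds) auto

lemma Phi_bounds:
  assumes "\<And>k. k \<in> K \<Longrightarrow> 0 \<le> w k"
  shows "0 \<le> Phi w K" "Phi w K \<le> 1"
proof -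
  show "0 \<le> Phi w K"
    unfolding Phi_def by (intro Bochner_Integration.integral_nonneg prod_q_bounds assms)
  have "Phi w K \<le> (\<integral>e. 1 \<partial>E)"
    unfolding Phi_def by (intro integral_mono integrable_prod_q prod_q_bounds assms) auto
  then show "Phi w K \<le> 1" by (simp add: prob_space)
qed

lemma Phi_empty [simp]: "Phi w {} = 1"
  by (simp add: Phi_def prob_space)

lemma Phi_shift: "Phi w ((+) n ` K) = Phi (\<lambda>k. w (n + k)) K"
  by (simp add: Phi_def prod.reindex)

text \<open>For a, b with values in [0, 1], both the mean of the product and the product of the
  means lie between E b - (1 - E a) and E b. Only the deficit of \<open>K\<close> enters, whatever
  the later visits \<open>L\<close> are.\<close>

lemma Phi_Un:
  assumes "\<And>k. k \<in> K \<union> L \<Longrightarrow> 0 \<le> w k" "finite K" "finite L" "K \<inter> L = {}"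
  shows "\<bar>Phi w (K \<union> L) - Phi w K * Phi w L\<bar> \<le> 1 - Phi w K"
proof -
  let ?a = "\<lambda>e. \<Prod>k\<in>K. q (w k) e" and ?b = "\<lambda>e. \<Prod>k\<in>L. q (w k) e"
  have KL: "Phi w (K \<union> L) = (\<integral>e. ?a e * ?b e \<partial>E)"
    unfolding Phi_def by (simp add: prod.union_disjoint assms)
  have a: "0 \<le> ?a e" "?a e \<le> 1" and b: "0 \<le> ?b e" "?b e \<le> 1" if "e \<in> space E" for e
    using that assms(1) by (auto intro!: prod_q_bounds)
  have ia: "integrable E ?a" and ib: "integrable E ?b" using assms(1) by (auto intro!: integrable_prod_q)
  have iab: "integrable E (\<lambda>e. ?a e * ?b e)"
    by (rule integrable_01) (auto intro!: a b mult_le_one mult_nonneg_nonneg)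
  have "Phi w (K \<union> L) \<le> Phi w L"
    unfolding KL unfolding Phi_def
    by (intro integral_mono iab ib) (use a b in \<open>auto intro: mult_left_le_one_le\<close>)
  moreover have "(\<integral>e. ?b e - (1 - ?a e) \<partial>E) \<le> Phi w (K \<union> L)"
    unfolding KL
  proof (intro integral_mono iab)
    show "?b e - (1 - ?a e) \<le> ?a e * ?b e" if "e \<in> space E" for e
      using mult_nonneg_nonneg[of "1 - ?a e" "1 - ?b e"] a[OF that] b[OF that]
      by (simp add: algebra_simps)
  qed (use ia ib in auto)
  then have "Phi w L - (1 - Phi w K) \<le> Phi w (K \<union> L)"
    using ia ib by (simp add: Phi_def prob_space)
  moreover have "0 \<le> Phi w K" "Phi w K \<le> 1" "0 \<le> Phi w L" "Phi w L \<le> 1"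
    using assms(1) by (auto intro!: Phi_bounds)
  moreover have "Phi w L * (1 - Phi w K) \<le> 1 - Phi w K" "0 \<le> Phi w L * (1 - Phi w K)"
    using calculation by (auto intro!: mult_left_le_one_le)
  ultimately show ?thesis by (simp add: algebra_simps abs_le_iff)
qed

lemma q_power_bounds:
  assumes "e \<in> space E" "0 \<le> \<theta>"
  shows "0 \<le> q \<theta> e ^ j" "q \<theta> e ^ j \<le> 1"
  using assms by (auto intro!: power_le_one zero_le_power q_nonneg q_le_1)

lemma integrable_q_power: "0 \<le> \<theta> \<Longrightarrow> integrable E (\<lambda>e. q \<theta> e ^ j)"
  by (rule integrable_01) (auto intro!: q_power_bounds)

lemma one_minus_Phi_le:
  assumes "\<And>k. k \<in> K \<Longrightarrow> 0 \<le> w k" "\<And>k. k \<in> K \<Longrightarrow> w k \<le> \<theta>"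
  shows "1 - Phi w K \<le> g \<theta> (card K)"
proof (cases "finite K \<and> K \<noteq> {}")
  case True
  then have "0 \<le> \<theta>" using assms by fastforce
  then have "(\<integral>e. q \<theta> e ^ card K \<partial>E) \<le> Phi w K"
    unfolding Phi_def
    by (intro integral_mono integrable_prod_q integrable_q_power)
       (auto intro!: prod_mono q_nonneg q_antimono simp: assms simp flip: prod_constant)
  then show ?thesis by (simp add: g_def)
qed (auto simp: g_def Phi_def prob_space)

lemma g_0 [simp]: "g \<theta> 0 = 0"
  by (simp add: g_def prob_space)

lemma g_le_1: "g \<theta> j \<le> 1"
  unfolding g_def by (auto intro!: Bochner_Integration.integral_nonneg zero_le_power q_nonneg)

lemma g_mono: "0 \<le> \<theta> \<Longrightarrow> i \<le> j \<Longrightarrow> g \<theta> i \<le> g \<theta> j"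
  unfolding g_def
  by (auto intro!: integral_mono integrable_q_power power_decreasing q_nonneg q_le_1)

lemma g_nonneg: "0 \<le> \<theta> \<Longrightarrow> 0 \<le> g \<theta> j"
  using g_mono[of \<theta> 0 j] by simp

text \<open>Follows from \<open>(1 - a) * (1 - b) \<ge> 0\<close> in each fixed environment,
  although the two groups of visits share their trapping law.\<close>

lemma g_add:
  assumes "0 \<le> \<theta>"
  shows "g \<theta> (i + j) \<le> g \<theta> i + g \<theta> j"
proof -
  have "(\<integral>e. q \<theta> e ^ i + q \<theta> e ^ j - 1 \<partial>E) \<le> (\<integral>e. q \<theta> e ^ (i + j) \<partial>E)"
  proof (intro integral_mono)
    show "q \<theta> e ^ i + q \<theta> e ^ j - 1 \<le> q \<theta> e ^ (i + j)" if "e \<in> space E" for e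
      using mult_nonneg_nonneg[of "1 - q \<theta> e ^ i" "1 - q \<theta> e ^ j"] q_power_bounds[OF that assms]
      by (simp add: algebra_simps power_add)
  qed (use integrable_q_power[OF assms] in auto)
  also have "(\<integral>e. q \<theta> e ^ i + q \<theta> e ^ j - 1 \<partial>E)
      = (\<integral>e. q \<theta> e ^ i \<partial>E) + (\<integral>e. q \<theta> e ^ j \<partial>E) - 1"
    using integrable_q_power[OF assms] by (simp add: prob_space)
  finally show ?thesis by (simp add: g_def)
qed

text \<open>Combines \<open>2 * x - 1 \<le> x\<^sup>2\<close> with \<open>q_double\<close>. A bound
  at one argument is thereby carried to larger arguments at the price of a constant factor.\<close>

lemma g_double:
  assumes "0 \<le> \<theta>"
  shows "g (2 * \<theta>) j \<le> 2 * g \<theta> j"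
proof -
  have "(\<integral>e. 2 * q \<theta> e ^ j - 1 \<partial>E) \<le> (\<integral>e. q (2 * \<theta>) e ^ j \<partial>E)"
  proof (intro integral_mono)
    fix e assume e: "e \<in> space E"
    have "2 * q \<theta> e ^ j - 1 \<le> (q \<theta> e ^ j)\<^sup>2"
      using zero_le_power2[of "q \<theta> e ^ j - 1"] by (simp add: power2_eq_square algebra_simps)
    also have "\<dots> = ((q \<theta> e)\<^sup>2) ^ j"
      by (simp add: power_mult[symmetric] mult.commute)
    also have "\<dots> \<le> q (2 * \<theta>) e ^ j"
      by (intro power_mono q_double e assms) simp
    finally show "2 * q \<theta> e ^ j - 1 \<le> q (2 * \<theta>) e ^ j" .
  qed (use integrable_q_power[of \<theta>] integrable_q_power[of "2 * \<theta>"] assms in auto)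
  also have "(\<integral>e. 2 * q \<theta> e ^ j - 1 \<partial>E) = 2 * (\<integral>e. q \<theta> e ^ j \<partial>E) - 1"
    using integrable_q_power[OF assms] by (simp add: prob_space)
  finally show ?thesis by (simp add: g_def)
qed

lemma g_mono_arg: "0 \<le> \<theta> \<Longrightarrow> \<theta> \<le> \<theta>' \<Longrightarrow> g \<theta> j \<le> g \<theta>' j"
  unfolding g_def
  by (auto intro!: integral_mono integrable_q_power power_mono q_nonneg q_antimono)

text \<open>An unvisited site contributes the neutral factor \<open>Phi w {} = 1\<close>, so paths
  with different sites can be compared over one common index set. The shifted variants below serve
  the second piece of a concatenation, which starts at the end point of the first.\<close>

lemma W_superset:
  assumes "finite A" "sites xs \<subseteq> A"
  shows "W w xs = (\<Prod>x\<in>A. Phi w (visits xs x))"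
  unfolding W_def using assms
  by (intro prod.mono_neutral_left) (auto simp: visits_eq_empty[THEN iffD2])

lemma G_superset:
  assumes "finite A" "sites xs \<subseteq> A"
  shows "G \<theta> xs = (\<Sum>x\<in>A. g \<theta> (card (visits xs x)))"
  unfolding G_def using assms
  by (intro sum.mono_neutral_left) (auto simp: visits_eq_empty[THEN iffD2])

lemma G_shift:
  assumes "finite A" "(+) s ` sites xs \<subseteq> A"
  shows "G \<theta> xs = (\<Sum>x\<in>A. g \<theta> (card (visits xs (x - s))))"
proof -
  have "(\<Sum>x\<in>A. g \<theta> (card (visits xs (x - s)))) = (\<Sum>x\<in>(\<lambda>x. x - s) ` A. g \<theta> (card (visits xs x)))"
    by (subst sum.reindex) (auto simp: inj_on_def)
  moreover have "sites xs \<subseteq> (\<lambda>x. x - s) ` A"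
    using assms(2) by (force intro: image_eqI[where x = "s + x" for x])
  ultimately show ?thesis
    using assms(1) by (simp add: G_superset[where A = "(\<lambda>x. x - s) ` A"])
qed

lemma W_shift:
  assumes "finite A" "(+) s ` sites xs \<subseteq> A"
  shows "W w xs = (\<Prod>x\<in>A. Phi w (visits xs (x - s)))"
proof -
  have "(\<Prod>x\<in>A. Phi w (visits xs (x - s))) = (\<Prod>x\<in>(\<lambda>x. x - s) ` A. Phi w (visits xs x))"
    by (subst prod.reindex) (auto simp: inj_on_def)
  moreover have "sites xs \<subseteq> (\<lambda>x. x - s) ` A"
    using assms(2) by (force intro: image_eqI[where x = "s + x" for x])
  ultimately show ?thesis
    using assms(1) by (simp add: W_superset[where A = "(\<lambda>x. x - s) ` A"])
qed

lemma W_bounds: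
  assumes "\<And>k. k < length xs \<Longrightarrow> 0 \<le> w k"
  shows "0 \<le> W w xs" "W w xs \<le> 1"
  unfolding W_def using assms
  by (auto intro!: prod_nonneg prod_le_1 Phi_bounds simp: visits_def)

text \<open>A product of factors bounded by \<open>1\<close> changes by at most the sum of the
  changes of its factors. A factor changes only at a site visited by both pieces, and there
  \<open>Phi_Un\<close> charges the deficit of the first piece.\<close>

lemma W_append:
  assumes w: "\<And>k. 0 \<le> w k" "\<And>k. k < length xs \<Longrightarrow> w k \<le> \<theta>" and "0 \<le> \<theta>"
  shows "\<bar>W w (xs @ ys) - W w xs * W (\<lambda>k. w (length xs + k)) ys\<bar>
    \<le> (\<Sum>x\<in>sites xs \<inter> (+) (sum_list xs) ` sites ys. g \<theta> (card (visits xs x)))"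
proof -
  let ?A = "sites (xs @ ys)" and ?w = "\<lambda>k. w (length xs + k)" and ?s = "sum_list xs"
  let ?a = "\<lambda>x. Phi w (visits (xs @ ys) x)"
  let ?b = "\<lambda>x. Phi w (visits xs x) * Phi ?w (visits ys (x - ?s))"
  have "W w xs * W ?w ys = (\<Prod>x\<in>?A. ?b x)"
    by (subst W_superset[where A = ?A], simp, simp add: sites_append,
        subst W_shift[where A = ?A and s = ?s], simp, simp add: sites_append,
        simp add: prod.distrib)
  then have "\<bar>W w (xs @ ys) - W w xs * W ?w ys\<bar> = \<bar>(\<Prod>x\<in>?A. ?a x) - (\<Prod>x\<in>?A. ?b x)\<bar>"
    by (simp add: W_def)
  also have "\<dots> \<le> (\<Sum>x\<in>?A. \<bar>?a x - ?b x\<bar>)"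
  proof -
    have "\<bar>?a x\<bar> \<le> 1" "\<bar>?b x\<bar> \<le> 1" for x
      using w(1) by (auto simp: abs_mult abs_of_nonneg Phi_bounds intro!: mult_le_one)
    then show ?thesis using norm_prod_diff[of ?A ?a ?b] by simp
  qed
  also have "\<dots> \<le> (\<Sum>x\<in>?A. if x \<in> sites xs \<inter> (+) ?s ` sites ys then g \<theta> (card (visits xs x)) else 0)"
  proof (intro sum_mono)
    fix x assume x: "x \<in> ?A"
    have split: "?a x = Phi w (visits xs x \<union> (+) (length xs) ` visits ys (x - ?s))"
      by (simp add: visits_append)
    have b: "?b x = Phi w (visits xs x) * Phi w ((+) (length xs) ` visits ys (x - ?s))"
      by (simp add: Phi_shift)
    show "\<bar>?a x - ?b x\<bar> \<le> (if x \<in> sites xs \<inter> (+) ?s ` sites ys then g \<theta> (card (visits xs x)) else 0)"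
    proof (cases "x \<in> sites xs \<inter> (+) ?s ` sites ys")
      case True
      have "\<bar>?a x - ?b x\<bar> \<le> 1 - Phi w (visits xs x)"
        unfolding split b by (rule Phi_Un) (auto simp: w visits_append_disjoint)
      also have "\<dots> \<le> g \<theta> (card (visits xs x))"
        by (rule one_minus_Phi_le) (auto simp: w visits_def)
      finally show ?thesis using True by simp
    next
      case False
      then have "visits xs x = {} \<or> visits ys (x - ?s) = {}"
        by (auto simp: visits_eq_empty image_iff algebra_simps)
      then show ?thesis using False unfolding split b by auto
    qed
  qed
  also have "\<dots> = (\<Sum>x\<in>sites xs \<inter> (+) ?s ` sites ys. g \<theta> (card (visits xs x)))"
    by (subst sum.inter_restrict[symmetric])
       (auto simp: sites_append Int_absorb1 intro!: sum.cong)
  finally show ?thesis .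
qed

section \<open>Subadditivity and moments of \<open>G\<close>\<close>

lemma G_nonneg: "0 \<le> \<theta> \<Longrightarrow> 0 \<le> G \<theta> xs"
  by (simp add: G_def sum_nonneg g_nonneg)

lemma G_append_le:
  assumes "0 \<le> \<theta>"
  shows "G \<theta> (xs @ ys) \<le> G \<theta> xs + G \<theta> ys"
proof -
  have "G \<theta> xs + G \<theta> ys = (\<Sum>x\<in>sites (xs @ ys). g \<theta> (card (visits xs x)) + g \<theta> (card (visits ys (x - sum_list xs))))"
    by (subst G_superset[where A = "sites (xs @ ys)"], simp, simp add: sites_append,
        subst G_shift[where A = "sites (xs @ ys)" and s = "sum_list xs"], simp, simp add: sites_append,
        simp add: sum.distrib)
  then show ?thesis
    unfolding G_def by (simp add: card_visits_append sum_mono g_add assms)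
qed

lemma G_append_ge:
  assumes "0 \<le> \<theta>"
  shows "G \<theta> xs \<le> G \<theta> (xs @ ys)"
  by (subst G_superset[where A = "sites (xs @ ys)"])
     (auto simp: sites_append G_def[of _ "xs @ ys"] card_visits_append intro!: sum_mono g_mono assms)

lemma G_le_length: "0 \<le> \<theta> \<Longrightarrow> G \<theta> xs \<le> length xs"
proof -
  have "G \<theta> xs \<le> (\<Sum>x\<in>sites xs. 1)"
    unfolding G_def by (intro sum_mono g_le_1)
  also have "\<dots> \<le> length xs"
    using card_image_le[of "{..<length xs}" "pos xs"] by (simp add: sites_def)
  finally show ?thesis .
qed

lemma G_double: "0 \<le> \<theta> \<Longrightarrow> G (2 * \<theta>) xs \<le> 2 * G \<theta> xs"
  unfolding G_def sum_distrib_left by (intro sum_mono g_double)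

lemma G_mono_arg: "0 \<le> \<theta> \<Longrightarrow> \<theta> \<le> \<theta>' \<Longrightarrow> G \<theta> xs \<le> G \<theta>' xs"
  unfolding G_def by (intro sum_mono g_mono_arg)

lemma W_const_le:
  assumes "0 \<le> \<theta>"
  shows "W (\<lambda>_. \<theta>) xs \<le> exp (- G \<theta> xs)"
proof -
  have "W (\<lambda>_. \<theta>) xs = (\<Prod>x\<in>sites xs. 1 - g \<theta> (card (visits xs x)))"
    by (simp add: W_def Phi_def g_def)
  also have "\<dots> \<le> (\<Prod>x\<in>sites xs. exp (- g \<theta> (card (visits xs x))))"
  proof (intro prod_mono conjI)
    show "1 - g \<theta> (card (visits xs i)) \<le> exp (- g \<theta> (card (visits xs i)))" for i
      using exp_ge_add_one_self[of "- g \<theta> (card (visits xs i))"] by simp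
  qed (use g_le_1 in auto)
  also have "\<dots> = exp (- G \<theta> xs)"
    by (simp add: G_def exp_sum flip: sum_negf)
  finally show ?thesis .
qed

abbreviation meanG :: "real \<Rightarrow> nat \<Rightarrow> real" where
  "meanG \<theta> n \<equiv> expect_steps \<nu> n (G \<theta>)"

lemma meanG_mono:
  assumes "0 \<le> \<theta>" "m \<le> n"
  shows "meanG \<theta> m \<le> meanG \<theta> n"
proof -
  have "meanG \<theta> m = expect_steps \<nu> n (\<lambda>xs. G \<theta> (take m xs))"
    using assms G_le_length[of \<theta>] by (intro expect_steps_take[symmetric, where B = m]) (auto simp: G_nonneg)
  also have "\<dots> \<le> meanG \<theta> n"
  proof (rule expect_steps_mono[where B = n and C = n])
    fix xs :: "'a list" assume xs: "length xs = n"
    show *: "G \<theta> (take m xs) \<le> G \<theta> xs"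
      using G_append_ge[of \<theta> "take m xs" "drop m xs"] assms by simp
    show "\<bar>G \<theta> xs\<bar> \<le> n"
      using G_le_length[of \<theta> xs] G_nonneg[of \<theta>] assms xs by auto
    then show "\<bar>G \<theta> (take m xs)\<bar> \<le> n"
      using * G_nonneg[of \<theta>] assms by auto
  qed
  finally show ?thesis .
qed

text \<open>The increments \<open>D k\<close> of \<open>G\<close> along the path lie in \<open>[0, 1]\<close>, and by subadditivity what
  accumulates after step \<open>k\<close> is bounded by an independent copy of \<open>G\<close>; expanding the square as
  \<open>\<Sum>k. D k * (2 * (G n - G (k + 1)) + D k)\<close> therefore gives a bound without any variance estimate.\<close>

lemma second_moment_G:
  assumes \<theta>: "0 \<le> \<theta>"
  shows "expect_steps \<nu> n (\<lambda>xs. (G \<theta> xs)\<^sup>2) \<le> 2 * (meanG \<theta> n)\<^sup>2 + meanG \<theta> n"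
proof -
  let ?G = "G \<theta>" and ?m = "meanG \<theta> n"
  define D where "D k xs = ?G xs - ?G (take k xs)" for k and xs :: "'a list"
  have D: "0 \<le> D k xs" "D k xs \<le> 1" if "length xs = Suc k" for k xs
  proof -
    have "?G (drop k xs) \<le> 1" using that G_le_length[OF \<theta>, of "drop k xs"] by simp
    then show "0 \<le> D k xs" "D k xs \<le> 1"
      using G_append_ge[OF \<theta>, of "take k xs" "drop k xs"] G_append_le[OF \<theta>, of "take k xs" "drop k xs"]
      by (simp_all add: D_def)
  qed
  have G: "0 \<le> ?G xs" "?G xs \<le> length xs" for xs
    using \<theta> by (simp_all add: G_nonneg G_le_length)
  have telescope: "(?G xs)\<^sup>2 = (\<Sum>k<n. D k (take (Suc k) xs) *
      (2 * (?G xs - ?G (take (Suc k) xs)) + D k (take (Suc k) xs)))" if "length xs = n" for xs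
  proof -
    \<comment> \<open>\<open>T k\<close> is the square of \<open>G\<close> of the whole path minus
      the square of what is gained after step \<open>k\<close>; it vanishes at \<open>0\<close> and
      is the full square at \<open>n\<close>.\<close>
    define T where "T k = 2 * ?G (take k xs) * ?G xs - (?G (take k xs))\<^sup>2" for k
    have "T (Suc k) - T k = D k (take (Suc k) xs) *
      (2 * (?G xs - ?G (take (Suc k) xs)) + D k (take (Suc k) xs))" for k
      by (simp add: T_def D_def power2_eq_square algebra_simps)
    then have "(\<Sum>k<n. D k (take (Suc k) xs) *
      (2 * (?G xs - ?G (take (Suc k) xs)) + D k (take (Suc k) xs))) = (\<Sum>k<n. T (Suc k) - T k)"
      by simp
    also have "\<dots> = T n - T 0"
      by (rule sum_lessThan_telescope)
    also have "\<dots> = (?G xs)\<^sup>2"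
      using that by (simp add: T_def power2_eq_square G_def sites_def)
    finally show ?thesis ..
  qed
  have bound: "(?G xs)\<^sup>2 \<le> (\<Sum>k<n. 2 * (D k (take (Suc k) xs) * ?G (drop (Suc k) xs)) + D k (take (Suc k) xs))"
    if "length xs = n" for xs
    unfolding telescope[OF that]
  proof (intro sum_mono)
    fix k assume k: "k \<in> {..<n}"
    let ?d = "D k (take (Suc k) xs)"
    have d: "0 \<le> ?d" "?d \<le> 1" using D[of "take (Suc k) xs" k] k that by auto
    have "?G xs - ?G (take (Suc k) xs) \<le> ?G (drop (Suc k) xs)"
      using G_append_le[OF \<theta>, of "take (Suc k) xs" "drop (Suc k) xs"] by simp
    then have "?d * (2 * (?G xs - ?G (take (Suc k) xs)) + ?d) \<le> ?d * (2 * ?G (drop (Suc k) xs) + 1)"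
      using d by (intro mult_left_mono) auto
    then show "?d * (2 * (?G xs - ?G (take (Suc k) xs)) + ?d) \<le> 2 * (?d * ?G (drop (Suc k) xs)) + ?d"
      by (simp add: algebra_simps)
  qed
  \<comment> \<open>\<open>D k\<close> reads the first \<open>k + 1\<close> steps and the other
    factor reads the remaining ones, so the expectation factorizes.\<close>
  have prod: "expect_steps \<nu> n (\<lambda>xs. D k (take (Suc k) xs) * ?G (drop (Suc k) xs))
      \<le> expect_steps \<nu> n (\<lambda>xs. D k (take (Suc k) xs)) * ?m" if "k < n" for k
  proof -
    have n: "n = Suc k + (n - Suc k)" using that by simp
    have "expect_steps \<nu> (Suc k + (n - Suc k)) (\<lambda>xs. D k (take (Suc k) xs) * ?G (drop (Suc k) xs))
        = expect_steps \<nu> (Suc k) (D k) * meanG \<theta> (n - Suc k)"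
      by (rule expect_steps_prod[where B = 1 and C = "n - Suc k"])
         (use D G in \<open>auto simp del: of_nat_diff\<close>, metis G(2))
    also have "\<dots> \<le> expect_steps \<nu> (Suc k) (D k) * ?m"
      using expect_steps_bounds(1)[of "Suc k" "D k" 1] D
      by (intro mult_left_mono meanG_mono \<theta>) auto
    also have "expect_steps \<nu> (Suc k) (D k) = expect_steps \<nu> n (\<lambda>xs. D k (take (Suc k) xs))"
      using that D by (intro expect_steps_take[symmetric, where B = 1]) auto
    finally show ?thesis using n by simp
  qed
  have int1: "integrable (replicate_pmf n \<nu>) (\<lambda>xs. D k (take (Suc k) xs))" if "k < n" for k
    using D that by (intro integrable_steps[where B = 1]) auto
  have int2: "integrable (replicate_pmf n \<nu>) (\<lambda>xs. D k (take (Suc k) xs) * ?G (drop (Suc k) xs))"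
    if "k < n" for k
  proof (rule integrable_steps[where B = n])
    fix xs :: "'a list" assume xs: "length xs = n"
    have d: "0 \<le> D k (take (Suc k) xs)" "D k (take (Suc k) xs) \<le> 1" 
      using D[of "take (Suc k) xs" k] that xs by auto
    have "?G (drop (Suc k) xs) \<le> n" using G(2)[of "drop (Suc k) xs"] xs by simp
    then have "D k (take (Suc k) xs) * ?G (drop (Suc k) xs) \<le> 1 * real n"
      using d G by (intro mult_mono) auto
    then show "\<bar>D k (take (Suc k) xs) * ?G (drop (Suc k) xs)\<bar> \<le> n"
      using d G by (simp add: abs_mult)
  qed
  have int3: "integrable (replicate_pmf n \<nu>) (\<lambda>xs. (?G xs)\<^sup>2)"
    using G by (intro integrable_steps[where B = "(real n)\<^sup>2"]) (auto intro!: power_mono)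
  have "expect_steps \<nu> n (\<lambda>xs. (?G xs)\<^sup>2)
      \<le> expect_steps \<nu> n (\<lambda>xs. \<Sum>k<n. 2 * (D k (take (Suc k) xs) * ?G (drop (Suc k) xs)) + D k (take (Suc k) xs))"
    using int1 int2 int3 bound by (intro expect_steps_mono_integrable) auto
  also have "\<dots> = (\<Sum>k<n. 2 * expect_steps \<nu> n (\<lambda>xs. D k (take (Suc k) xs) * ?G (drop (Suc k) xs))
      + expect_steps \<nu> n (\<lambda>xs. D k (take (Suc k) xs)))"
    using int1 int2 by simp
  also have "\<dots> \<le> (\<Sum>k<n. (2 * ?m + 1) * expect_steps \<nu> n (\<lambda>xs. D k (take (Suc k) xs)))"
  proof (intro sum_mono)
    fix k assume "k \<in> {..<n}"
    then show "2 * expect_steps \<nu> n (\<lambda>xs. D k (take (Suc k) xs) * ?G (drop (Suc k) xs))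
      + expect_steps \<nu> n (\<lambda>xs. D k (take (Suc k) xs))
      \<le> (2 * ?m + 1) * expect_steps \<nu> n (\<lambda>xs. D k (take (Suc k) xs))"
      using prod[of k] by (simp add: algebra_simps)
  qed
  also have "\<dots> = (2 * ?m + 1) * expect_steps \<nu> n (\<lambda>xs. \<Sum>k<n. D k (take (Suc k) xs))"
    using int1 by (simp add: sum_distrib_left)
  also have "expect_steps \<nu> n (\<lambda>xs. \<Sum>k<n. D k (take (Suc k) xs)) = ?m"
  proof (rule expect_steps_cong)
    fix xs :: "'a list" assume xs: "length xs = n"
    have "(\<Sum>k<n. D k (take (Suc k) xs)) = (\<Sum>k<n. ?G (take (Suc k) xs) - ?G (take k xs))"
      by (simp add: D_def)
    also have "\<dots> = ?G xs"
      using xs by (subst sum_lessThan_telescope) (simp add: G_def sites_def)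
    finally show "(\<Sum>k<n. D k (take (Suc k) xs)) = ?G xs" .
  qed
  finally show ?thesis by (simp add: power2_eq_square algebra_simps)
qed

text \<open>Serves by contraposition: a Laplace transform above \<open>5 / 6\<close> keeps the mean
  of \<open>G\<close> below \<open>1\<close>. The bound \<open>W \<le> exp (- G)\<close> alone would
  allow a large mean carried by rare paths; the second moment excludes this.\<close>

lemma Z_const_le:
  assumes \<theta>: "0 \<le> \<theta>" and ge: "1 \<le> meanG \<theta> n"
  shows "Z (\<lambda>_. \<theta>) n \<le> 5 / 6"
proof -
  let ?m = "meanG \<theta> n" and ?s = "expect_steps \<nu> n (\<lambda>xs. (G \<theta> xs)\<^sup>2)"
  \<comment> \<open>With \<open>s \<le> 3 * m\<^sup>2\<close>, this choice minimizes \<open>1 - t * m + t\<^sup>2 / 2 * s\<close>.\<close>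
  define t where "t = 1 / (3 * ?m)"
  have t: "0 \<le> t" "t \<le> 1" using ge by (auto simp: t_def)
  have G: "0 \<le> G \<theta> xs" "G \<theta> xs \<le> length xs" for xs
    using \<theta> by (simp_all add: G_nonneg G_le_length)
  have int: "integrable (replicate_pmf n \<nu>) (G \<theta>)" "integrable (replicate_pmf n \<nu>) (\<lambda>xs. (G \<theta> xs)\<^sup>2)"
    using G by (auto intro!: integrable_steps[where B = n and f = "G \<theta>"]
        integrable_steps[where B = "(real n)\<^sup>2" and f = "\<lambda>xs. (G \<theta> xs)\<^sup>2"] power_mono)
  have "W (\<lambda>_. \<theta>) xs \<le> 1 - t * G \<theta> xs + t\<^sup>2 / 2 * (G \<theta> xs)\<^sup>2" for xs
  proof -
    have "W (\<lambda>_. \<theta>) xs \<le> exp (- G \<theta> xs)" by (rule W_const_le[OF \<theta>])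
    also have "\<dots> \<le> exp (- (t * G \<theta> xs))"
      using G[of xs] t by (simp add: mult_left_le_one_le)
    also have "\<dots> \<le> 1 - t * G \<theta> xs + (t * G \<theta> xs)\<^sup>2 / 2"
      using G[of xs] t by (intro exp_minus_le_quadratic) auto
    finally show ?thesis by (simp add: power_mult_distrib)
  qed
  moreover have "integrable (replicate_pmf n \<nu>) (W (\<lambda>_. \<theta>))"
    using W_bounds[where w = "\<lambda>_. \<theta>"] \<theta> by (intro integrable_steps[where B = 1]) auto
  ultimately have "Z (\<lambda>_. \<theta>) n \<le> expect_steps \<nu> n (\<lambda>xs. 1 - t * G \<theta> xs + t\<^sup>2 / 2 * (G \<theta> xs)\<^sup>2)"
    unfolding Z_def using int by (intro integral_mono) auto
  also have "\<dots> = 1 - t * ?m + t\<^sup>2 / 2 * ?s"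
    using int by simp
  also have "\<dots> \<le> 1 - t * ?m + t\<^sup>2 / 2 * (3 * ?m\<^sup>2)"
  proof -
    have "?s \<le> 3 * ?m\<^sup>2"
    proof -
      \<comment> \<open>\<open>?m \<ge> 1\<close> absorbs the linear term of the second moment bound
        into the quadratic one.\<close>
      have "?m * 1 \<le> ?m * ?m" using ge by (intro mult_left_mono) auto
      then show ?thesis using second_moment_G[OF \<theta>, of n] by (simp only: power2_eq_square[of ?m])
    qed
    then show ?thesis by (intro add_left_mono mult_left_mono) auto
  qed
  \<comment> \<open>Here \<open>t * ?m = 1 / 3\<close>, so the value is
    \<open>1 - 1 / 3 + 1 / 6\<close>.\<close>
  also have "\<dots> = 5 / 6"
    using ge by (simp add: t_def power2_eq_square field_simps)
  finally show ?thesis .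
qed

end

section \<open>Non-return events and the decomposition at last visits\<close>

definition no_return :: "nat \<Rightarrow> 'a::monoid_add list \<Rightarrow> bool" where
  "no_return n xs \<longleftrightarrow> (\<forall>k\<in>{1..n}. pos xs k \<noteq> 0)"

text \<open>Unlike in \<open>visits\<close>, the end point counts: on \<open>take k xs\<close> this
  is the local time at time \<open>k\<close> of the site then occupied, hence at least
  \<open>1\<close>.\<close>

definition visits_to_end :: "'a::monoid_add list \<Rightarrow> nat" where
  "visits_to_end xs = card {j. j \<le> length xs \<and> pos xs j = sum_list xs}"

lemma pos_take: "j \<le> k \<Longrightarrow> pos (take k xs) j = pos xs j"
  by (simp add: pos_def min_def)

lemma pos_drop:
  fixes xs :: "'a::ab_group_add list"
  shows "pos (drop k xs) j = pos xs (k + j) - pos xs k"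
  by (simp add: pos_def take_add)

lemma no_return_take: "n \<le> m \<Longrightarrow> no_return n (take m xs) = no_return n xs"
  by (simp add: no_return_def pos_take)

lemma no_return_drop:
  fixes xs :: "'a::ab_group_add list"
  shows "no_return n (drop k xs) \<longleftrightarrow> (\<forall>j. k < j \<and> j \<le> k + n \<longrightarrow> pos xs j \<noteq> pos xs k)"
proof
  assume "no_return n (drop k xs)"
  then have *: "pos xs (k + i) \<noteq> pos xs k" if "i \<in> {1..n}" for i
    using that by (auto simp: no_return_def pos_drop)
  show "\<forall>j. k < j \<and> j \<le> k + n \<longrightarrow> pos xs j \<noteq> pos xs k"
  proof (intro allI impI)
    fix j assume "k < j \<and> j \<le> k + n"
    then have "j - k \<in> {1..n}" "k + (j - k) = j" by auto
    then show "pos xs j \<noteq> pos xs k" using *[of "j - k"] by metis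
  qed
qed (auto simp: no_return_def pos_drop)

lemma visits_to_end_take:
  "k \<le> length xs \<Longrightarrow> visits_to_end (take k xs) = card {j. j \<le> k \<and> pos xs j = pos xs k}"
  unfolding visits_to_end_def
  by (intro arg_cong[where f = card]) (auto simp: pos_take pos_def min_def)

text \<open>Seen from its end, the reversed path starts at the origin, so prolonging it only adds visits.\<close>

lemma visits_to_end_rev:
  fixes xs :: "'a::ab_group_add list"
  shows "visits_to_end (rev xs) = card {j. j \<le> length xs \<and> pos xs j = 0}"
proof -
  have "pos (rev xs) (length xs - j) = sum_list xs - pos xs j" if "j \<le> length xs" for j
  proof -
    have "pos (rev xs) (length xs - j) = sum_list (drop j xs)"
      using that by (simp add: pos_def take_rev)
    moreover have "sum_list xs = sum_list (take j xs) + sum_list (drop j xs)"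
      by (metis append_take_drop_id sum_list_append)
    ultimately show ?thesis by (simp add: pos_def)
  qed
  then have eq: "pos (rev xs) (length xs - j) = sum_list (rev xs) \<longleftrightarrow> pos xs j = 0" if "j \<le> length xs" for j
    using that by simp
  have eq': "pos (rev xs) j = sum_list (rev xs) \<longleftrightarrow> pos xs (length xs - j) = 0" if "j \<le> length xs" for j
    using eq[of "length xs - j"] that by simp
  have "bij_betw (\<lambda>j. length xs - j) {j. j \<le> length xs \<and> pos xs j = 0}
      {j. j \<le> length xs \<and> pos (rev xs) j = sum_list (rev xs)}"
    by (intro bij_betw_byWitness[where f' = "\<lambda>j. length xs - j"])
       (use eq eq' in \<open>auto simp del: sum_list_rev\<close>)
  then show ?thesis
    by (simp add: visits_to_end_def bij_betw_same_card)
qed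

text \<open>Every visited site has exactly one last visit \<open>k\<close>, and its number of visits
  is complete at \<open>k\<close>. The count thus reads the path up to \<open>k\<close>, while being
  last is an event of the path after \<open>k\<close>.\<close>

lemma sum_sites_last_visit:
  fixes f :: "'a::monoid_add \<Rightarrow> nat \<Rightarrow> real"
  shows "(\<Sum>x\<in>sites xs. f x (card (visits xs x))) =
    (\<Sum>k<length xs. if \<forall>j. k < j \<and> j < length xs \<longrightarrow> pos xs j \<noteq> pos xs k
      then f (pos xs k) (card {j. j \<le> k \<and> pos xs j = pos xs k}) else 0)"
proof -
  let ?L = "{k\<in>{..<length xs}. \<forall>j. k < j \<and> j < length xs \<longrightarrow> pos xs j \<noteq> pos xs k}"
  have inj: "inj_on (pos xs) ?L"
  proof (rule inj_onI)
    fix i j assume "i \<in> ?L" "j \<in> ?L" "pos xs i = pos xs j"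
    then show "i = j" by (metis (mono_tags, lifting) lessThan_iff linorder_neqE_nat mem_Collect_eq)
  qed
  have "sites xs \<subseteq> pos xs ` ?L"
  proof
    fix x assume "x \<in> sites xs"
    then have ne: "visits xs x \<noteq> {}" by (simp add: visits_eq_empty)
    define k where "k = Max (visits xs x)"
    have k: "k \<in> visits xs x" using ne by (simp add: k_def)
    have "j \<notin> visits xs x" if "k < j" for j
      using that ne Max_ge[of "visits xs x" j] unfolding k_def by (meson finite_visits leD)
    then have "k \<in> ?L" "x = pos xs k" using k by (simp_all add: visits_def)
    then show "x \<in> pos xs ` ?L" by blast
  qed
  then have "sites xs = pos xs ` ?L" by (auto simp: sites_def)
  then have "(\<Sum>x\<in>sites xs. f x (card (visits xs x))) = (\<Sum>k\<in>?L. f (pos xs k) (card (visits xs (pos xs k))))"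
    using sum.reindex[OF inj, of "\<lambda>x. f x (card (visits xs x))"] by simp
  also have "\<dots> = (\<Sum>k\<in>?L. f (pos xs k) (card {j. j \<le> k \<and> pos xs j = pos xs k}))"
  proof (intro sum.cong refl)
    fix k assume "k \<in> ?L"
    then have "j < length xs \<and> pos xs j = pos xs k \<longleftrightarrow> j \<le> k \<and> pos xs j = pos xs k" for j
      by (metis (mono_tags, lifting) lessThan_iff mem_Collect_eq not_le order_le_less_trans)
    then have "visits xs (pos xs k) = {j. j \<le> k \<and> pos xs j = pos xs k}"
      unfolding visits_def by blast
    then show "f (pos xs k) (card (visits xs (pos xs k))) = f (pos xs k) (card {j. j \<le> k \<and> pos xs j = pos xs k})"
      by simp
  qed
  also have "\<dots> = (\<Sum>k<length xs. if \<forall>j. k < j \<and> j < length xs \<longrightarrow> pos xs j \<noteq> pos xs k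
      then f (pos xs k) (card {j. j \<le> k \<and> pos xs j = pos xs k}) else 0)"
    by (rule sum.inter_filter) simp
  finally show ?thesis .
qed

lemma sites_drop:
  fixes xs :: "'a::ab_group_add list"
  assumes "length xs = n + m"
  shows "(+) (sum_list (take n xs)) ` sites (drop n xs) = pos xs ` {n..<n + m}"
proof -
  have "sum_list (take n xs) + pos (drop n xs) j = pos xs (n + j)" for j
    by (simp add: pos_def take_add)
  then have "(+) (sum_list (take n xs)) ` sites (drop n xs) = pos xs ` (+) n ` {..<m}"
    using assms by (simp add: sites_def image_image)
  also have "(+) n ` {..<m} = {n..<n + m}"
    using image_add_atLeastLessThan[of n 0 m] by (simp add: lessThan_atLeast0 ac_simps)
  finally show ?thesis .
qed

text \<open>The difference of the two indicators marks a site whose last visit before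
  \<open>n\<close> is at \<open>k\<close> and which is visited again at one of the times
  \<open>n\<close> to \<open>n + m - 1\<close>.\<close>

lemma sum_overlap_last_visit:
  fixes xs :: "'a::ab_group_add list" and f :: "nat \<Rightarrow> real"
  assumes xs: "length xs = n + m"
  shows "(\<Sum>x\<in>sites (take n xs) \<inter> (+) (sum_list (take n xs)) ` sites (drop n xs).
      f (card (visits (take n xs) x)))
    = (\<Sum>k<n. f (visits_to_end (take k xs)) *
      (of_bool (no_return (n - Suc k) (drop k xs)) - of_bool (no_return (n + m - Suc k) (drop k xs))))"
proof -
  let ?us = "take n xs" and ?B = "pos xs ` {n..<n + m}"
  have "(\<Sum>x\<in>sites ?us \<inter> ?B. f (card (visits ?us x)))
    = (\<Sum>x\<in>sites ?us. if x \<in> ?B then f (card (visits ?us x)) else 0)"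
    by (rule sum.inter_restrict) simp
  also have "\<dots> = (\<Sum>k<length ?us. if \<forall>j. k < j \<and> j < length ?us \<longrightarrow> pos ?us j \<noteq> pos ?us k
    then (if pos ?us k \<in> ?B then f (card {j. j \<le> k \<and> pos ?us j = pos ?us k}) else 0) else 0)"
    by (rule sum_sites_last_visit)
  also have "\<dots> = (\<Sum>k<n. f (visits_to_end (take k xs)) *
      (of_bool (no_return (n - Suc k) (drop k xs)) - of_bool (no_return (n + m - Suc k) (drop k xs))))"
  proof (intro sum.cong)
    fix k assume k: "k \<in> {..<n}"
    have pos: "pos ?us j = pos xs j" if "j < n" for j using that by (simp add: pos_take)
    have len: "length ?us = n" using xs by simp
    have no_return: "no_return (l - Suc k) (drop k xs) \<longleftrightarrow> (\<forall>j. k < j \<and> j < l \<longrightarrow> pos xs j \<noteq> pos xs k)"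
      if "k < l" for l
    proof -
      have "j \<le> k + (l - Suc k) \<longleftrightarrow> j < l" for j using that by linarith
      then show ?thesis by (simp only: no_return_drop)
    qed
    have A: "(\<forall>j. k < j \<and> j < n \<longrightarrow> pos ?us j \<noteq> pos ?us k) \<longleftrightarrow> no_return (n - Suc k) (drop k xs)"
      using k by (simp add: no_return pos)
    have B: "no_return (n + m - Suc k) (drop k xs) \<longleftrightarrow> no_return (n - Suc k) (drop k xs) \<and> pos ?us k \<notin> ?B"
    proof -
      have "j < n + m \<longleftrightarrow> j < n \<or> j \<in> {n..<n + m}" for j by auto
      moreover have "pos ?us k \<in> ?B \<longleftrightarrow> (\<exists>j\<in>{n..<n + m}. pos xs j = pos xs k)" "k < n"
        using k pos[of k] by (simp_all only: image_iff lessThan_iff) metis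
      moreover have "j \<in> {n..<n + m} \<Longrightarrow> k < j" for j using k by auto
      moreover have "k < n + m" using k by simp
      ultimately show ?thesis unfolding no_return[OF \<open>k < n\<close>] no_return[OF \<open>k < n + m\<close>] by blast
    qed
    have C: "card {j. j \<le> k \<and> pos ?us j = pos ?us k} = visits_to_end (take k xs)"
    proof -
      have "{j. j \<le> k \<and> pos ?us j = pos ?us k} = {j. j \<le> k \<and> pos xs j = pos xs k}"
        using k pos by auto
      then show ?thesis using k xs by (simp add: visits_to_end_take)
    qed
    show "(if \<forall>j. k < j \<and> j < length ?us \<longrightarrow> pos ?us j \<noteq> pos ?us k
      then (if pos ?us k \<in> ?B then f (card {j. j \<le> k \<and> pos ?us j = pos ?us k}) else 0) else 0)
      = f (visits_to_end (take k xs)) *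
      (of_bool (no_return (n - Suc k) (drop k xs)) - of_bool (no_return (n + m - Suc k) (drop k xs)))"
      unfolding len A B C by auto
  qed (simp add: xs)
  finally show ?thesis by (simp only: sites_drop[OF xs])
qed

declare sum_of_bool_mult_eq [simp del] sum_mult_of_bool_eq [simp del]

context trap_walk begin

definition r :: "nat \<Rightarrow> real" where
  "r n = expect_steps \<nu> n (\<lambda>xs. of_bool (no_return n xs))"

text \<open>Reversing the path turns the local time at the end point into the number of visits to
  the origin up to \<open>n\<close>, so this is also the mean of \<open>g\<close> at that
  number.\<close>

definition h :: "real \<Rightarrow> nat \<Rightarrow> real" where
  "h \<theta> n = expect_steps \<nu> n (\<lambda>xs. g \<theta> (visits_to_end xs))"

lemma r_eq: "n \<le> m \<Longrightarrow> expect_steps \<nu> m (\<lambda>xs. of_bool (no_return n xs)) = r n"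
  using expect_steps_take[of n m "\<lambda>xs. of_bool (no_return n xs)" 1 \<nu>]
  by (simp add: r_def no_return_take)

lemma r_antimono: "n \<le> m \<Longrightarrow> r m \<le> r n"
  unfolding r_eq[symmetric, of n m] r_def[of m]
  by (rule expect_steps_mono[where B = 1 and C = 1]) (auto simp: no_return_def)

lemma r_nonneg: "0 \<le> r n"
  unfolding r_def by (rule expect_steps_bounds[where B = 1]) auto

text \<open>Monotonicity is used in both directions: \<open>h k \<le> h n\<close> before the
  splitting time in \<open>Z_append\<close>, and \<open>h n \<le> h k\<close> after it in
  \<open>meanG_ge\<close>.\<close>

lemma h_mono:
  assumes "0 \<le> \<theta>" "m \<le> n"
  shows "h \<theta> m \<le> h \<theta> n"
proof -
  have h: "h \<theta> n = expect_steps \<nu> n (\<lambda>xs. g \<theta> (card {j. j \<le> length xs \<and> pos xs j = 0}))" for n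
    unfolding h_def
    using expect_steps_rev[of n \<nu> "\<lambda>xs. g \<theta> (visits_to_end xs)"] by (simp only: visits_to_end_rev)
  have "h \<theta> m = expect_steps \<nu> n (\<lambda>xs. g \<theta> (card {j. j \<le> m \<and> pos (take m xs) j = 0}))"
  proof -
    have "h \<theta> m = expect_steps \<nu> m (\<lambda>xs. g \<theta> (card {j. j \<le> m \<and> pos xs j = 0}))"
      unfolding h by (intro expect_steps_cong) simp
    then show ?thesis
      using assms expect_steps_take[of m n "\<lambda>xs. g \<theta> (card {j. j \<le> m \<and> pos xs j = 0})" 1 \<nu>]
      by (simp add: g_nonneg g_le_1)
  qed
  also have "\<dots> \<le> h \<theta> n"
    unfolding h
  proof (rule expect_steps_mono[where B = 1 and C = 1])
    fix xs :: "'a list" assume "length xs = n"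
    then have "{j. j \<le> m \<and> pos (take m xs) j = 0} \<subseteq> {j. j \<le> length xs \<and> pos xs j = 0}"
      using assms by (auto simp: pos_take)
    then show "g \<theta> (card {j. j \<le> m \<and> pos (take m xs) j = 0})
        \<le> g \<theta> (card {j. j \<le> length xs \<and> pos xs j = 0})"
      using assms by (intro g_mono card_mono) auto
  qed (use assms in \<open>auto simp: abs_of_nonneg g_nonneg g_le_1\<close>)
  finally show ?thesis .
qed

lemma h_nonneg: "0 \<le> \<theta> \<Longrightarrow> 0 \<le> h \<theta> n"
  unfolding h_def by (rule expect_steps_bounds[where B = 1]) (auto simp: g_nonneg g_le_1)

lemma expect_last_visit:
  assumes "0 \<le> \<theta>" "k + m \<le> n"
  shows "expect_steps \<nu> n (\<lambda>xs. g \<theta> (visits_to_end (take k xs)) * of_bool (no_return m (drop k xs)))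
    = h \<theta> k * r m"
proof -
  have "expect_steps \<nu> (k + (n - k)) (\<lambda>xs. g \<theta> (visits_to_end (take k xs)) * of_bool (no_return m (drop k xs)))
    = h \<theta> k * expect_steps \<nu> (n - k) (\<lambda>xs. of_bool (no_return m xs))"
    unfolding h_def using assms
    by (intro expect_steps_prod[where B = 1 and C = 1]) (auto simp: g_nonneg g_le_1)
  then show ?thesis using assms by (simp add: r_eq)
qed

lemma integrable_last_visit:
  assumes "0 \<le> \<theta>"
  shows "integrable (replicate_pmf n \<nu>)
    (\<lambda>xs. g \<theta> (visits_to_end (take k xs)) * of_bool (no_return m (drop k xs)))"
  by (rule integrable_steps[where B = 1]) (auto simp: abs_of_nonneg g_nonneg g_le_1 assms)

text \<open>A last-exit decomposition: summand \<open>k\<close> collects the sites last visited at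
  \<open>k\<close>, with \<open>n - 1 - k\<close> later times at which the walk has to stay
  away.\<close>

lemma meanG_eq:
  assumes "0 \<le> \<theta>"
  shows "meanG \<theta> n = (\<Sum>k<n. h \<theta> k * r (n - Suc k))"
proof -
  have "meanG \<theta> n = expect_steps \<nu> n (\<lambda>xs. \<Sum>k<n.
      g \<theta> (visits_to_end (take k xs)) * of_bool (no_return (n - Suc k) (drop k xs)))"
  proof (rule expect_steps_cong)
    fix xs :: "'a list" assume xs: "length xs = n"
    show "G \<theta> xs = (\<Sum>k<n. g \<theta> (visits_to_end (take k xs)) * of_bool (no_return (n - Suc k) (drop k xs)))"
      unfolding G_def sum_sites_last_visit[where f = "\<lambda>_. g \<theta>"] xs
    proof (intro sum.cong refl)
      fix k assume k: "k \<in> {..<n}"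
      have "no_return (n - Suc k) (drop k xs) \<longleftrightarrow> (\<forall>j. k < j \<and> j < n \<longrightarrow> pos xs j \<noteq> pos xs k)"
        using k by (auto simp: no_return_drop)
      then show "(if \<forall>j. k < j \<and> j < n \<longrightarrow> pos xs j \<noteq> pos xs k
          then g \<theta> (card {j. j \<le> k \<and> pos xs j = pos xs k}) else 0)
        = g \<theta> (visits_to_end (take k xs)) * of_bool (no_return (n - Suc k) (drop k xs))"
        using k xs by (simp add: visits_to_end_take)
    qed
  qed
  also have "\<dots> = (\<Sum>k<n. h \<theta> k * r (n - Suc k))"
    using integrable_last_visit[OF assms] by (simp add: expect_last_visit assms)
  finally show ?thesis .
qed

text \<open>The expectation of the bound in \<open>W_append\<close>, decomposed at last visits: each
  term is a past factor \<open>h \<theta> k\<close> times the probability that the first return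
  after \<open>k\<close> falls into the second block.\<close>

lemma Z_append:
  assumes w: "\<And>k. 0 \<le> w k" "\<And>k. k < n \<Longrightarrow> w k \<le> \<theta>" and "0 \<le> \<theta>"
  shows "\<bar>Z w (n + m) - Z w n * Z (\<lambda>k. w (n + k)) m\<bar>
    \<le> h \<theta> n * (\<Sum>j<n. r j - r (j + m))"
proof -
  let ?w = "\<lambda>k. w (n + k)"
  let ?F = "\<lambda>k xs. g \<theta> (visits_to_end (take k xs)) *
      (of_bool (no_return (n - Suc k) (drop k xs)) - of_bool (no_return (n + m - Suc k) (drop k xs)))"
  have Wb: "0 \<le> W w xs" "W w xs \<le> 1" "0 \<le> W ?w xs" "W ?w xs \<le> 1" for xs
    using w by (auto intro!: W_bounds)
  have int: "integrable (replicate_pmf l \<nu>) (W w)" for l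
    using Wb by (intro integrable_steps[where B = 1]) auto
  have ZZ: "Z w n * Z ?w m = expect_steps \<nu> (n + m) (\<lambda>xs. W w (take n xs) * W ?w (drop n xs))"
    unfolding Z_def using Wb by (intro expect_steps_prod[symmetric, where B = 1 and C = 1]) auto
  have int2: "integrable (replicate_pmf (n + m) \<nu>) (\<lambda>xs. W w (take n xs) * W ?w (drop n xs))"
    using Wb by (intro integrable_steps[where B = 1]) (auto simp: abs_mult intro!: mult_le_one)
  note F = sum_overlap_last_visit[of _ n m "g \<theta>"]
  have bound: "\<bar>W w xs - W w (take n xs) * W ?w (drop n xs)\<bar> \<le> (\<Sum>k<n. ?F k xs)" if xs: "length xs = n + m" for xs
    using W_append[of w "take n xs" \<theta> "drop n xs"] w xs assms(3) by (simp add: F)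
  have intF: "integrable (replicate_pmf (n + m) \<nu>) (?F k)" for k
    unfolding right_diff_distrib using integrable_last_visit[OF assms(3)] by (intro Bochner_Integration.integrable_diff) auto
  have "\<bar>Z w (n + m) - Z w n * Z ?w m\<bar>
      = \<bar>expect_steps \<nu> (n + m) (\<lambda>xs. W w xs - W w (take n xs) * W ?w (drop n xs))\<bar>"
    unfolding ZZ using int int2 by (simp add: Z_def)
  also have "\<dots> \<le> expect_steps \<nu> (n + m) (\<lambda>xs. \<bar>W w xs - W w (take n xs) * W ?w (drop n xs)\<bar>)"
    by (rule integral_abs_bound)
  also have "\<dots> \<le> expect_steps \<nu> (n + m) (\<lambda>xs. \<Sum>k<n. ?F k xs)"
    using int int2 intF bound by (intro expect_steps_mono_integrable) auto
  also have "\<dots> = (\<Sum>k<n. expect_steps \<nu> (n + m) (?F k))"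
    using intF by simp
  also have "\<dots> = (\<Sum>k<n. h \<theta> k * (r (n - Suc k) - r (n + m - Suc k)))"
    unfolding right_diff_distrib
    using integrable_last_visit[OF assms(3)] assms(3) by (intro sum.cong refl) (simp add: expect_last_visit)
  \<comment> \<open>Freezing \<open>h\<close> at its largest value leaves a sum over
    \<open>r\<close> only, which the substitution \<open>j = n - 1 - k\<close> brings into the
    stated form.\<close>
  also have "\<dots> \<le> (\<Sum>k<n. h \<theta> n * (r (n - Suc k) - r (n + m - Suc k)))"
    using assms(3) by (intro sum_mono mult_right_mono h_mono) (auto intro!: r_antimono)
  also have "\<dots> = h \<theta> n * (\<Sum>k<n. r (n - Suc k) - r (n - Suc k + m))"
    by (simp add: sum_distrib_left)
  also have "(\<Sum>k<n. r (n - Suc k) - r (n - Suc k + m)) = (\<Sum>j<n. r j - r (j + m))"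
    by (rule sum.nat_diff_reindex)
  finally show ?thesis .
qed

text \<open>Only the last visits in \<open>{n..<n'}\<close> are kept. Read as an upper bound for
  \<open>h \<theta> n\<close>, this is how tightness of \<open>G\<close> controls the error in
  \<open>Z_append\<close>.\<close>

lemma meanG_ge:
  assumes "0 \<le> \<theta>" "n \<le> n'"
  shows "real (n' - n) * h \<theta> n * r n' \<le> meanG \<theta> n'"
proof -
  have "real (n' - n) * h \<theta> n * r n' = (\<Sum>k\<in>{n..<n'}. h \<theta> n * r n')"
    by simp
  also have "\<dots> \<le> (\<Sum>k\<in>{n..<n'}. h \<theta> k * r (n' - Suc k))"
    using assms by (intro sum_mono mult_mono h_mono r_antimono h_nonneg r_nonneg) auto
  also have "\<dots> \<le> (\<Sum>k<n'. h \<theta> k * r (n' - Suc k))"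
    using assms by (intro sum_mono2) (auto simp: h_nonneg r_nonneg)
  finally show ?thesis by (simp add: meanG_eq assms)
qed

lemma meanG_double: 
  assumes "0 \<le> \<theta>"
  shows "meanG (2 * \<theta>) n \<le> 2 * meanG \<theta> n"
proof -
  have int: "integrable (replicate_pmf n \<nu>) (G \<theta>)" if "0 \<le> \<theta>" for \<theta>
    using G_nonneg[OF that] G_le_length[OF that] by (intro integrable_steps[where B = n]) auto
  have "meanG (2 * \<theta>) n \<le> expect_steps \<nu> n (\<lambda>xs. 2 * G \<theta> xs)"
    using int[of \<theta>] int[of "2 * \<theta>"] assms by (intro integral_mono G_double) auto
  then show ?thesis by simp
qed

lemma meanG_mono_arg: 
  assumes "0 \<le> \<theta>" "\<theta> \<le> \<theta>'"
  shows "meanG \<theta> n \<le> meanG \<theta>' n"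
proof -
  have int: "integrable (replicate_pmf n \<nu>) (G \<theta>)" if "0 \<le> \<theta>" for \<theta>
    using G_nonneg[OF that] G_le_length[OF that] by (intro integrable_steps[where B = n]) auto
  show ?thesis
    using int[of \<theta>] int[of "\<theta>'"] assms by (intro integral_mono G_mono_arg) auto
qed

end

section \<open>Slow variation and asymptotic independence\<close>

text \<open>The easy half of Karamata's theorem at index 0, by halving: the lower half of the sum is
  bounded inductively, the upper half by its largest term \<open>r (n div 2)\<close>.\<close>

lemma sum_le_of_slow_variation:
  fixes r :: "nat \<Rightarrow> real"
  assumes dec: "\<And>m n. m \<le> n \<Longrightarrow> r n \<le> r m" and pos: "\<And>n. 0 < r n" and le1: "\<And>n. r n \<le> 1"
    and sv: "\<And>c. 0 < c \<Longrightarrow> (\<lambda>n. r (nat \<lfloor>c * real n\<rfloor>) / r n) \<longlonglongrightarrow> 1"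
  obtains C where "\<And>n. (\<Sum>j<n. r j) \<le> C * real n * r n" "1 \<le> C"
proof -
  have half: "nat \<lfloor>1 / 2 * real n\<rfloor> = n div 2" for n
    using floor_divide_of_nat_eq[of n 2, where ?'a = real] by simp
  have "\<forall>\<^sub>F n in sequentially. r (n div 2) / r n < 5 / 4"
    using order_tendstoD(2)[OF sv[of "1/2"], of "5/4"] half by simp
  then obtain n0 where n0: "\<And>n. n \<ge> n0 \<Longrightarrow> r (n div 2) \<le> 5 / 4 * r n"
    using pos unfolding eventually_sequentially by (metis divide_less_eq less_imp_le)
  \<comment> \<open>Halving costs a factor \<open>5 / 4\<close>, and
    \<open>(C + 1) / 2 * (5 / 4) \<le> C\<close> exactly when \<open>C \<ge> 5 / 3\<close>; any
    ratio below \<open>2\<close> could replace \<open>5 / 4\<close>, with another constant. The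
    second entry settles \<open>n < n0\<close>, where the sum is at most \<open>n\<close> and
    \<open>r n \<ge> r n0\<close>.\<close>
  define C where "C = max (5 / 3) (1 / r n0)"
  have C: "5 / 3 \<le> C" "1 \<le> C * r n0"
    using pos[of n0] by (auto simp: C_def field_simps max_def)
  have "(\<Sum>j<n. r j) \<le> C * real n * r n" for n
  proof (induction n rule: less_induct)
    case (less n)
    show ?case
    proof (cases "n < n0 \<or> n = 0")
      case True
      have "(\<Sum>j<n. r j) \<le> (\<Sum>j<n. 1)" by (intro sum_mono le1)
      also have "\<dots> = real n * 1" by simp
      also have "\<dots> \<le> real n * (C * r n)"
      proof (cases "n = 0")
        case False
        then have "C * r n0 \<le> C * r n" using True C(1) dec[of n n0] by (intro mult_left_mono) auto
        then show ?thesis using C(2) by (intro mult_left_mono) auto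
      qed auto
      finally show ?thesis by (simp add: mult_ac)
    next
      case False
      let ?h = "n div 2"
      have h: "?h < n" "real ?h \<le> real n / 2" using False by auto
      have "(\<Sum>j<n. r j) = (\<Sum>j<?h. r j) + (\<Sum>j\<in>{?h..<n}. r j)"
        using h(1) sum.atLeastLessThan_concat[of 0 ?h n r] by (simp add: lessThan_atLeast0)
      also have "\<dots> \<le> C * real ?h * r ?h + (\<Sum>j\<in>{?h..<n}. r ?h)"
        using less.IH[OF h(1)] by (intro add_mono sum_mono dec) auto
      also have "\<dots> = (C * real ?h + (real n - real ?h)) * r ?h"
        using h(1) by (simp add: algebra_simps of_nat_diff)
      also have "\<dots> \<le> ((C + 1) / 2 * real n) * (5 / 4 * r n)"
      proof (intro mult_mono n0)
        have "(C - 1) * real ?h \<le> (C - 1) * (real n / 2)" using C h by (intro mult_left_mono) auto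
        then show "C * real ?h + (real n - real ?h) \<le> (C + 1) / 2 * real n" by (simp add: algebra_simps)
      qed (use False C in \<open>auto intro: less_imp_le[OF pos]\<close>)
      also have "\<dots> = (5 / 8 * (C + 1)) * (real n * r n)" by simp
      also have "\<dots> \<le> C * (real n * r n)"
        using C less_imp_le[OF pos] by (intro mult_right_mono) auto
      finally show ?thesis by (simp add: mult_ac)
    qed
  qed
  then show ?thesis using that[of C] C by auto
qed

text \<open>The first \<open>e N\<close> terms add up to at most
  \<open>C * \<epsilon> * N * r (e N)\<close>. Every later term is at most
  \<open>r (e N) - r (2 * T * N)\<close>, which slow variation makes negligible against
  \<open>r N\<close>.\<close>

lemma overlap_sum_negligible:
  fixes r :: "nat \<Rightarrow> real" and n m :: "nat \<Rightarrow> nat"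
  assumes dec: "\<And>m n. m \<le> n \<Longrightarrow> r n \<le> r m" and pos: "\<And>n. 0 < r n" and le1: "\<And>n. r n \<le> 1"
    and sv: "\<And>c. 0 < c \<Longrightarrow> (\<lambda>n. r (nat \<lfloor>c * real n\<rfloor>) / r n) \<longlonglongrightarrow> 1"
    and n: "\<And>N. n N \<le> T * N" and m: "\<And>N. m N \<le> T * N" and T: "0 < T"
  shows "(\<lambda>N. (\<Sum>j<n N. r j - r (j + m N)) / (real N * r N)) \<longlonglongrightarrow> 0"
proof (rule LIMSEQ_I)
  fix \<eta> :: real assume \<eta>: "0 < \<eta>"
  obtain C where C: "\<And>n. (\<Sum>j<n. r j) \<le> C * real n * r n" "1 \<le> C"
    using sum_le_of_slow_variation[OF dec pos le1 sv] by metis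
  \<comment> \<open>The factor \<open>2\<close> keeps the limit \<open>C * \<epsilon>\<close> of
    \<open>B\<close> strictly below \<open>\<eta>\<close>; the cap \<open>1\<close> keeps
    \<open>e N\<close> within the horizon \<open>2 * T * N\<close>.\<close>
  define \<epsilon> where "\<epsilon> = min 1 (\<eta> / (2 * C))"
  have \<epsilon>: "0 < \<epsilon>" "\<epsilon> \<le> 1" using \<eta> C by (auto simp: \<epsilon>_def)
  have "\<epsilon> \<le> \<eta> / (2 * C)" by (simp add: \<epsilon>_def)
  then have C\<epsilon>: "C * \<epsilon> < \<eta>" using \<eta> C by (simp add: field_simps)
  define e where "e N = nat \<lfloor>\<epsilon> * real N\<rfloor>" for N
  define B where "B N = C * \<epsilon> * (r (e N) / r N) + real T * (r (e N) / r N - r (2 * T * N) / r N)" for N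
  have floor_mult: "nat \<lfloor>real (2 * T) * real N\<rfloor> = 2 * T * N" for N
    by (metis floor_of_nat nat_int of_nat_mult)
  have lim2: "(\<lambda>N. r (2 * T * N) / r N) \<longlonglongrightarrow> 1"
    using sv[of "real (2 * T)"] T unfolding floor_mult by simp
  have lim: "B \<longlonglongrightarrow> C * \<epsilon> * 1 + real T * (1 - 1)"
    unfolding B_def e_def by (intro tendsto_intros sv \<epsilon>(1) lim2)
  have "\<forall>\<^sub>F N in sequentially. B N < \<eta>"
    by (rule order_tendstoD(2)[OF lim]) (use C\<epsilon> in simp)
  moreover have "norm ((\<Sum>j<n N. r j - r (j + m N)) / (real N * r N) - 0) \<le> B N" if N: "0 < N" for N
  proof -
    have nonneg: "0 \<le> r j - r (j + m N)" for j using dec[of j "j + m N"] by simp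
    have "\<epsilon> * real N \<le> 1 * real N" using \<epsilon> by (intro mult_right_mono) auto
    then have "e N \<le> N" unfolding e_def by linarith
    also have "\<dots> \<le> 2 * T * N" using T by simp
    finally have eN: "e N \<le> 2 * T * N" .
    have each: "r j - r (j + m N) \<le> (if j < e N then r j else 0) + (r (e N) - r (2 * T * N)) * of_bool (e N \<le> j)"
      if "j < n N" for j
    proof (cases "j < e N")
      case False
      have "j + m N \<le> 2 * T * N" using that n[of N] m[of N] by simp
      then show ?thesis using False dec[of "e N" j] dec[of "j + m N" "2 * T * N"] by simp
    qed (use less_imp_le[OF pos] in auto)
    have "(\<Sum>j<n N. r j - r (j + m N)) \<le> (\<Sum>j<n N. (if j < e N then r j else 0) + (r (e N) - r (2 * T * N)) * of_bool (e N \<le> j))"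
      by (intro sum_mono each) auto
    also have "\<dots> = (\<Sum>j<n N. if j < e N then r j else 0) + (r (e N) - r (2 * T * N)) * (\<Sum>j<n N. of_bool (e N \<le> j))"
      by (simp add: sum.distrib sum_distrib_left del: sum_of_bool_eq)
    also have "(\<Sum>j<n N. if j < e N then r j else 0) \<le> (\<Sum>j<e N. r j)"
      unfolding sum.inter_filter[OF finite_lessThan, symmetric]
      by (intro sum_mono2) (auto intro: less_imp_le[OF pos])
    also have "(\<Sum>j<e N. r j) \<le> C * real (e N) * r (e N)" by (rule C)
    also have "\<dots> \<le> C * (\<epsilon> * real N) * r (e N)"
      using C(2) \<epsilon> less_imp_le[OF pos] by (intro mult_right_mono mult_left_mono) (auto simp: e_def)
    also have "(r (e N) - r (2 * T * N)) * (\<Sum>j<n N. of_bool (e N \<le> j)) \<le> (r (e N) - r (2 * T * N)) * (real T * real N)"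
    proof (intro mult_left_mono)
      have "(\<Sum>j<n N. of_bool (e N \<le> j)) \<le> (\<Sum>j<n N. 1 :: real)" by (intro sum_mono) auto
      also have "\<dots> \<le> real (T * N)" using n[of N] by (simp del: of_nat_mult)
      finally show "(\<Sum>j<n N. of_bool (e N \<le> j)) \<le> real T * real N" by simp
    qed (use dec eN in auto)
    finally have *: "(\<Sum>j<n N. r j - r (j + m N)) \<le>
        C * (\<epsilon> * real N) * r (e N) + (r (e N) - r (2 * T * N)) * (real T * real N)" by simp
    have "(\<Sum>j<n N. r j - r (j + m N)) / (real N * r N) \<le> B N"
      using * N pos[of N] by (simp add: B_def divide_simps) (simp add: algebra_simps)
    moreover have "0 \<le> (\<Sum>j<n N. r j - r (j + m N))" by (intro sum_nonneg nonneg)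
    ultimately show ?thesis using less_imp_le[OF pos[of N]] by simp
  qed
  ultimately show "\<exists>no. \<forall>N\<ge>no. norm ((\<Sum>j<n N. r j - r (j + m N)) / (real N * r N) - 0) < \<eta>"
    unfolding eventually_sequentially by (meson le_less_trans less_le_trans zero_less_Suc Suc_le_eq max.boundedE order_refl)
qed

context trap_walk begin

section \<open>Monotonicity of the Laplace functionals and asymptotic factorization\<close>

lemma Phi_antimono:
  assumes "\<And>k. k \<in> L \<Longrightarrow> 0 \<le> w k" "K \<subseteq> L" "finite L"
  shows "Phi w L \<le> Phi w K"
  unfolding Phi_def
proof (intro integral_mono integrable_prod_q)
  fix e assume e: "e \<in> space E"
  have "(\<Prod>k\<in>L. q (w k) e) = (\<Prod>k\<in>K. q (w k) e) * (\<Prod>k\<in>L - K. q (w k) e)"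
    using assms by (metis prod.subset_diff mult.commute)
  also have "\<dots> \<le> (\<Prod>k\<in>K. q (w k) e)"
    using assms by (intro mult_left_le prod_q_bounds[OF e]) auto
  finally show "(\<Prod>k\<in>L. q (w k) e) \<le> (\<Prod>k\<in>K. q (w k) e)" .
qed (use assms in auto)

lemma Phi_antimono_arg:
  assumes "\<And>k. k \<in> K \<Longrightarrow> 0 \<le> w k" "\<And>k. k \<in> K \<Longrightarrow> w k \<le> w' k"
  shows "Phi w' K \<le> Phi w K"
  unfolding Phi_def
  by (intro integral_mono integrable_prod_q prod_mono)
     (use assms in \<open>auto intro!: q_antimono q_nonneg intro: order_trans\<close>)

lemma W_append_le:
  assumes "\<And>k. 0 \<le> w k"
  shows "W w (xs @ ys) \<le> W w xs"
proof -
  have "W w (xs @ ys) \<le> (\<Prod>x\<in>sites (xs @ ys). Phi w (visits xs x))"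
    unfolding W_def
    by (intro prod_mono conjI Phi_bounds Phi_antimono) (auto simp: assms visits_append)
  also have "\<dots> = W w xs"
    by (rule W_superset[symmetric]) (auto simp: sites_append)
  finally show ?thesis .
qed

lemma Z_bounds:
  assumes "\<And>k. 0 \<le> w k"
  shows "0 \<le> Z w n" "Z w n \<le> 1"
  unfolding Z_def using expect_steps_bounds[of n "W w" 1] W_bounds[of _ w] assms by auto

lemma Z_antimono:
  assumes "\<And>k. 0 \<le> w k" "m \<le> n"
  shows "Z w n \<le> Z w m"
proof -
  have "Z w m = expect_steps \<nu> n (\<lambda>xs. W w (take m xs))"
    unfolding Z_def using assms by (intro expect_steps_take[symmetric, where B = 1] W_bounds) auto
  moreover have "Z w n \<le> \<dots>"
    unfolding Z_def
  proof (rule expect_steps_mono[where B = 1 and C = 1])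
    show "W w xs \<le> W w (take m xs)" for xs
      using W_append_le[of w "take m xs" "drop m xs"] assms by simp
  qed (use W_bounds[of _ w] assms in auto)
  ultimately show ?thesis by simp
qed

lemma Z_antimono_arg:
  assumes "\<And>k. 0 \<le> w k" "\<And>k. w k \<le> w' k"
  shows "Z w' n \<le> Z w n"
proof -
  have w': "0 \<le> w' k" for k using assms[of k] by (rule order_trans)
  show ?thesis
    unfolding Z_def
  proof (rule expect_steps_mono[where B = 1 and C = 1])
    show "W w' xs \<le> W w xs" for xs
      unfolding W_def by (intro prod_mono conjI Phi_bounds Phi_antimono_arg) (auto simp: assms w')
  qed (use W_bounds[of _ w] W_bounds[of _ w'] assms w' in auto)
qed

lemma Z_cong:
  assumes "\<And>k. k < n \<Longrightarrow> w k = w' k"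
  shows "Z w n = Z w' n"
  unfolding Z_def
proof (rule expect_steps_cong)
  fix xs :: "'a list" assume "length xs = n"
  then have "Phi w (visits xs x) = Phi w' (visits xs x)" for x
    unfolding Phi_def using assms
    by (intro Bochner_Integration.integral_cong refl prod.cong) (auto simp: visits_def)
  then show "W w xs = W w' xs" by (simp add: W_def)
qed

lemma Z_zero_weight: "Z (\<lambda>_. 0) n = 1"
proof -
  have "Phi (\<lambda>_. 0) K = (\<integral>e. 1 \<partial>E)" for K
    unfolding Phi_def by (intro Bochner_Integration.integral_cong) (auto simp: q_0)
  then show ?thesis by (simp add: Z_def W_def[abs_def] prob_space)
qed

text \<open>Only the weights before \<open>n N\<close> are compared with \<open>\<theta> N\<close>;
  the later ones may be arbitrary nonnegative numbers, which is what the splitting into several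
  blocks exploits.\<close>

lemma Z_append_asymp:
  fixes n m :: "nat \<Rightarrow> nat" and T :: nat
  assumes pos: "\<And>n. 0 < r n"
    and sv: "\<And>c. 0 < c \<Longrightarrow> (\<lambda>n. r (nat \<lfloor>c * real n\<rfloor>) / r n) \<longlonglongrightarrow> 1"
    and T: "0 < T" and n: "\<And>N. n N \<le> T * N" and m: "\<And>N. m N \<le> T * N"
    and w: "\<forall>\<^sub>F N in sequentially. \<forall>k. 0 \<le> w N k" "\<forall>\<^sub>F N in sequentially. \<forall>k<n N. w N k \<le> \<theta> N"
    and \<theta>: "\<forall>\<^sub>F N in sequentially. 0 \<le> \<theta> N"
    and bdd: "\<forall>\<^sub>F N in sequentially. meanG (\<theta> N) (2 * T * N) \<le> B"
  shows "(\<lambda>N. Z (w N) (n N + m N) - Z (w N) (n N) * Z (\<lambda>k. w N (n N + k)) (m N)) \<longlonglongrightarrow> 0"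
proof -
  let ?S = "\<lambda>N. \<Sum>j<n N. r j - r (j + m N)"
  have le1: "r k \<le> 1" for k
    unfolding r_def by (rule expect_steps_bounds(2)) auto
  have floor_mult: "nat \<lfloor>real (2 * T) * real N\<rfloor> = 2 * T * N" for N
    by (metis floor_of_nat nat_int of_nat_mult)
  have "(\<lambda>N. r (2 * T * N) / r N) \<longlonglongrightarrow> 1"
    using sv[of "real (2 * T)"] T unfolding floor_mult by simp
  then have "(\<lambda>N. B / T * ((?S N / (real N * r N)) / (r (2 * T * N) / r N))) \<longlonglongrightarrow> B / T * (0 / 1)"
    by (intro tendsto_intros overlap_sum_negligible[where T = T] r_antimono pos sv le1 n m T) auto
  then have lim: "(\<lambda>N. B / T * ((?S N / (real N * r N)) / (r (2 * T * N) / r N))) \<longlonglongrightarrow> 0"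
    by simp
  show ?thesis
  proof (rule Lim_null_comparison[OF _ lim])
    show "\<forall>\<^sub>F N in sequentially. norm (Z (w N) (n N + m N) - Z (w N) (n N) * Z (\<lambda>k. w N (n N + k)) (m N))
        \<le> B / T * ((?S N / (real N * r N)) / (r (2 * T * N) / r N))"
      using w \<theta> bdd eventually_gt_at_top[of 0]
    proof eventually_elim
      case (elim N)
      have S: "0 \<le> ?S N" by (intro sum_nonneg) (use r_antimono in auto)
      let ?h = "h (\<theta> N) (n N)"
      have r2: "0 < r (2 * T * N)" by (rule pos)
      have "real T * real N * ?h * r (2 * T * N) \<le> real (2 * T * N - n N) * ?h * r (2 * T * N)"
      proof (intro mult_right_mono h_nonneg r_nonneg elim)
        \<comment> \<open>The doubled horizon leaves at least \<open>T * N\<close> times after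
          \<open>n N\<close> for \<open>meanG_ge\<close> to count.\<close>
        have "T * N \<le> 2 * T * N - n N" using n[of N] by linarith
        then show "real T * real N \<le> real (2 * T * N - n N)" by (metis of_nat_mono of_nat_mult)
      qed
      also have "\<dots> \<le> meanG (\<theta> N) (2 * T * N)"
        using n[of N] elim by (intro meanG_ge) auto
      also have "\<dots> \<le> B" using elim by simp
      finally have h: "?h \<le> B / (real T * real N * r (2 * T * N))"
        using T elim r2 by (simp add: field_simps)
      have "norm (Z (w N) (n N + m N) - Z (w N) (n N) * Z (\<lambda>k. w N (n N + k)) (m N)) \<le> ?h * ?S N"
        using elim by (simp, intro Z_append) auto
      also have "\<dots> \<le> B / (real T * real N * r (2 * T * N)) * ?S N"
        using h S by (intro mult_right_mono)
      also have "\<dots> = B / T * ((?S N / (real N * r N)) / (r (2 * T * N) / r N))"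
        using T elim r2 pos[of N] by (simp add: field_simps)
      finally show ?case .
    qed
  qed
qed

end

section \<open>The Laplace exponent of the limit\<close>

text \<open>Cauchy's functional equation: \<open>b\<close> is linear on the integers, and
  monotonicity squeezes \<open>real n * b x\<close> between neighbouring integer multiples of
  \<open>b 1\<close>.\<close>

lemma additive_mono_linear:
  fixes b :: "real \<Rightarrow> real"
  assumes add: "\<And>x y. b (x + y) = b x + b y" and mono: "\<And>x y. x \<le> y \<Longrightarrow> b x \<le> b y"
  shows "b x = x * b 1"
proof -
  have b0: "b 0 = 0" using add[of 0 0] by simp
  have neg: "b (- x) = - b x" for x using add[of x "- x"] b0 by simp
  have nat: "b (of_nat n * x) = of_nat n * b x" for n x
    by (induction n) (simp_all add: b0 add algebra_simps)
  have int: "b (of_int k * x) = of_int k * b x" for k x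
    by (cases k rule: int_cases2) (simp_all add: nat neg)
  have b1: "0 \<le> b 1" using mono[of 0 1] b0 by simp
  have "\<bar>b x - x * b 1\<bar> * real n \<le> b 1" for n
  proof -
    let ?k = "\<lfloor>real n * x\<rfloor>"
    have "b (of_int ?k) \<le> b (real n * x)" "b (real n * x) \<le> b (of_int ?k + 1)"
      by (intro mono; linarith)+
    then have k: "of_int ?k * b 1 \<le> real n * b x" "real n * b x \<le> (of_int ?k + 1) * b 1"
      using int[of ?k 1] add[of "of_int ?k" 1] nat[of n x] by (simp_all add: algebra_simps)
    have "of_int ?k * b 1 \<le> (real n * x) * b 1" "(real n * x) * b 1 \<le> (of_int ?k + 1) * b 1"
      using b1 by (intro mult_right_mono; linarith)+
    then have "\<bar>real n * b x - (real n * x) * b 1\<bar> \<le> b 1"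
      using k by (simp add: algebra_simps abs_le_iff)
    moreover have "\<bar>real n * b x - (real n * x) * b 1\<bar> = \<bar>b x - x * b 1\<bar> * real n"
    proof -
      have "real n * b x - (real n * x) * b 1 = (b x - x * b 1) * real n" by (simp add: algebra_simps)
      then show ?thesis by (simp add: abs_mult)
    qed
    ultimately show ?thesis by simp
  qed
  then have "\<bar>b x - x * b 1\<bar> = 0"
    using reals_Archimedean3[of "\<bar>b x - x * b 1\<bar>"] by (metis abs_ge_zero less_le_not_le mult.commute order_le_less)
  then show ?thesis by simp
qed

lemma multiplicative_mono_powr:
  fixes \<kappa> :: "real \<Rightarrow> real"
  assumes pos: "\<And>x. 0 < x \<Longrightarrow> 0 < \<kappa> x" and mult: "\<And>x y. 0 < x \<Longrightarrow> 0 < y \<Longrightarrow> \<kappa> (x * y) = \<kappa> x * \<kappa> y"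
    and mono: "\<And>x y. 0 < x \<Longrightarrow> x < y \<Longrightarrow> \<kappa> x < \<kappa> y"
  obtains \<alpha> where "0 < \<alpha>" "\<And>x. 0 < x \<Longrightarrow> \<kappa> x = x powr \<alpha>"
proof
  define b where "b s = ln (\<kappa> (exp s))" for s
  have b: "b s = s * b 1" for s
  proof (rule additive_mono_linear)
    show "b (x + y) = b x + b y" for x y
      using pos[of "exp x"] pos[of "exp y"] by (simp add: b_def exp_add mult ln_mult_pos)
    show "b x \<le> b y" if "x \<le> y" for x y
      using that mono[of "exp x" "exp y"] pos by (cases "x = y") (auto simp: b_def)
  qed
  have k1: "\<kappa> 1 = 1" using mult[of 1 1] pos[of 1] by simp
  show "0 < b 1" using mono[of 1 "exp 1"] k1 by (simp add: b_def)
  show "\<kappa> x = x powr b 1" if "0 < x" for x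
  proof -
    have "\<kappa> x = exp (b (ln x))" using that pos[of x] by (simp add: b_def)
    then show ?thesis using that b[of "ln x"] by (simp add: powr_def mult.commute)
  qed
qed

lemma floor_mult_ratio:
  assumes "0 \<le> t"
  shows "(\<lambda>N. real (nat \<lfloor>real N * t\<rfloor>) / real N) \<longlonglongrightarrow> t"
proof (rule tendsto_sandwich)
  show "\<forall>\<^sub>F N in sequentially. t - 1 / real N \<le> real (nat \<lfloor>real N * t\<rfloor>) / real N"
    using eventually_gt_at_top[of 0]
  proof eventually_elim
    case (elim N)
    have "real N * t - 1 \<le> real (nat \<lfloor>real N * t\<rfloor>)" by linarith
    then have "(real N * t - 1) / real N \<le> real (nat \<lfloor>real N * t\<rfloor>) / real N"
      by (intro divide_right_mono) auto
    then show ?case using elim by (simp add: diff_divide_distrib)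
  qed
  show "\<forall>\<^sub>F N in sequentially. real (nat \<lfloor>real N * t\<rfloor>) / real N \<le> t"
    using eventually_gt_at_top[of 0]
  proof eventually_elim
    case (elim N)
    have "real (nat \<lfloor>real N * t\<rfloor>) \<le> real N * t" using assms by (simp add: of_nat_nat)
    then show ?case using elim by (simp add: field_simps)
  qed
  have "(\<lambda>N. t - 1 / real N) \<longlonglongrightarrow> t - 0" by (intro tendsto_intros lim_1_over_n)
  then show "(\<lambda>N. t - 1 / real N) \<longlonglongrightarrow> t" by simp
qed simp

lemma filterlim_floor_mult:
  assumes "0 < c"
  shows "filterlim (\<lambda>N. nat \<lfloor>c * real N\<rfloor>) at_top sequentially"
  unfolding filterlim_at_top
proof
  fix K :: nat
  have "\<forall>\<^sub>F N in sequentially. real N \<ge> (real K + 1) / c"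
    by (rule eventually_sequentiallyI[of "nat \<lceil>(real K + 1) / c\<rceil>"]) linarith
  then show "\<forall>\<^sub>F N in sequentially. K \<le> nat \<lfloor>c * real N\<rfloor>"
  proof eventually_elim
    case (elim N)
    then have "real K + 1 \<le> c * real N" using assms by (simp add: field_simps)
    then show ?case by linarith
  qed
qed

text \<open>Only the Laplace transforms \<open>\<phi> t\<close> of the limit enter, not the process
  itself. The locale can therefore be used with several exceptional sets \<open>D\<close> for the
  same \<open>\<phi>\<close>.\<close>

locale trap_walk_limit = trap_walk E q \<nu> for E :: "'e measure" and q and \<nu> :: "'a::ab_group_add pmf" +
  fixes a :: "nat \<Rightarrow> real" and D :: "real set" and \<phi> :: "real \<Rightarrow> real \<Rightarrow> real"
  assumes r_pos: "\<And>n. 0 < r n"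
    and r_sv: "\<And>c. 0 < c \<Longrightarrow> (\<lambda>n. r (nat \<lfloor>c * real n\<rfloor>) / r n) \<longlonglongrightarrow> 1"
    and a_top: "filterlim a at_top sequentially"
    and countable_D: "countable D"
    and conv: "\<And>t \<eta>. 0 \<le> t \<Longrightarrow> t \<notin> D \<Longrightarrow> 0 \<le> \<eta> \<Longrightarrow>
      (\<lambda>N. Z (\<lambda>_. \<eta> / a N) (nat \<lfloor>real N * t\<rfloor>)) \<longlonglongrightarrow> \<phi> t \<eta>"
    and \<phi>_pos: "\<And>t \<eta>. 0 \<le> t \<Longrightarrow> 0 \<le> \<eta> \<Longrightarrow> 0 < \<phi> t \<eta>"
    and \<phi>_arg_0: "\<And>t. 0 \<le> t \<Longrightarrow> (\<phi> t \<longlongrightarrow> 1) (at_right 0)"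
    and \<phi>_right_cont: "\<And>t \<eta>. 0 \<le> t \<Longrightarrow> 0 \<le> \<eta> \<Longrightarrow> ((\<lambda>s. \<phi> s \<eta>) \<longlongrightarrow> \<phi> t \<eta>) (at_right t)"
begin

lemma a_pos: "\<forall>\<^sub>F N in sequentially. 0 < a N"
  using a_top by (auto simp: filterlim_at_top_dense)

text \<open>The exceptional times \<open>D\<close> are avoided by working with the positive rational multiples of one
  suitable \<open>\<delta>\<close>.\<close>

lemma rational_grid: "\<exists>\<delta>>0. \<forall>p\<in>\<rat>. 0 < p \<longrightarrow> \<delta> * p \<notin> D"
proof -
  \<comment> \<open>\<open>\<delta> * p = d\<close> with \<open>p > 0\<close> and
    \<open>d \<in> D\<close> would put \<open>\<delta>\<close> into this countable set.\<close>
  let ?B = "(\<lambda>(p, d). d / p) ` (\<rat> \<times> D)"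
  have "countable ?B" using countable_D countable_rat by (intro countable_image countable_SIGMA) auto
  moreover have "uncountable {0<..<1::real}" by (simp add: uncountable_open_interval)
  ultimately obtain \<delta> where \<delta>: "\<delta> \<in> {0<..<1}" "\<delta> \<notin> ?B"
    by (meson countable_subset subsetI)
  have "\<delta> * p \<notin> D" if "p \<in> \<rat>" "0 < p" for p
  proof
    assume "\<delta> * p \<in> D"
    then have "(\<lambda>(p, d). d / p) (p, \<delta> * p) \<in> ?B" using that by blast
    then show False using \<delta> that by simp
  qed
  then show ?thesis using \<delta> by auto
qed

definition \<delta> :: real where "\<delta> = (SOME \<delta>. \<delta> > 0 \<and> (\<forall>p\<in>\<rat>. 0 < p \<longrightarrow> \<delta> * p \<notin> D))"

definition grid :: "real set" where "grid = {\<delta> * p | p. p \<in> \<rat> \<and> 0 < p}"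

lemma \<delta>: "0 < \<delta>" "p \<in> \<rat> \<Longrightarrow> 0 < p \<Longrightarrow> \<delta> * p \<notin> D"
  using someI_ex[OF rational_grid] unfolding \<delta>_def by auto

lemma gridI: "p \<in> \<rat> \<Longrightarrow> 0 < p \<Longrightarrow> \<delta> * p \<in> grid"
  by (auto simp: grid_def)

lemma grid_pos: "t \<in> grid \<Longrightarrow> 0 < t" and grid_D: "t \<in> grid \<Longrightarrow> t \<notin> D"
  using \<delta> by (auto simp: grid_def)

lemma grid_add: "s \<in> grid \<Longrightarrow> t \<in> grid \<Longrightarrow> s + t \<in> grid"
  unfolding grid_def by (smt (verit) Rats_add distrib_left mem_Collect_eq)

lemma grid_mult: "p \<in> \<rat> \<Longrightarrow> 0 < p \<Longrightarrow> t \<in> grid \<Longrightarrow> p * t \<in> grid"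
  unfolding grid_def by clarsimp (metis Rats_mult mult.left_commute mult_pos_pos)

lemma grid_dense:
  assumes "0 \<le> x" "x < y"
  obtains s where "s \<in> grid" "x < s" "s < y"
proof -
  have "x / \<delta> < y / \<delta>" using assms \<delta> by (simp add: divide_strict_right_mono)
  then obtain p where p: "p \<in> \<rat>" "x / \<delta> < p" "p < y / \<delta>"
    using Rats_dense_in_real by blast
  have "0 \<le> x / \<delta>" using assms \<delta> by simp
  then have "0 < p" using p by linarith
  then show ?thesis
    using that[of "\<delta> * p"] gridI[of p] p \<delta>(1) by (simp add: field_simps)
qed

text \<open>The next point strictly above \<open>u\<close> of the lattice with mesh
  \<open>\<delta> / (k + 1)\<close>. Strictness lets right continuity apply, and monotonicity in
  \<open>u\<close> for fixed \<open>k\<close> keeps ordered times ordered.\<close>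

definition grid_above :: "nat \<Rightarrow> real \<Rightarrow> real" where
  "grid_above k u = \<delta> * ((of_int \<lfloor>real (Suc k) * (u / \<delta>)\<rfloor> + 1) / real (Suc k))"

lemma grid_above_bounds: "u < grid_above k u" "grid_above k u \<le> u + \<delta> * (1 / real (Suc k))"
proof -
  define K where "K = real (Suc k)"
  have K: "0 < K" by (simp add: K_def)
  let ?x = "K * (u / \<delta>)"
  have "?x < of_int \<lfloor>?x\<rfloor> + 1" "of_int \<lfloor>?x\<rfloor> + 1 \<le> ?x + 1" by linarith+
  then have "u / \<delta> < (of_int \<lfloor>?x\<rfloor> + 1) / K" "(of_int \<lfloor>?x\<rfloor> + 1) / K \<le> (?x + 1) / K"
    using K by (auto intro: divide_right_mono simp: less_divide_eq mult.commute)
  moreover have "(?x + 1) / K = u / \<delta> + 1 / K" using K by (simp add: add_divide_distrib)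
  ultimately have "u / \<delta> < (of_int \<lfloor>real (Suc k) * (u / \<delta>)\<rfloor> + 1) / real (Suc k)"
    "(of_int \<lfloor>real (Suc k) * (u / \<delta>)\<rfloor> + 1) / real (Suc k) \<le> u / \<delta> + 1 / real (Suc k)"
    unfolding K_def by simp_all
  then have "\<delta> * (u / \<delta>) < grid_above k u" "grid_above k u \<le> \<delta> * (u / \<delta> + 1 / real (Suc k))"
    using \<delta>(1) unfolding grid_above_def
    by (auto intro!: mult_strict_left_mono mult_left_mono simp del: times_divide_eq_right)
  then show "u < grid_above k u" "grid_above k u \<le> u + \<delta> * (1 / real (Suc k))"
    using \<delta>(1) by (simp_all add: distrib_left)
qed

lemma grid_above_tendsto: "(\<lambda>k. grid_above k u) \<longlonglongrightarrow> u"
proof (rule tendsto_sandwich[of "\<lambda>_. u"])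
  show "\<forall>\<^sub>F k in sequentially. u \<le> grid_above k u"
    using grid_above_bounds(1) by (intro always_eventually allI less_imp_le)
  show "\<forall>\<^sub>F k in sequentially. grid_above k u \<le> u + \<delta> * (1 / real (Suc k))"
    by (intro always_eventually allI grid_above_bounds(2))
  have "(\<lambda>k. u + \<delta> * (1 / real (Suc k))) \<longlonglongrightarrow> u + \<delta> * 0"
    by (intro tendsto_intros LIMSEQ_Suc lim_1_over_n)
  then show "(\<lambda>k. u + \<delta> * (1 / real (Suc k))) \<longlonglongrightarrow> u" by simp
qed simp

lemma grid_above_at_right: "filterlim (\<lambda>k. grid_above k u) (at_right u) sequentially"
  using grid_above_tendsto[of u] grid_above_bounds(1)[of u]
  by (auto simp: filterlim_at less_imp_neq[symmetric] intro!: always_eventually)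

lemma grid_above_in_grid:
  assumes "0 \<le> u"
  shows "grid_above k u \<in> grid"
proof -
  have "0 < grid_above k u" using assms grid_above_bounds(1)[of u k] by linarith
  then have "0 < (of_int \<lfloor>real (Suc k) * (u / \<delta>)\<rfloor> + 1) / real (Suc k)"
    using zero_less_mult_pos[of \<delta>] \<delta>(1) unfolding grid_above_def by blast
  then show ?thesis unfolding grid_above_def by (intro gridI) auto
qed

lemma grid_above_mono: "u \<le> v \<Longrightarrow> grid_above k u \<le> grid_above k v"
proof -
  assume "u \<le> v"
  then have "real (Suc k) * (u / \<delta>) \<le> real (Suc k) * (v / \<delta>)"
    using \<delta>(1) by (intro mult_left_mono divide_right_mono) auto
  then have "\<lfloor>real (Suc k) * (u / \<delta>)\<rfloor> \<le> \<lfloor>real (Suc k) * (v / \<delta>)\<rfloor>" by (rule floor_mono)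
  then show ?thesis
    unfolding grid_above_def using \<delta>(1) by (intro mult_left_mono divide_right_mono) auto
qed

lemma countable_grid: "countable grid"
proof -
  have "grid \<subseteq> (*) \<delta> ` \<rat>" by (auto simp: grid_def)
  then show ?thesis using countable_rat countable_subset by blast
qed

lemma conv_grid:
  "t \<in> grid \<Longrightarrow> 0 \<le> \<eta> \<Longrightarrow> (\<lambda>N. Z (\<lambda>_. \<eta> / a N) (nat \<lfloor>real N * t\<rfloor>)) \<longlonglongrightarrow> \<phi> t \<eta>"
  using conv grid_D grid_pos by (simp add: less_imp_le)

text \<open>Tightness: \<open>\<phi> t\<close> is close to \<open>1\<close> at some small
  \<open>y\<close>, where \<open>Z_const_le\<close> then keeps the mean of \<open>G\<close> below
  \<open>1\<close>; finitely many doublings lead from \<open>y\<close> beyond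
  \<open>\<eta>\<close>.\<close>

lemma meanG_bounded:
  assumes "0 \<le> \<eta>"
  shows "\<exists>B. \<forall>\<^sub>F N in sequentially. meanG (\<eta> / a N) (T * N) \<le> B"
proof -
  \<comment> \<open>A time beyond \<open>T\<close>, so that \<open>\<lfloor>N * t\<rfloor>\<close>
    steps cover \<open>T * N\<close>.\<close>
  obtain t where t: "t \<in> grid" "real T + 1 < t" using grid_dense[of "real T + 1" "real T + 2"] by auto
  have "\<forall>\<^sub>F x in at_right 0. 5 / 6 < \<phi> t x"
    using \<phi>_arg_0[of t] grid_pos[OF t(1)] by (intro order_tendstoD(1)[where y = 1]) auto
  then obtain x0 where x0: "0 < x0" "\<And>x. 0 < x \<Longrightarrow> x < x0 \<Longrightarrow> 5 / 6 < \<phi> t x"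
    by (auto simp: eventually_at_right_field)
  define y where "y = x0 / 2"
  have y: "0 < y" "5 / 6 < \<phi> t y" using x0 by (auto simp: y_def)
  have double: "meanG (2 ^ j * y / a N) n \<le> 2 ^ j * meanG (y / a N) n" if "0 < a N" for j N n
  proof (induction j)
    case (Suc j)
    have "meanG (2 * (2 ^ j * y / a N)) n \<le> 2 * meanG (2 ^ j * y / a N) n"
      using y that by (intro meanG_double) auto
    then show ?case using Suc by (simp add: mult.assoc)
  qed simp
  obtain j where "\<eta> / y < 2 ^ j" using real_arch_pow[of 2 "\<eta> / y"] by auto
  then have j: "\<eta> \<le> 2 ^ j * y" using y by (simp add: field_simps)
  have "\<forall>\<^sub>F N in sequentially. 5 / 6 < Z (\<lambda>_. y / a N) (nat \<lfloor>real N * t\<rfloor>)"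
    using conv_grid[OF t(1), of y] y by (intro order_tendstoD(1)) auto
  then have "\<forall>\<^sub>F N in sequentially. meanG (\<eta> / a N) (T * N) \<le> 2 ^ j"
    using a_pos
  proof eventually_elim
    case (elim N)
    have "meanG (y / a N) (nat \<lfloor>real N * t\<rfloor>) < 1"
      using Z_const_le[of "y / a N" "nat \<lfloor>real N * t\<rfloor>"] elim y by force
    moreover have "T * N \<le> nat \<lfloor>real N * t\<rfloor>"
    proof -
      have "real N * real T \<le> real N * t" using t by (intro mult_left_mono) auto
      then have "real (T * N) \<le> real N * t" by (simp add: mult.commute)
      then show ?thesis by linarith
    qed
    ultimately have *: "meanG (y / a N) (T * N) \<le> 1"
      using meanG_mono[of "y / a N" "T * N" "nat \<lfloor>real N * t\<rfloor>"] y elim by simp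
    have "meanG (\<eta> / a N) (T * N) \<le> meanG (2 ^ j * y / a N) (T * N)"
      using assms j elim by (intro meanG_mono_arg) (auto intro!: divide_right_mono)
    also have "\<dots> \<le> 2 ^ j * meanG (y / a N) (T * N)" using elim by (intro double)
    also have "\<dots> \<le> 2 ^ j * 1" using * by (intro mult_left_mono) auto
    finally show ?case by simp
  qed
  then show ?thesis by blast
qed

lemma Z_append_limit:
  fixes n m :: "nat \<Rightarrow> nat" and T :: nat
  assumes "0 < T" "\<And>N. n N \<le> T * N" "\<And>N. m N \<le> T * N"
    and "\<forall>\<^sub>F N in sequentially. \<forall>k. 0 \<le> w N k" "\<forall>\<^sub>F N in sequentially. \<forall>k<n N. w N k \<le> \<eta> / a N" "0 \<le> \<eta>"
  shows "(\<lambda>N. Z (w N) (n N + m N) - Z (w N) (n N) * Z (\<lambda>k. w N (n N + k)) (m N)) \<longlonglongrightarrow> 0"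
proof -
  obtain B where "\<forall>\<^sub>F N in sequentially. meanG (\<eta> / a N) (2 * T * N) \<le> B"
    using meanG_bounded[OF assms(6), of "2 * T"] by auto
  moreover have "\<forall>\<^sub>F N in sequentially. 0 \<le> \<eta> / a N"
    using a_pos by eventually_elim (use assms in simp)
  ultimately show ?thesis
    using assms by (intro Z_append_asymp[where \<theta> = "\<lambda>N. \<eta> / a N" and T = T and B = B] r_pos r_sv)
qed

text \<open>The second block has
  \<open>\<lfloor>N * (s + t)\<rfloor> - \<lfloor>N * s\<rfloor>\<close> steps, which need not be
  \<open>\<lfloor>N * t\<rfloor>\<close>; the discrepancy is removed in
  \<open>\<phi>_add\<close>.\<close>

lemma Z_floor_add:
  assumes "0 \<le> s" "0 \<le> t" "0 \<le> \<eta>"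
  shows "(\<lambda>N. Z (\<lambda>_. \<eta> / a N) (nat \<lfloor>real N * (s + t)\<rfloor>) - Z (\<lambda>_. \<eta> / a N) (nat \<lfloor>real N * s\<rfloor>) *
    Z (\<lambda>_. \<eta> / a N) (nat \<lfloor>real N * (s + t)\<rfloor> - nat \<lfloor>real N * s\<rfloor>)) \<longlonglongrightarrow> 0"
proof -
  define T where "T = nat \<lceil>s + t\<rceil> + 1"
  have le: "nat \<lfloor>real N * s\<rfloor> \<le> nat \<lfloor>real N * (s + t)\<rfloor>" for N
    using assms by (intro nat_mono floor_mono mult_left_mono) auto
  have T: "nat \<lfloor>real N * (s + t)\<rfloor> \<le> T * N" for N
  proof -
    have "s + t \<le> real T" unfolding T_def by linarith
    then have "real N * (s + t) \<le> real N * real T" by (intro mult_left_mono) auto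
    then have "real N * (s + t) \<le> real (T * N)" by (simp add: mult.commute)
    then show ?thesis by linarith
  qed
  have nn: "\<forall>\<^sub>F N in sequentially. \<forall>k::nat. 0 \<le> \<eta> / a N"
    using a_pos by eventually_elim (use assms in simp)
  show ?thesis
    using Z_append_limit[where n = "\<lambda>N. nat \<lfloor>real N * s\<rfloor>" and w = "\<lambda>N _. \<eta> / a N" and \<eta> = \<eta> and T = T and
        m = "\<lambda>N. nat \<lfloor>real N * (s + t)\<rfloor> - nat \<lfloor>real N * s\<rfloor>"] nn le T assms order_trans[OF le T]
      diff_le_self[THEN order_trans, OF T]
    by (simp add: T_def)
qed

text \<open>The second block has at least \<open>\<lfloor>N * t\<rfloor>\<close> steps and, for each
  \<open>u > t\<close>, eventually at most \<open>\<lfloor>N * u\<rfloor>\<close>. As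
  \<open>Z\<close> decreases in the number of steps, this gives two bounds, and right continuity
  closes the gap between them.\<close>

lemma \<phi>_add:
  assumes s: "s \<in> grid" and t: "t \<in> grid" and \<eta>: "0 \<le> \<eta>"
  shows "\<phi> (s + t) \<eta> = \<phi> s \<eta> * \<phi> t \<eta>"
proof -
  let ?Z = "\<lambda>N. Z (\<lambda>_. \<eta> / a N)"
  let ?m = "\<lambda>N. nat \<lfloor>real N * (s + t)\<rfloor> - nat \<lfloor>real N * s\<rfloor>"
  have st: "0 < s" "0 < t" using s t grid_pos by auto
  have "(\<lambda>N. ?Z N (nat \<lfloor>real N * (s + t)\<rfloor>) -
      (?Z N (nat \<lfloor>real N * (s + t)\<rfloor>) - ?Z N (nat \<lfloor>real N * s\<rfloor>) * ?Z N (?m N))) \<longlonglongrightarrow> \<phi> (s + t) \<eta> - 0"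
    using st \<eta> by (intro tendsto_diff Z_floor_add conv_grid grid_add s t) auto
  then have lim: "(\<lambda>N. ?Z N (nat \<lfloor>real N * s\<rfloor>) * ?Z N (?m N)) \<longlonglongrightarrow> \<phi> (s + t) \<eta>" by simp
  have upper: "\<phi> (s + t) \<eta> \<le> \<phi> s \<eta> * \<phi> t \<eta>"
  proof (rule tendsto_le[OF _ _ lim])
    show "(\<lambda>N. ?Z N (nat \<lfloor>real N * s\<rfloor>) * ?Z N (nat \<lfloor>real N * t\<rfloor>)) \<longlonglongrightarrow> \<phi> s \<eta> * \<phi> t \<eta>"
      by (intro tendsto_mult conv_grid s t \<eta>)
    show "\<forall>\<^sub>F N in sequentially. ?Z N (nat \<lfloor>real N * s\<rfloor>) * ?Z N (?m N)
        \<le> ?Z N (nat \<lfloor>real N * s\<rfloor>) * ?Z N (nat \<lfloor>real N * t\<rfloor>)"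
      using a_pos
    proof eventually_elim
      case (elim N)
      have "0 \<le> real N * s" "0 \<le> real N * t" using st by auto
      then have "nat \<lfloor>real N * t\<rfloor> \<le> ?m N" unfolding distrib_left by linarith
      then show ?case using elim \<eta> by (intro mult_left_mono Z_antimono Z_bounds) auto
    qed
  qed simp
  have lower: "\<phi> s \<eta> * \<phi> u \<eta> \<le> \<phi> (s + t) \<eta>" if u: "u \<in> grid" "t < u" for u
  proof (rule tendsto_le[OF _ lim])
    show "(\<lambda>N. ?Z N (nat \<lfloor>real N * s\<rfloor>) * ?Z N (nat \<lfloor>real N * u\<rfloor>)) \<longlonglongrightarrow> \<phi> s \<eta> * \<phi> u \<eta>"
      by (intro tendsto_mult conv_grid s u \<eta>)
    have "\<forall>\<^sub>F N in sequentially. 1 / (u - t) \<le> real N"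
      by (rule eventually_sequentiallyI[of "nat \<lceil>1 / (u - t)\<rceil>"]) linarith
    then show "\<forall>\<^sub>F N in sequentially. ?Z N (nat \<lfloor>real N * s\<rfloor>) * ?Z N (nat \<lfloor>real N * u\<rfloor>)
        \<le> ?Z N (nat \<lfloor>real N * s\<rfloor>) * ?Z N (?m N)"
      using a_pos
    proof eventually_elim
      case (elim N)
      have "1 \<le> real N * u - real N * t" using elim u by (simp add: field_simps)
      moreover have "0 \<le> real N * s" "0 \<le> real N * t" using st by auto
      ultimately have "?m N \<le> nat \<lfloor>real N * u\<rfloor>" unfolding distrib_left by linarith
      then show ?case using elim \<eta> by (intro mult_left_mono Z_antimono Z_bounds) auto
    qed
  qed simp
  have "((\<lambda>u. \<phi> s \<eta> * \<phi> u \<eta>) \<longlongrightarrow> \<phi> s \<eta> * \<phi> t \<eta>) (at_right t)"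
    using st \<eta> by (intro tendsto_intros \<phi>_right_cont) auto
  moreover have "filterlim (\<lambda>k. t + \<delta> * (1 / real (Suc k))) (at_right t) sequentially"
    unfolding filterlim_at
  proof
    show "\<forall>\<^sub>F k in sequentially. t + \<delta> * (1 / real (Suc k)) \<in> {t<..} \<and> t + \<delta> * (1 / real (Suc k)) \<noteq> t"
      using \<delta> by (intro always_eventually) auto
    have "(\<lambda>k. t + \<delta> * (1 / real (Suc k))) \<longlonglongrightarrow> t + \<delta> * 0"
      by (intro tendsto_intros LIMSEQ_Suc lim_1_over_n)
    then show "(\<lambda>k. t + \<delta> * (1 / real (Suc k))) \<longlonglongrightarrow> t" by simp
  qed
  ultimately have "(\<lambda>k. \<phi> s \<eta> * \<phi> (t + \<delta> * (1 / real (Suc k))) \<eta>) \<longlonglongrightarrow> \<phi> s \<eta> * \<phi> t \<eta>"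
    by (rule filterlim_compose)
  moreover have "\<phi> s \<eta> * \<phi> (t + \<delta> * (1 / real (Suc k))) \<eta> \<le> \<phi> (s + t) \<eta>" for k
  proof (rule lower)
    have "\<delta> * (1 / real (Suc k)) \<in> grid" by (rule gridI) auto
    then show "t + \<delta> * (1 / real (Suc k)) \<in> grid" by (rule grid_add[OF t])
  qed (use \<delta> in simp)
  ultimately have "\<phi> s \<eta> * \<phi> t \<eta> \<le> \<phi> (s + t) \<eta>"
    by (intro LIMSEQ_le_const2) auto
  then show ?thesis using upper by simp
qed

text \<open>The time \<open>1\<close> may be exceptional; \<open>\<phi>_eq\<close> holds there as
  well, and any other positive time would yield the same exponent.\<close>

definition \<psi> :: "real \<Rightarrow> real" where "\<psi> \<eta> = - ln (\<phi> 1 \<eta>)"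

lemma \<phi>_mult_nat:
  assumes "t \<in> grid" "0 \<le> \<eta>"
  shows "\<phi> (real (Suc k) * t) \<eta> = \<phi> t \<eta> ^ Suc k"
proof (induction k)
  case (Suc k)
  have "real (Suc (Suc k)) * t = real (Suc k) * t + t" by (simp add: algebra_simps)
  moreover have "real (Suc k) * t \<in> grid" using assms by (intro grid_mult) auto
  ultimately show ?case using Suc \<phi>_add[of "real (Suc k) * t" t \<eta>] assms by simp
qed simp

text \<open>Multiplicativity fixes \<open>\<phi>\<close> at rational multiples of
  \<open>\<delta>\<close>; right limits along the grid extend this to all times, exceptional ones
  included.\<close>

lemma \<phi>_eq:
  assumes t: "0 \<le> t" and \<eta>: "0 \<le> \<eta>"
  shows "\<phi> t \<eta> = exp (- t * \<psi> \<eta>)"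
proof -
  define c where "c = - ln (\<phi> \<delta> \<eta>) / \<delta>"
  have \<delta>_grid: "\<delta> \<in> grid" using gridI[of 1] by simp
  have grid: "\<phi> u \<eta> = exp (- u * c)" if u: "u \<in> grid" for u
  proof -
    from u obtain p where p: "u = \<delta> * p" "p \<in> \<rat>" "0 < p" by (auto simp: grid_def)
    obtain k l :: nat where kl: "l \<noteq> 0" "p = real k / real l"
      using Rats_abs_nat_div_natE[OF p(2)] p(3) by (metis abs_of_pos)
    then have "k \<noteq> 0" using p(3) by (metis div_0 less_irrefl of_nat_0)
    then obtain k' l' where Suc: "k = Suc k'" "l = Suc l'" using kl not0_implies_Suc by metis
    have "\<phi> u \<eta> ^ l = \<phi> (real l * u) \<eta>" using \<phi>_mult_nat[OF u \<eta>, of l'] Suc by simp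
    also have "real l * u = real k * \<delta>" using kl p by simp
    also have "\<phi> (real k * \<delta>) \<eta> = \<phi> \<delta> \<eta> ^ k" using \<phi>_mult_nat[OF \<delta>_grid \<eta>, of k'] Suc by simp
    finally have "real l * ln (\<phi> u \<eta>) = real k * ln (\<phi> \<delta> \<eta>)"
      using \<phi>_pos[of u \<eta>] \<phi>_pos[of \<delta> \<eta>] grid_pos[OF u] \<delta>(1) \<eta> by (metis ln_realpow less_imp_le)
    then have "ln (\<phi> u \<eta>) = real k / real l * ln (\<phi> \<delta> \<eta>)"
      using kl(1) by (metis nonzero_mult_div_cancel_left of_nat_eq_0_iff times_divide_eq_left)
    then have "ln (\<phi> u \<eta>) = - u * c"
      using \<delta>(1) by (simp only: kl(2)[symmetric] p(1) c_def) simp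
    then show ?thesis using \<phi>_pos[of u \<eta>] grid_pos[OF u] \<eta> by (metis exp_ln less_imp_le)
  qed
  have all: "\<phi> u \<eta> = exp (- u * c)" if u: "0 \<le> u" for u
  proof -
    define v where "v k = grid_above k u" for k
    note v_lim = grid_above_tendsto[of u, folded v_def]
    have "filterlim v (at_right u) sequentially"
      using grid_above_at_right[of u] by (simp add: v_def[abs_def])
    then have "(\<lambda>k. \<phi> (v k) \<eta>) \<longlonglongrightarrow> \<phi> u \<eta>"
      by (rule filterlim_compose[OF \<phi>_right_cont[OF u \<eta>]])
    moreover have "v k \<in> grid" for k using grid_above_in_grid[OF u] by (simp add: v_def)
    ultimately have "(\<lambda>k. exp (- v k * c)) \<longlonglongrightarrow> \<phi> u \<eta>" by (simp add: grid)
    moreover have "(\<lambda>k. exp (- v k * c)) \<longlonglongrightarrow> exp (- u * c)" by (intro tendsto_intros v_lim)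
    ultimately show ?thesis by (rule LIMSEQ_unique)
  qed
  have "\<psi> \<eta> = c" using all[of 1] by (simp add: \<psi>_def)
  then show ?thesis using all[OF t] by simp
qed

lemma \<psi>_nonneg: "0 \<le> \<eta> \<Longrightarrow> 0 \<le> \<psi> \<eta>"
proof -
  assume \<eta>: "0 \<le> \<eta>"
  have g: "\<delta> \<in> grid" using gridI[of 1] by simp
  have "\<phi> \<delta> \<eta> \<le> 1"
  proof (rule tendsto_upperbound[OF conv_grid[OF g \<eta>]])
    show "\<forall>\<^sub>F N in sequentially. Z (\<lambda>_. \<eta> / a N) (nat \<lfloor>real N * \<delta>\<rfloor>) \<le> 1"
      using a_pos by eventually_elim (use \<eta> in \<open>auto intro!: Z_bounds\<close>)
  qed simp
  then show ?thesis using \<phi>_eq[of \<delta> \<eta>] \<delta>(1) \<eta> by (simp add: zero_le_mult_iff)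
qed

text \<open>\<open>Z\<close> decreases in the number of steps, so grid times on either side of
  \<open>t\<close> enclose \<open>Z\<close> at \<open>n N\<close>, and the limit is continuous in
  \<open>t\<close>. Blocks of any asymptotic length are thereby covered.\<close>

lemma Z_limit:
  fixes n :: "nat \<Rightarrow> nat"
  assumes n: "(\<lambda>N. real (n N) / real N) \<longlonglongrightarrow> t" and t: "0 \<le> t" and \<eta>: "0 \<le> \<eta>"
  shows "(\<lambda>N. Z (\<lambda>_. \<eta> / a N) (n N)) \<longlonglongrightarrow> exp (- t * \<psi> \<eta>)"
proof (rule order_tendstoI)
  fix b assume b: "b < exp (- t * \<psi> \<eta>)"
  have "((\<lambda>s. exp (- s * \<psi> \<eta>)) \<longlongrightarrow> exp (- t * \<psi> \<eta>)) (at_right t)" by (intro tendsto_intros)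
  then have "\<forall>\<^sub>F s in at_right t. b < exp (- s * \<psi> \<eta>)" using b by (rule order_tendstoD)
  then obtain y where y: "t < y" "\<And>s. t < s \<Longrightarrow> s < y \<Longrightarrow> b < exp (- s * \<psi> \<eta>)"
    by (auto simp: eventually_at_right_field)
  obtain s where s: "s \<in> grid" "t < s" "s < y" using grid_dense[OF t y(1)] .
  have "(\<lambda>N. Z (\<lambda>_. \<eta> / a N) (nat \<lfloor>real N * s\<rfloor>)) \<longlonglongrightarrow> exp (- s * \<psi> \<eta>)"
    using conv_grid[OF s(1) \<eta>] \<phi>_eq[of s \<eta>] s t \<eta> by simp
  then have "\<forall>\<^sub>F N in sequentially. b < Z (\<lambda>_. \<eta> / a N) (nat \<lfloor>real N * s\<rfloor>)"
    using y(2)[OF s(2,3)] by (rule order_tendstoD)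
  moreover have "\<forall>\<^sub>F N in sequentially. real (n N) / real N < s"
    using n s(2) by (rule order_tendstoD)
  ultimately show "\<forall>\<^sub>F N in sequentially. b < Z (\<lambda>_. \<eta> / a N) (n N)"
    using a_pos eventually_gt_at_top[of 0]
  proof eventually_elim
    case (elim N)
    then have "real (n N) \<le> real N * s" by (simp add: field_simps)
    then have "n N \<le> nat \<lfloor>real N * s\<rfloor>" by linarith
    then show ?case
      using elim \<eta> Z_antimono[of "\<lambda>_. \<eta> / a N" "n N" "nat \<lfloor>real N * s\<rfloor>"] by simp
  qed
next
  fix b assume b: "exp (- t * \<psi> \<eta>) < b"
  show "\<forall>\<^sub>F N in sequentially. Z (\<lambda>_. \<eta> / a N) (n N) < b"
  proof (cases "t = 0")
    \<comment> \<open>No grid time lies below \<open>0\<close>; here the limit is \<open>1\<close>,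
      an upper bound for \<open>Z\<close>.\<close>
    case True
    show ?thesis
      using a_pos
    proof eventually_elim
      case (elim N)
      then have "Z (\<lambda>_. \<eta> / a N) (n N) \<le> 1" using \<eta> by (intro Z_bounds) simp
      then show ?case using b True by simp
    qed
  next
    case False
    have "((\<lambda>s. exp (- s * \<psi> \<eta>)) \<longlongrightarrow> exp (- t * \<psi> \<eta>)) (at_left t)" by (intro tendsto_intros)
    then have "\<forall>\<^sub>F s in at_left t. exp (- s * \<psi> \<eta>) < b" using b by (rule order_tendstoD)
    then obtain y where y: "y < t" "\<And>s. y < s \<Longrightarrow> s < t \<Longrightarrow> exp (- s * \<psi> \<eta>) < b"
      by (auto simp: eventually_at_left_field)
    obtain s where s: "s \<in> grid" "max 0 y < s" "s < t" using grid_dense[of "max 0 y" t] y False t by auto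
    have "(\<lambda>N. Z (\<lambda>_. \<eta> / a N) (nat \<lfloor>real N * s\<rfloor>)) \<longlonglongrightarrow> exp (- s * \<psi> \<eta>)"
      using conv_grid[OF s(1) \<eta>] \<phi>_eq[of s \<eta>] s t \<eta> by simp
    then have "\<forall>\<^sub>F N in sequentially. Z (\<lambda>_. \<eta> / a N) (nat \<lfloor>real N * s\<rfloor>) < b"
      by (rule order_tendstoD) (use s y(2) in auto)
    moreover have "\<forall>\<^sub>F N in sequentially. s < real (n N) / real N"
      using n s(3) by (rule order_tendstoD)
    ultimately show ?thesis
      using a_pos eventually_gt_at_top[of 0]
    proof eventually_elim
      case (elim N)
      then have "real N * s \<le> real (n N)" by (simp add: field_simps)
      then have "nat \<lfloor>real N * s\<rfloor> \<le> n N" by linarith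
      then show ?case
        using elim \<eta> Z_antimono[of "\<lambda>_. \<eta> / a N" "nat \<lfloor>real N * s\<rfloor>" "n N"] by simp
    qed
  qed
qed

end

section \<open>Regular variation of the normalization\<close>

context trap_walk_limit begin

context
  assumes \<psi>_cont: "continuous_on {0..} \<psi>"
    and \<psi>_strict: "\<And>x y. 0 \<le> x \<Longrightarrow> x < y \<Longrightarrow> \<psi> x < \<psi> y"
    and \<psi>_0: "\<psi> 0 = 0"
begin

lemma \<psi>_pos: "0 < x \<Longrightarrow> 0 < \<psi> x"
  using \<psi>_strict[of 0 x] \<psi>_0 by simp

lemma \<psi>_less_iff: "0 \<le> x \<Longrightarrow> 0 \<le> y \<Longrightarrow> \<psi> x < \<psi> y \<longleftrightarrow> x < y"
  using \<psi>_strict[of x y] \<psi>_strict[of y x] by (cases x y rule: linorder_cases) auto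

text \<open>Comparing the clock at \<open>\<lfloor>cN\<rfloor>\<close> under the two normalizations \<open>a \<lfloor>cN\<rfloor>\<close> and \<open>a N\<close> is a
  convergence-of-types argument: both Laplace transforms converge to nondegenerate limits.\<close>

lemma convergence_of_types:
  assumes c: "0 < c"
  obtains \<rho> where "0 < \<rho>" "(\<lambda>N. a (nat \<lfloor>c * real N\<rfloor>) / a N) \<longlonglongrightarrow> \<rho>"
    "\<And>x. 0 < x \<Longrightarrow> \<psi> (\<rho> * x) = c * \<psi> x"
proof -
  define N' where "N' N = nat \<lfloor>c * real N\<rfloor>" for N
  define R where "R N = a (N' N) / a N" for N
  define L where "L N \<theta> = Z (\<lambda>_. \<theta> / a N) (N' N)" for N \<theta>
  have N': "filterlim N' at_top sequentially"
    unfolding N'_def by (rule filterlim_floor_mult[OF c])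
  have a_pos': "\<forall>\<^sub>F N in sequentially. 0 < a (N' N)"
    using a_pos N' by (rule eventually_compose_filterlim)
  have R_pos: "\<forall>\<^sub>F N in sequentially. 0 < R N"
    using a_pos a_pos' by eventually_elim (simp add: R_def)
  have L1: "(\<lambda>N. L N \<theta>) \<longlonglongrightarrow> exp (- c * \<psi> \<theta>)" if "0 \<le> \<theta>" for \<theta>
    unfolding L_def using c that floor_mult_ratio[of c]
    by (intro Z_limit) (auto simp: N'_def mult.commute)
  have diag: "(\<lambda>N. Z (\<lambda>_. \<eta> / a N) N) \<longlonglongrightarrow> exp (- \<psi> \<eta>)" if "0 \<le> \<eta>" for \<eta>
  proof -
    have "(\<lambda>N. real N / real N) \<longlonglongrightarrow> 1"
      by (rule tendsto_eventually) (use eventually_gt_at_top[of 0] in \<open>eventually_elim; simp\<close>)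
    from Z_limit[OF this _ that] show ?thesis by simp
  qed
  have L2: "(\<lambda>N. L N (\<eta> / R N)) \<longlonglongrightarrow> exp (- \<psi> \<eta>)" if "0 \<le> \<eta>" for \<eta>
  proof (rule Lim_transform_eventually[OF filterlim_compose[OF diag[OF that] N']])
    show "\<forall>\<^sub>F N in sequentially. Z (\<lambda>_. \<eta> / a (N' N)) (N' N) = L N (\<eta> / R N)"
      using a_pos a_pos' by eventually_elim (simp add: L_def R_def)
  qed
  have L_antimono: "\<forall>\<^sub>F N in sequentially. \<forall>x\<ge>0. \<forall>y\<ge>x. L N y \<le> L N x"
    using a_pos by eventually_elim (auto simp: L_def intro!: Z_antimono_arg divide_right_mono)
  \<comment> \<open>\<open>\<psi>\<close> is not yet known to be unbounded. The intermediate value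
    theorem is therefore applied on \<open>[0, 1]\<close>, solving for \<theta>0 if
    \<open>c \<ge> 1\<close> and for \<eta>0 otherwise.\<close>
  obtain \<eta>0 \<theta>0 where pair: "0 < \<eta>0" "0 < \<theta>0" "c * \<psi> \<theta>0 = \<psi> \<eta>0"
  proof (cases "1 \<le> c")
    case True
    have "\<exists>x\<ge>0. x \<le> 1 \<and> \<psi> x = \<psi> 1 / c"
      by (rule IVT') (use True \<psi>_pos[of 1] \<psi>_0 \<psi>_cont in \<open>auto simp: field_simps intro: continuous_on_subset\<close>)
    then obtain x where x: "0 \<le> x" "\<psi> x = \<psi> 1 / c" by blast
    then have "x \<noteq> 0" using \<psi>_pos[of 1] c \<psi>_0 by auto
    then show ?thesis using that[of 1 x] x c by auto
  next
    case False
    have "\<exists>x\<ge>0. x \<le> 1 \<and> \<psi> x = c * \<psi> 1"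
      by (rule IVT') (use False c \<psi>_pos[of 1] \<psi>_0 \<psi>_cont in \<open>auto intro: continuous_on_subset\<close>)
    then obtain x where x: "0 \<le> x" "\<psi> x = c * \<psi> 1" by blast
    then have "x \<noteq> 0" using \<psi>_pos[of 1] c \<psi>_0 by auto
    then show ?thesis using that[of x 1] x c by auto
  qed
  \<comment> \<open>\<open>L N\<close> has the same limit at \<theta>0 and at
    \<open>\<eta>0 / R N\<close>. Since \<open>L N\<close> is decreasing and its limit strictly
    decreasing, the two arguments must approach each other.\<close>
  have x_lim: "(\<lambda>N. \<eta>0 / R N) \<longlonglongrightarrow> \<theta>0"
  proof (rule order_tendstoI)
    fix u assume u: "u < \<theta>0"
    let ?u = "max 0 u"
    have "c * \<psi> ?u < \<psi> \<eta>0"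
      using pair u c \<psi>_strict[of ?u \<theta>0] by (simp add: pair(3)[symmetric])
    then obtain z where z: "exp (- \<psi> \<eta>0) < z" "z < exp (- c * \<psi> ?u)"
      using dense[of "exp (- \<psi> \<eta>0)" "exp (- c * \<psi> ?u)"] by auto
    have "\<forall>\<^sub>F N in sequentially. L N (\<eta>0 / R N) < z"
      using L2[of \<eta>0] z(1) pair by (intro order_tendstoD(2)) auto
    moreover have "\<forall>\<^sub>F N in sequentially. z < L N ?u"
      using L1[of ?u] z(2) by (intro order_tendstoD(1)) auto
    ultimately show "\<forall>\<^sub>F N in sequentially. u < \<eta>0 / R N"
      using L_antimono R_pos
    proof eventually_elim
      case (elim N)
      have "\<not> \<eta>0 / R N \<le> ?u"
      proof
        assume "\<eta>0 / R N \<le> ?u"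
        moreover have "0 \<le> \<eta>0 / R N" using elim pair by simp
        ultimately have "L N ?u \<le> L N (\<eta>0 / R N)" using elim by blast
        then show False using elim by simp
      qed
      then show ?case by simp
    qed
  next
    fix u assume u: "\<theta>0 < u"
    have "\<psi> \<eta>0 < c * \<psi> u"
      using pair u c \<psi>_strict[of \<theta>0 u] by (simp add: pair(3)[symmetric])
    then obtain z where z: "exp (- c * \<psi> u) < z" "z < exp (- \<psi> \<eta>0)"
      using dense[of "exp (- c * \<psi> u)" "exp (- \<psi> \<eta>0)"] by auto
    have "\<forall>\<^sub>F N in sequentially. z < L N (\<eta>0 / R N)"
      using L2[of \<eta>0] z(2) pair by (intro order_tendstoD(1)) auto
    moreover have "\<forall>\<^sub>F N in sequentially. L N u < z"
      using L1[of u] z(1) u pair by (intro order_tendstoD(2)) auto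
    ultimately show "\<forall>\<^sub>F N in sequentially. \<eta>0 / R N < u"
      using L_antimono R_pos
    proof eventually_elim
      case (elim N)
      have "\<not> u \<le> \<eta>0 / R N"
      proof
        assume "u \<le> \<eta>0 / R N"
        moreover have "0 \<le> u" using u pair by simp
        ultimately have "L N (\<eta>0 / R N) \<le> L N u" using elim by blast
        then show False using elim by simp
      qed
      then show ?case by simp
    qed
  qed
  define \<rho> where "\<rho> = \<eta>0 / \<theta>0"
  have \<rho>: "0 < \<rho>" using pair by (simp add: \<rho>_def)
  have "(\<lambda>N. \<eta>0 / (\<eta>0 / R N)) \<longlonglongrightarrow> \<rho>"
    unfolding \<rho>_def using pair by (intro tendsto_intros x_lim) auto
  then have R_lim: "R \<longlonglongrightarrow> \<rho>" using pair by simp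
  \<comment> \<open>As \<open>?l / R N\<close> tends to \<open>x\<close>, the limits can differ at
    most by a jump of \<open>\<psi>\<close> at \<open>x\<close>, and continuity excludes
    jumps.\<close>
  have "\<psi> (\<rho> * x) = c * \<psi> x" if x: "0 < x" for x
  proof -
    let ?l = "\<rho> * x"
    have lim: "(\<lambda>N. ?l / R N) \<longlonglongrightarrow> x"
      using tendsto_divide[OF tendsto_const R_lim, of ?l] \<rho> by simp
    have lower: "c * \<psi> u \<le> \<psi> ?l" if u: "0 \<le> u" "u < x" for u
    proof -
      have "exp (- \<psi> ?l) \<le> exp (- c * \<psi> u)"
      proof (rule tendsto_le[OF _ L1[OF u(1)] L2])
        show "\<forall>\<^sub>F N in sequentially. L N (?l / R N) \<le> L N u"
          using order_tendstoD(1)[OF lim u(2)] L_antimono by eventually_elim (use u in auto)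
      qed (use \<rho> x in auto)
      then show ?thesis by simp
    qed
    have upper: "\<psi> ?l \<le> c * \<psi> u" if u: "x < u" for u
    proof -
      have "exp (- c * \<psi> u) \<le> exp (- \<psi> ?l)"
      proof (rule tendsto_le[OF _ L2 L1])
        show "\<forall>\<^sub>F N in sequentially. L N u \<le> L N (?l / R N)"
          using order_tendstoD(2)[OF lim u(1)] L_antimono R_pos by eventually_elim (use x \<rho> in auto)
      qed (use \<rho> x u in auto)
      then show ?thesis by simp
    qed
    have "isCont \<psi> x"
      using \<psi>_cont x by (intro continuous_on_interior[of "{0..}"]) auto
    then have cont: "(\<psi> \<longlongrightarrow> \<psi> x) (at_left x)" "(\<psi> \<longlongrightarrow> \<psi> x) (at_right x)"
      by (auto simp: isCont_def filterlim_at_split)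
    have "c * \<psi> x \<le> \<psi> ?l"
    proof (rule tendsto_upperbound[OF tendsto_mult[OF tendsto_const cont(1)]])
      show "\<forall>\<^sub>F u in at_left x. c * \<psi> u \<le> \<psi> ?l"
        using x by (auto simp: eventually_at_left_field intro!: exI[of _ 0] lower)
    qed simp
    moreover have "\<psi> ?l \<le> c * \<psi> x"
    proof (rule tendsto_lowerbound[OF tendsto_mult[OF tendsto_const cont(2)]])
      show "\<forall>\<^sub>F u in at_right x. \<psi> ?l \<le> c * \<psi> u"
        by (auto simp: eventually_at_right_field intro!: exI[of _ "x + 1"] upper)
    qed simp
    ultimately show ?thesis by simp
  qed
  then show ?thesis using that[OF \<rho>] R_lim unfolding R_def N'_def by blast
qed

text \<open>Taking \<open>c = \<kappa> x\<close> in
  \<open>\<psi> (\<rho> c * y) = c * \<psi> y\<close>, injectivity of \<open>\<psi>\<close> gives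
  \<open>\<rho> (\<kappa> x) = x\<close>, and so \<open>\<kappa>\<close> is multiplicative. The
  hypothesis \<open>double\<close> rules out exponents above \<open>1\<close>.\<close>

lemma regular_variation:
  assumes double: "\<psi> 2 \<le> 2 * \<psi> 1"
  obtains \<alpha> where "0 < \<alpha>" "\<alpha> \<le> 1" "\<And>x. 0 \<le> x \<Longrightarrow> \<psi> x = \<psi> 1 * x powr \<alpha>"
    "\<And>c. 0 < c \<Longrightarrow> (\<lambda>N. a (nat \<lfloor>c * real N\<rfloor>) / a N) \<longlonglongrightarrow> c powr (1 / \<alpha>)"
proof -
  have "\<exists>\<rho>. \<forall>c>0. 0 < \<rho> c \<and> (\<lambda>N. a (nat \<lfloor>c * real N\<rfloor>) / a N) \<longlonglongrightarrow> \<rho> c \<and> (\<forall>x>0. \<psi> (\<rho> c * x) = c * \<psi> x)"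
    by (rule choice) (metis convergence_of_types)
  then obtain \<rho> where \<rho>: "\<And>c. 0 < c \<Longrightarrow> 0 < \<rho> c"
    "\<And>c. 0 < c \<Longrightarrow> (\<lambda>N. a (nat \<lfloor>c * real N\<rfloor>) / a N) \<longlonglongrightarrow> \<rho> c"
    "\<And>c x. 0 < c \<Longrightarrow> 0 < x \<Longrightarrow> \<psi> (\<rho> c * x) = c * \<psi> x" by blast
  define \<kappa> where "\<kappa> x = \<psi> x / \<psi> 1" for x
  have p1: "0 < \<psi> 1" by (rule \<psi>_pos) simp
  have inj: "x = y" if "\<psi> x = \<psi> y" "0 \<le> x" "0 \<le> y" for x y
    using that \<psi>_less_iff[of x y] \<psi>_less_iff[of y x] by linarith
  have \<kappa>_pos: "0 < \<kappa> x" if "0 < x" for x using that p1 \<psi>_pos by (simp add: \<kappa>_def)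
  have \<kappa>_mult: "\<kappa> (x * y) = \<kappa> x * \<kappa> y" if "0 < x" "0 < y" for x y
  proof -
      have k: "0 < \<kappa> x" using that p1 \<psi>_pos by (simp add: \<kappa>_def)
      have "\<psi> (\<rho> (\<kappa> x) * 1) = \<psi> x" using p1 \<rho>(3)[OF k, of 1] by (simp add: \<kappa>_def)
      then have "\<rho> (\<kappa> x) = x" using inj[of "\<rho> (\<kappa> x)" x] \<rho>(1)[OF k] that by simp
      then have "\<psi> (x * y) = \<kappa> x * \<psi> y" using \<rho>(3)[OF k that(2)] by simp
      then show ?thesis by (simp add: \<kappa>_def)
    qed
  have \<kappa>_strict: "\<kappa> x < \<kappa> y" if "0 < x" "x < y" for x y
      using \<psi>_strict[of x y] that p1 by (simp add: \<kappa>_def divide_strict_right_mono)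
  obtain \<alpha> where \<alpha>: "0 < \<alpha>" "\<And>x. 0 < x \<Longrightarrow> \<kappa> x = x powr \<alpha>"
    using multiplicative_mono_powr[of \<kappa>] \<kappa>_pos \<kappa>_mult \<kappa>_strict by metis
  have eq: "\<psi> x = \<psi> 1 * x powr \<alpha>" if "0 \<le> x" for x
    using that \<alpha>(2)[of x] p1 \<psi>_0 by (cases "x = 0") (auto simp: \<kappa>_def field_simps)
  have "2 powr \<alpha> \<le> 2 powr (1::real)" using double eq[of 2] p1 by simp
  then have \<alpha>1: "\<alpha> \<le> 1" by (subst (asm) powr_le_cancel_iff) simp_all
  have "\<rho> c = c powr (1 / \<alpha>)" if c: "0 < c" for c
  proof -
    have "\<psi> 1 * \<rho> c powr \<alpha> = c * \<psi> 1" using \<rho>(3)[OF c, of 1] eq[of "\<rho> c"] \<rho>(1)[OF c] by simp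
    then have "\<rho> c powr \<alpha> = c" using p1 by simp
    then have "(\<rho> c powr \<alpha>) powr (1 / \<alpha>) = c powr (1 / \<alpha>)" by simp
    then show ?thesis using \<alpha>(1) \<rho>(1)[OF c] by (simp add: powr_powr)
  qed
  then show ?thesis using that[of \<alpha>] \<alpha>(1) \<alpha>1 eq \<rho>(2) by metis
qed

end

section \<open>Joint Laplace transforms of several increments\<close>

text \<open>The weights that turn \<open>Z\<close> into the joint Laplace transform of the increments over the intervals
  from \<open>t i\<close> to \<open>t (Suc i)\<close>, with arguments \<open>\<eta> i\<close>.\<close>

definition block_weight :: "(nat \<Rightarrow> real) \<Rightarrow> (nat \<Rightarrow> real) \<Rightarrow> nat \<Rightarrow> nat \<Rightarrow> nat \<Rightarrow> real" where
  "block_weight t \<eta> j N k = (\<Sum>i<j. if nat \<lfloor>real N * t i\<rfloor> \<le> k \<and> k < nat \<lfloor>real N * t (Suc i)\<rfloor> then \<eta> i / a N else 0)"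

text \<open>Each induction step splits off the last interval: its weight is constant, so
  \<open>Z_limit\<close> applies, and the weights before it are those of the previous stage.\<close>

lemma joint_limit:
  assumes t: "0 \<le> t 0" "mono t" and \<eta>: "\<And>i. 0 \<le> \<eta> i"
  shows "(\<lambda>N. Z (block_weight t \<eta> j N) (nat \<lfloor>real N * t j\<rfloor>))
    \<longlonglongrightarrow> (\<Prod>i<j. exp (- (t (Suc i) - t i) * \<psi> (\<eta> i)))"
proof (induction j)
  case 0
  have "Z (block_weight t \<eta> 0 N) n = 1" for N n
    using Z_zero_weight[of n] by (simp add: block_weight_def[abs_def])
  then show ?case by simp
next
  case (Suc j)
  define n where "n i N = nat \<lfloor>real N * t i\<rfloor>" for i N
  have t_nonneg: "0 \<le> t i" for i using t(1) monoD[OF t(2), of 0 i] by simp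
  have n_mono: "n i N \<le> n i' N" if "i \<le> i'" for i i' N
    unfolding n_def using monoD[OF t(2) that] by (intro nat_mono floor_mono mult_left_mono) auto
  define T where "T = nat \<lceil>t (Suc j)\<rceil> + 1"
  have n_T: "n (Suc j) N \<le> T * N" for N
  proof -
    have "t (Suc j) \<le> real T" unfolding T_def by linarith
    then have "real N * t (Suc j) \<le> real N * real T" by (intro mult_left_mono) auto
    then have "real N * t (Suc j) \<le> real (T * N)" by (simp add: mult.commute)
    then show ?thesis unfolding n_def by linarith
  qed
  let ?w = "block_weight t \<eta> (Suc j)" and ?m = "\<lambda>N. n (Suc j) N - n j N"
  define \<Lambda> where "\<Lambda> = (\<Sum>i<Suc j. \<eta> i)"
  have w_nonneg: "\<forall>\<^sub>F N in sequentially. \<forall>k. 0 \<le> ?w N k"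
    using a_pos by eventually_elim (auto simp: block_weight_def \<eta> simp del: sum.lessThan_Suc intro!: sum_nonneg)
  have w_le: "\<forall>\<^sub>F N in sequentially. \<forall>k<n j N. ?w N k \<le> \<Lambda> / a N"
    using a_pos
  proof eventually_elim
    case (elim N)
    have "?w N k \<le> (\<Sum>i<Suc j. \<eta> i / a N)" for k
      unfolding block_weight_def using elim by (intro sum_mono) (auto simp: \<eta>)
    then show ?case by (simp add: \<Lambda>_def sum_divide_distrib del: sum.lessThan_Suc)
  qed
  have "(\<lambda>N. Z (?w N) (n j N + ?m N) - Z (?w N) (n j N) * Z (\<lambda>k. ?w N (n j N + k)) (?m N)) \<longlonglongrightarrow> 0"
  proof (rule Z_append_limit[where T = T and \<eta> = \<Lambda>])
    show "0 < T" by (simp add: T_def)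
    show "n j N \<le> T * N" "?m N \<le> T * N" for N
      using n_T[of N] n_mono[of j "Suc j" N] by auto
    show "0 \<le> \<Lambda>" unfolding \<Lambda>_def by (intro sum_nonneg \<eta>)
  qed (fact w_nonneg w_le)+
  moreover have "n j N + ?m N = n (Suc j) N" for N using n_mono[of j "Suc j" N] by simp
  moreover have "Z (?w N) (n j N) = Z (block_weight t \<eta> j N) (n j N)" for N
    by (rule Z_cong) (auto simp: block_weight_def n_def)
  moreover have "Z (\<lambda>k. ?w N (n j N + k)) (?m N) = Z (\<lambda>_. \<eta> j / a N) (?m N)" for N
  proof (rule Z_cong)
    fix k assume k: "k < ?m N"
    have "(\<Sum>i<j. if n i N \<le> n j N + k \<and> n j N + k < n (Suc i) N then \<eta> i / a N else 0) = 0"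
    proof (intro sum.neutral ballI)
      fix i assume "i \<in> {..<j}"
      then have "n (Suc i) N \<le> n j N" by (intro n_mono) auto
      then show "(if n i N \<le> n j N + k \<and> n j N + k < n (Suc i) N then \<eta> i / a N else 0) = 0" by simp
    qed
    then show "?w N (n j N + k) = \<eta> j / a N"
      using k by (simp add: block_weight_def n_def)
  qed
  ultimately have diff: "(\<lambda>N. Z (?w N) (n (Suc j) N) -
      Z (block_weight t \<eta> j N) (n j N) * Z (\<lambda>_. \<eta> j / a N) (?m N)) \<longlonglongrightarrow> 0" by simp
  have "(\<lambda>N. real (?m N) / real N) \<longlonglongrightarrow> t (Suc j) - t j"
  proof -
    have "(\<lambda>N. real (n (Suc j) N) / real N - real (n j N) / real N) \<longlonglongrightarrow> t (Suc j) - t j"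
      unfolding n_def by (intro tendsto_diff floor_mult_ratio t_nonneg)
    then show ?thesis using n_mono[of j "Suc j"] by (simp add: of_nat_diff diff_divide_distrib)
  qed
  then have "(\<lambda>N. Z (\<lambda>_. \<eta> j / a N) (?m N)) \<longlonglongrightarrow> exp (- (t (Suc j) - t j) * \<psi> (\<eta> j))"
    using monoD[OF t(2), of j "Suc j"] by (intro Z_limit \<eta>) auto
  then have "(\<lambda>N. (Z (?w N) (n (Suc j) N) - Z (block_weight t \<eta> j N) (n j N) * Z (\<lambda>_. \<eta> j / a N) (?m N))
      + Z (block_weight t \<eta> j N) (n j N) * Z (\<lambda>_. \<eta> j / a N) (?m N))
      \<longlonglongrightarrow> 0 + (\<Prod>i<j. exp (- (t (Suc i) - t i) * \<psi> (\<eta> i))) * exp (- (t (Suc j) - t j) * \<psi> (\<eta> j))"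
    using Suc.IH unfolding n_def[symmetric] by (intro tendsto_intros diff)
  then show ?case by (simp add: n_def)
qed

end

section \<open>The clock process\<close>

text \<open>Both sides integrate \<open>f\<close> against a measure on \<open>N\<close>: the image
  under \<open>T\<close> of \<open>M\<close> with density \<open>G\<close>, and the mixture of the
  kernel \<open>\<kappa>\<close> under the density \<open>c * H\<close>. Agreement on sets is
  agreement of the measures.\<close>

lemma nn_integral_kernel_extend:
  assumes [measurable]: "G \<in> borel_measurable M" "H \<in> borel_measurable M" "T \<in> M \<rightarrow>\<^sub>M N"
    and \<kappa>: "\<kappa> \<in> M \<rightarrow>\<^sub>M subprob_algebra N" and ne: "space M \<noteq> {}"
    and eq: "\<And>B. B \<in> sets N \<Longrightarrow> (\<integral>\<^sup>+\<omega>. G \<omega> * indicator B (T \<omega>) \<partial>M) = c * (\<integral>\<^sup>+\<omega>. H \<omega> * emeasure (\<kappa> \<omega>) B \<partial>M)"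
    and f [measurable]: "f \<in> borel_measurable N"
  shows "(\<integral>\<^sup>+\<omega>. G \<omega> * f (T \<omega>) \<partial>M) = c * (\<integral>\<^sup>+\<omega>. H \<omega> * (\<integral>\<^sup>+u. f u \<partial>\<kappa> \<omega>) \<partial>M)"
proof -
  let ?M1 = "distr (density M G) N T" and ?M0 = "density M (\<lambda>\<omega>. c * H \<omega>)"
  let ?M2 = "?M0 \<bind> \<kappa>"
  have \<kappa>0: "\<kappa> \<in> ?M0 \<rightarrow>\<^sub>M subprob_algebra N" using \<kappa> by simp
  have ne0: "space ?M0 \<noteq> {}" using ne by simp
  have \<kappa>f [measurable]: "(\<lambda>\<omega>. \<integral>\<^sup>+u. h u \<partial>\<kappa> \<omega>) \<in> borel_measurable M" if "h \<in> borel_measurable N" for h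
    using measurable_compose[OF \<kappa> nn_integral_measurable_subprob_algebra[OF that]] .
  have \<kappa>B [measurable]: "(\<lambda>\<omega>. emeasure (\<kappa> \<omega>) B) \<in> borel_measurable M" if "B \<in> sets N" for B
    using measurable_compose[OF \<kappa> measurable_emeasure_subprob_algebra[OF that]] .
  have "?M1 = ?M2"
  proof (rule measure_eqI)
    show "sets ?M1 = sets ?M2" using ne0 sets_bind[OF sets_kernel[OF \<kappa>0] ne0] by simp
    fix B assume "B \<in> sets ?M1"
    then have B [measurable]: "B \<in> sets N" by simp
    have "emeasure ?M1 B = (\<integral>\<^sup>+\<omega>. G \<omega> * indicator (T -` B \<inter> space M) \<omega> \<partial>M)"
      by (simp add: emeasure_distr emeasure_density)
    also have "\<dots> = (\<integral>\<^sup>+\<omega>. G \<omega> * indicator B (T \<omega>) \<partial>M)"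
      by (intro nn_integral_cong) (auto split: split_indicator)
    also have "\<dots> = (\<integral>\<^sup>+\<omega>. c * H \<omega> * emeasure (\<kappa> \<omega>) B \<partial>M)"
      using B by (simp add: eq nn_integral_cmult mult.assoc)
    also have "\<dots> = emeasure ?M2 B"
      using B by (simp add: emeasure_bind[OF ne0 \<kappa>0] nn_integral_density)
    finally show "emeasure ?M1 B = emeasure ?M2 B" .
  qed
  then have "(\<integral>\<^sup>+u. f u \<partial>?M1) = (\<integral>\<^sup>+u. f u \<partial>?M2)" by simp
  then show ?thesis
    using f by (simp add: nn_integral_distr nn_integral_density nn_integral_bind[OF f \<kappa>0]
        nn_integral_cmult mult.assoc)
qed

lemma pmf_replicate_pmf:
  "length xs = n \<Longrightarrow> pmf (replicate_pmf n p) xs = (\<Prod>i<n. pmf p (xs ! i))"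
proof (induction n arbitrary: xs)
  case (Suc n)
  then obtain x ys where xs: "xs = x # ys" "length ys = n" by (cases xs) auto
  have "replicate_pmf (Suc n) p = map_pmf (\<lambda>(x, xs). x # xs) (pair_pmf p (replicate_pmf n p))"
    by (simp add: pair_pmf_def map_bind_pmf)
  moreover have "inj (\<lambda>(x, xs). x # xs)" by (auto simp: inj_on_def)
  ultimately have "pmf (replicate_pmf (Suc n) p) xs = pmf p x * pmf (replicate_pmf n p) ys"
    using pmf_map_inj'[of "\<lambda>(x, xs). x # xs" "pair_pmf p (replicate_pmf n p)" "(x, ys)"] xs
    by (simp add: pmf_pair)
  also have "\<dots> = (\<Prod>i<Suc n. pmf p (xs ! i))"
    using Suc.IH[OF xs(2)] unfolding prod.lessThan_Suc_shift by (simp add: xs)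
  finally show ?case .
qed simp

lemma space_pos_borel: "space pos_borel = {0<..}"
  by (simp add: pos_borel_def space_restrict_space)

lemma measurable_pos_borelD: "f \<in> M \<rightarrow>\<^sub>M pos_borel \<Longrightarrow> f \<in> borel_measurable M"
  by (simp add: pos_borel_def measurable_restrict_space2_iff)

lemma borel_measurable_pos_borel: "f \<in> borel_measurable borel \<Longrightarrow> f \<in> borel_measurable pos_borel"
  by (simp add: pos_borel_def measurable_restrict_space1)

locale rtrw_process =
  fixes M :: "'w measure" and \<nu> :: "(int ^ 'd::finite) pmf" and \<mu> :: "real measure measure"
    and \<pi> :: "int ^ 'd \<Rightarrow> 'w \<Rightarrow> real measure"
    and \<xi> :: "nat \<Rightarrow> 'w \<Rightarrow> int ^ 'd"
    and \<tau> :: "int ^ 'd \<Rightarrow> nat \<Rightarrow> 'w \<Rightarrow> real"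
  assumes rtrw: "rtrw M \<nu> \<mu> \<pi> \<xi> \<tau>"
begin

sublocale prob_space M using rtrw by (simp add: rtrw_def)

definition q :: "real \<Rightarrow> real measure \<Rightarrow> real" where
  "q \<theta> p = (\<integral>u. exp (- \<theta> * u) \<partial>p)"

definition steps :: "nat \<Rightarrow> 'w \<Rightarrow> (int ^ 'd) list" where
  "steps n \<omega> = map (\<lambda>i. \<xi> (Suc i) \<omega>) [0..<n]"

lemma \<mu>_in: "\<mu> \<in> space (prob_algebra (prob_algebra pos_borel))"
  and indep_\<pi>: "indep_vars (\<lambda>_. prob_algebra pos_borel) \<pi> UNIV"
  and distr_\<pi>: "\<forall>x. distr M (prob_algebra pos_borel) (\<pi> x) = \<mu>"
  and indep_\<xi>: "indep_vars (\<lambda>_. count_space UNIV) \<xi> {1..}"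
  and distr_\<xi>: "\<forall>i\<ge>1. distr M (count_space UNIV) (\<xi> i) = measure_pmf \<nu>"
  and \<tau>_meas: "\<forall>x. \<forall>i\<ge>1. \<tau> x i \<in> M \<rightarrow>\<^sub>M pos_borel"
  by (insert rtrw[unfolded rtrw_def], (elim conjE, assumption)+)

lemma sets_\<mu>: "sets \<mu> = sets (prob_algebra pos_borel)"
  and prob_space_\<mu>: "prob_space \<mu>"
  using \<mu>_in by (auto simp: space_prob_algebra)

lemma space_\<mu>D:
  assumes "p \<in> space \<mu>"
  shows "prob_space p" "sets p = sets pos_borel" "space p = {0<..}"
proof -
  have "p \<in> space (prob_algebra pos_borel)" using assms sets_eq_imp_space_eq[OF sets_\<mu>] by simp
  then show "prob_space p" "sets p = sets pos_borel" by (auto simp: space_prob_algebra)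
  then show "space p = {0<..}" using sets_eq_imp_space_eq space_pos_borel by metis
qed

lemma integrable_exp:
  assumes p: "p \<in> space \<mu>" and \<theta>: "0 \<le> \<theta>"
  shows "integrable p (\<lambda>u. exp (- \<theta> * u))"
proof -
  interpret p: prob_space p by (rule space_\<mu>D[OF p])
  have "(\<lambda>u. exp (- \<theta> * u)) \<in> borel_measurable p"
    using borel_measurable_pos_borel[of "\<lambda>u. exp (- \<theta> * u)"] measurable_cong_sets[OF space_\<mu>D(2)[OF p] refl]
    by auto
  then show ?thesis
    by (rule p.integrable_const_bound[where B = 1, rotated])
      (rule AE_I2, use space_\<mu>D(3)[OF p] \<theta> in simp)
qed

sublocale env: trap_walk \<mu> q \<nu>
proof (unfold trap_walk_def trap_walk_axioms_def, intro conjI prob_space_\<mu> allI impI)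
  fix \<theta>
  have "(\<lambda>p. q \<theta> p) \<in> borel_measurable (prob_algebra pos_borel)"
    unfolding q_def prob_algebra_def
    by (intro measurable_restrict_space1 integral_measurable_subprob_algebra borel_measurable_pos_borel) measurable
  then show "q \<theta> \<in> borel_measurable \<mu>" using measurable_cong_sets[OF sets_\<mu> refl] by auto
next
  fix p and \<theta> \<theta>' :: real assume p: "p \<in> space \<mu>"
  interpret p: prob_space p by (rule space_\<mu>D[OF p])
  note sp = space_\<mu>D(3)[OF p]
  show "0 \<le> q \<theta> p" by (simp add: q_def)
  show "q 0 p = 1" by (simp add: q_def p.prob_space)
  show "q \<theta> p \<le> 1" if "0 \<le> \<theta>"
  proof -
    have "q \<theta> p \<le> (\<integral>u. 1 \<partial>p)"
      unfolding q_def using sp that by (intro integral_mono integrable_exp p) auto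
    then show ?thesis by (simp add: p.prob_space)
  qed
  show "q \<theta>' p \<le> q \<theta> p" if "0 \<le> \<theta>" "\<theta> \<le> \<theta>'"
    unfolding q_def using sp that by (intro integral_mono integrable_exp p) (auto intro: mult_right_mono)
  show "(q \<theta> p)\<^sup>2 \<le> q (2 * \<theta>) p" if "0 \<le> \<theta>"
  proof -
    let ?e = "\<lambda>u. exp (- \<theta> * u)"
    have sq: "exp (- (2 * \<theta>) * u) = (?e u)\<^sup>2" for u
      by (simp add: exp_double[symmetric] power2_eq_square exp_add[symmetric])
    have i: "integrable p ?e" "integrable p (\<lambda>u. (?e u)\<^sup>2)"
      using integrable_exp[OF p that] integrable_exp[OF p, of "2 * \<theta>"] that by (auto simp only: sq) 
    \<comment> \<open>The variance of \<open>exp (- \<theta> * u)\<close> under the trapping law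
      \<open>p\<close> is nonnegative.\<close>
    have "0 \<le> (\<integral>u. (?e u - q \<theta> p)\<^sup>2 \<partial>p)" by simp
    also have "\<dots> = (\<integral>u. (?e u)\<^sup>2 - 2 * q \<theta> p * ?e u + (q \<theta> p)\<^sup>2 \<partial>p)"
      by (simp add: power2_diff algebra_simps)
    also have "\<dots> = q (2 * \<theta>) p - 2 * q \<theta> p * q \<theta> p + (q \<theta> p)\<^sup>2"
      using i unfolding q_def sq by (simp add: p.prob_space)
    finally show ?thesis by (simp add: power2_eq_square)
  qed
qed

lemma \<xi>_measurable: "1 \<le> i \<Longrightarrow> \<xi> i \<in> M \<rightarrow>\<^sub>M count_space UNIV"
  using indep_\<xi> by (auto simp: indep_vars_def)

lemma \<pi>_measurable: "\<pi> x \<in> M \<rightarrow>\<^sub>M prob_algebra pos_borel"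
  using indep_\<pi> by (auto simp: indep_vars_def)

lemma \<tau>_measurable: "1 \<le> i \<Longrightarrow> \<tau> x i \<in> M \<rightarrow>\<^sub>M pos_borel"
  using \<tau>_meas by blast

lemma steps_measurable: "steps n \<in> M \<rightarrow>\<^sub>M count_space UNIV"
proof (induction n)
  case 0
  then show ?case by (simp add: steps_def)
next
  case (Suc n)
  have "(\<lambda>\<omega>. steps n \<omega> @ [\<xi> (Suc n) \<omega>]) \<in> M \<rightarrow>\<^sub>M count_space UNIV"
  proof (rule measurable_compose_countable[where f = "\<lambda>x \<omega>. steps n \<omega> @ [x]"])
    show "(\<lambda>\<omega>. steps n \<omega> @ [x]) \<in> M \<rightarrow>\<^sub>M count_space UNIV" for x
      by (rule measurable_compose[OF Suc, where g = "\<lambda>xs. xs @ [x]"]) simp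
  qed (rule \<xi>_measurable, simp)
  then show ?case by (simp add: steps_def[abs_def])
qed

lemma prob_steps:
  assumes "length ys = n"
  shows "prob {\<omega> \<in> space M. steps n \<omega> = ys} = pmf (replicate_pmf n \<nu>) ys"
proof (cases "n = 0")
  case False
  have indep: "indep_vars (\<lambda>_. count_space UNIV) \<xi> (Suc ` {..<n})"
    by (rule indep_vars_subset[OF indep_\<xi>]) auto
  have single: "prob (\<xi> (Suc i) -` {x} \<inter> space M) = pmf \<nu> x" for i x
  proof -
    have "distr M (count_space UNIV) (\<xi> (Suc i)) = measure_pmf \<nu>" using distr_\<xi> by simp
    then have "measure (distr M (count_space UNIV) (\<xi> (Suc i))) {x} = pmf \<nu> x"
      by (simp add: measure_pmf_single)
    then show ?thesis using \<xi>_measurable[of "Suc i"] by (simp add: measure_distr)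
  qed
  have "{\<omega> \<in> space M. steps n \<omega> = ys} = (\<Inter>j\<in>Suc ` {..<n}. \<xi> j -` {ys ! (j - 1)} \<inter> space M)"
    using assms False by (auto simp: steps_def list_eq_iff_nth_eq)
  then have "prob {\<omega> \<in> space M. steps n \<omega> = ys} = (\<Prod>j\<in>Suc ` {..<n}. prob (\<xi> j -` {ys ! (j - 1)} \<inter> space M))"
    using indep_varsD[OF indep, of "Suc ` {..<n}" "\<lambda>j. {ys ! (j - 1)}"] False by (simp only:) auto
  also have "\<dots> = (\<Prod>i<n. pmf \<nu> (ys ! i))"
    by (simp add: prod.reindex single)
  finally show ?thesis by (simp add: pmf_replicate_pmf assms)
qed (use assms in \<open>simp add: steps_def prob_space\<close>)

lemma subalgebra_env: "subalgebra M (env_sigma M \<pi>)"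
proof -
  have "(\<lambda>\<omega> x. \<pi> x \<omega>) \<in> M \<rightarrow>\<^sub>M PiM UNIV (\<lambda>_. prob_algebra pos_borel)"
    by (intro measurable_PiM_single') (auto intro: \<pi>_measurable measurable_space[OF \<pi>_measurable] simp: PiE_def)
  note meas = this
  then have "(\<lambda>\<omega> x. \<pi> x \<omega>) \<in> space M \<rightarrow> space (PiM UNIV (\<lambda>_. prob_algebra pos_borel))"
    by (rule measurable_space[THEN Pi_I])
  then show ?thesis
    using measurable_sets[OF meas]
    by (auto simp: subalgebra_def env_sigma_def sets_vimage_algebra2)
qed

text \<open>The conditional law in \<open>rtrw\<close> is integrated over the environment, with the
  cylinder event that fixes the first \<open>n\<close> steps in place of \<open>C\<close>.\<close>

lemma prob_steps_traps:
  assumes ys: "length ys = n" and J: "finite J" "J \<subseteq> UNIV \<times> {1..}" and B: "\<And>j. j \<in> J \<Longrightarrow> B j \<in> sets pos_borel"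
  shows "prob {\<omega> \<in> space M. steps n \<omega> = ys \<and> (\<forall>(x, i)\<in>J. \<tau> x i \<omega> \<in> B (x, i))}
    = prob {\<omega> \<in> space M. steps n \<omega> = ys} * (\<integral>\<omega>. (\<Prod>(x, i)\<in>J. measure (\<pi> x \<omega>) (B (x, i))) \<partial>M)"
proof -
  note rtrw_cond = rtrw[unfolded rtrw_def, THEN conjunct2, THEN conjunct2, THEN conjunct2, THEN conjunct2,
      THEN conjunct2, THEN conjunct2, THEN conjunct2, THEN conjunct2]
  interpret F: finite_measure_subalgebra M "env_sigma M \<pi>"
    by unfold_locales (rule subalgebra_env)
  let ?P = "PiM {1..} (\<lambda>_. count_space UNIV) :: (nat \<Rightarrow> int ^ 'd) measure"
  let ?C = "{s \<in> space ?P. \<forall>i\<in>{..<n}. s (Suc i) = ys ! i}"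
  have C: "?C \<in> sets ?P"
  proof (intro sets.sets_Collect_finite_All)
    fix i assume "i \<in> {..<n}"
    have "(\<lambda>s. s (Suc i)) -` {ys ! i} \<inter> space ?P \<in> sets ?P"
      by (rule measurable_sets[OF measurable_component_singleton]) auto
    moreover have "{s \<in> space ?P. s (Suc i) = ys ! i} = (\<lambda>s. s (Suc i)) -` {ys ! i} \<inter> space ?P" by auto
    ultimately show "{s \<in> space ?P. s (Suc i) = ys ! i} \<in> sets ?P" by simp
  qed simp
  have C_iff: "(\<lambda>i\<in>{1..}. \<xi> i \<omega>) \<in> ?C \<longleftrightarrow> steps n \<omega> = ys" for \<omega>
    using ys by (auto simp: space_PiM steps_def list_eq_iff_nth_eq)
  let ?A = "{\<omega> \<in> space M. steps n \<omega> = ys \<and> (\<forall>(x, i)\<in>J. \<tau> x i \<omega> \<in> B (x, i))}"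
  have A: "?A \<in> sets M"
  proof -
    have "steps n -` {ys} \<inter> space M \<in> sets M" by (rule measurable_sets[OF steps_measurable]) simp
    moreover have "\<tau> x i -` B (x, i) \<inter> space M \<in> sets M" if "(x, i) \<in> J" for x i
      using that J B by (intro measurable_sets[OF \<tau>_measurable]) auto
    then have "{\<omega> \<in> space M. \<forall>j\<in>J. case j of (x, i) \<Rightarrow> \<tau> x i \<omega> \<in> B (x, i)} \<in> sets M"
      using J(1) by (intro sets.sets_Collect_finite_All) (auto simp: vimage_def Int_def conj_commute)
    moreover have "?A = (steps n -` {ys} \<inter> space M) \<inter> {\<omega> \<in> space M. \<forall>j\<in>J. case j of (x, i) \<Rightarrow> \<tau> x i \<omega> \<in> B (x, i)}"
      by auto
    ultimately show ?thesis by simp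
  qed
  have "AE \<omega> in M. real_cond_exp M (env_sigma M \<pi>)
      (indicator {\<omega> \<in> space M. (\<lambda>i\<in>{1..}. \<xi> i \<omega>) \<in> ?C \<and> (\<forall>(x, i)\<in>J. \<tau> x i \<omega> \<in> B (x, i))}) \<omega>
    = measure M {\<omega> \<in> space M. (\<lambda>i\<in>{1..}. \<xi> i \<omega>) \<in> ?C} * (\<Prod>(x, i)\<in>J. measure (\<pi> x \<omega>) (B (x, i)))"
  proof (rule mp[OF spec[OF spec[OF spec[OF rtrw_cond]]]])
    show "finite J \<and> J \<subseteq> UNIV \<times> {1..} \<and> (\<forall>j\<in>J. B j \<in> sets pos_borel) \<and> ?C \<in> sets ?P"
      using J B C by blast
  qed
  then have ae: "AE \<omega> in M. real_cond_exp M (env_sigma M \<pi>) (indicator ?A) \<omega>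
    = prob {\<omega> \<in> space M. steps n \<omega> = ys} * (\<Prod>(x, i)\<in>J. measure (\<pi> x \<omega>) (B (x, i)))"
    unfolding C_iff .
  have int: "integrable M (indicator ?A :: 'w \<Rightarrow> real)"
    using A by (intro integrable_real_indicator) (auto simp: less_top[symmetric])
  have meas: "(\<lambda>\<omega>. \<Prod>(x, i)\<in>J. measure (\<pi> x \<omega>) (B (x, i))) \<in> borel_measurable M"
  proof (intro borel_measurable_prod)
    fix j assume j: "j \<in> J"
    obtain x i where xi: "j = (x, i)" by (cases j)
    show "(\<lambda>\<omega>. case j of (x, i) \<Rightarrow> measure (\<pi> x \<omega>) (B (x, i))) \<in> borel_measurable M"
      unfolding xi prod.case using B[OF j] xi
      by (intro measurable_compose[OF \<pi>_measurable measurable_measure_prob_algebra]) simp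
  qed
  have "prob ?A = (\<integral>\<omega>. indicator ?A \<omega> \<partial>M)" using A by simp
  also have "\<dots> = (\<integral>\<omega>. real_cond_exp M (env_sigma M \<pi>) (indicator ?A) \<omega> \<partial>M)"
    by (rule F.real_cond_exp_int(2)[OF int, symmetric])
  also have "\<dots> = (\<integral>\<omega>. prob {\<omega> \<in> space M. steps n \<omega> = ys} * (\<Prod>(x, i)\<in>J. measure (\<pi> x \<omega>) (B (x, i))) \<partial>M)"
    by (rule integral_cong_AE[OF borel_measurable_integrable[OF F.real_cond_exp_int(1)[OF int]]
          borel_measurable_times[OF borel_measurable_const meas] ae])
  finally show ?thesis by simp
qed

end

section \<open>Holding times along a fixed path\<close>

lemma walk_eq_pos: "k \<le> n \<Longrightarrow> walk \<xi> k \<omega> = pos (map (\<lambda>i. \<xi> (Suc i) \<omega>) [0..<n]) k"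
proof -
  assume "k \<le> n"
  then have "pos (map (\<lambda>i. \<xi> (Suc i) \<omega>) [0..<n]) k = (\<Sum>i\<leftarrow>[0..<k]. \<xi> (Suc i) \<omega>)"
    by (simp add: pos_def take_map)
  also have "\<dots> = (\<Sum>i=0..<k. \<xi> (Suc i) \<omega>)" by (simp add: sum_list_distinct_conv_sum_set)
  also have "\<dots> = walk \<xi> k \<omega>"
    unfolding walk_def by (rule sum.reindex_bij_witness[of _ "\<lambda>i. i - 1" Suc]) auto
  finally show ?thesis ..
qed

lemma local_time_eq_visits:
  assumes "k \<le> n"
  shows "local_time \<xi> (walk \<xi> k \<omega>) k \<omega> = visits_to_end (take k (map (\<lambda>i. \<xi> (Suc i) \<omega>) [0..<n]))"
proof -
  let ?xs = "map (\<lambda>i. \<xi> (Suc i) \<omega>) [0..<n]"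
  have "{j \<in> {0..k}. walk \<xi> j \<omega> = walk \<xi> k \<omega>} = {j. j \<le> k \<and> pos ?xs j = pos ?xs k}"
    using assms by (auto simp: walk_eq_pos[where n = n])
  then show ?thesis using assms by (simp add: local_time_def visits_to_end_take)
qed

text \<open>The site and the visit number that select the holding time spent at step
  \<open>k\<close>. Once the list of steps is fixed these indices are nonrandom, which removes the
  random indices from the clock.\<close>

definition trap_index :: "'a::ab_group_add list \<Rightarrow> nat \<Rightarrow> 'a \<times> nat" where
  "trap_index ys k = (pos ys k, visits_to_end (take k ys))"

lemma visits_to_end_pos: "k \<le> length ys \<Longrightarrow> 1 \<le> visits_to_end (take k ys)"
proof -
  assume "k \<le> length ys"
  then have "visits_to_end (take k ys) = card {j. j \<le> k \<and> pos ys j = pos ys k}"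
    by (rule visits_to_end_take)
  moreover have "0 < card {j. j \<le> k \<and> pos ys j = pos ys k}" by (auto simp: card_gt_0_iff)
  ultimately show ?thesis by simp
qed

text \<open>A later visit to the same site has a larger visit number. Distinct steps therefore use
  distinct holding times, which are independent given the environment.\<close>

lemma inj_on_trap_index: "inj_on (trap_index ys) {..<length ys}"
proof (rule linorder_inj_onI')
  fix i j assume ij: "i \<in> {..<length ys}" "j \<in> {..<length ys}" "i < j"
  show "trap_index ys i \<noteq> trap_index ys j"
  proof
    assume eq: "trap_index ys i = trap_index ys j"
    let ?V = "\<lambda>k. {l. l \<le> k \<and> pos ys l = pos ys k}"
    have "card (?V i) < card (?V j)"
    proof (rule psubset_card_mono)
      have "j \<in> ?V j" "j \<notin> ?V i" using ij by auto
      moreover have "?V i \<subseteq> ?V j" using ij eq by (auto simp: trap_index_def)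
      ultimately show "?V i \<subset> ?V j" by blast
    qed auto
    also have "card (?V j) = visits_to_end (take j ys)"
      by (rule visits_to_end_take[symmetric]) (use ij in simp)
    also have "\<dots> = visits_to_end (take i ys)" using eq by (simp add: trap_index_def)
    also have "\<dots> = card (?V i)"
      by (rule visits_to_end_take) (use ij in simp)
    finally show False by simp
  qed
qed

context rtrw_process begin

lemma q_ennreal:
  assumes p: "p \<in> space \<mu>" and \<theta>: "0 \<le> \<theta>"
  shows "(\<integral>\<^sup>+u. ennreal (exp (- \<theta> * u)) \<partial>p) = ennreal (q \<theta> p)"
  unfolding q_def by (rule nn_integral_eq_integral[OF integrable_exp[OF p \<theta>]]) simp

lemma \<pi>_in_\<mu>: "\<omega> \<in> space M \<Longrightarrow> \<pi> x \<omega> \<in> space \<mu>"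
  using measurable_space[OF \<pi>_measurable] sets_eq_imp_space_eq[OF sets_\<mu>] by simp

lemma \<pi>_measurable_\<mu>: "\<pi> x \<in> M \<rightarrow>\<^sub>M \<mu>"
  using \<pi>_measurable measurable_cong_sets[OF refl sets_\<mu>] by auto

lemma steps_event: "{\<omega> \<in> space M. steps n \<omega> = ys} \<in> events"
proof -
  have "steps n -` {ys} \<inter> space M \<in> events" by (rule measurable_sets[OF steps_measurable]) simp
  moreover have "{\<omega> \<in> space M. steps n \<omega> = ys} = steps n -` {ys} \<inter> space M" by auto
  ultimately show ?thesis by simp
qed

lemma nn_integral_steps_traps:
  fixes f :: "(int ^ 'd) \<times> nat \<Rightarrow> real \<Rightarrow> ennreal"
  assumes ys: "length ys = n" and J: "finite J" "J \<subseteq> UNIV \<times> {1..}"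
    and f: "\<And>j. j \<in> J \<Longrightarrow> f j \<in> borel_measurable pos_borel"
  shows "(\<integral>\<^sup>+\<omega>. indicator {\<omega> \<in> space M. steps n \<omega> = ys} \<omega> * (\<Prod>j\<in>J. f j (\<tau> (fst j) (snd j) \<omega>)) \<partial>M)
    = emeasure M {\<omega> \<in> space M. steps n \<omega> = ys} * (\<integral>\<^sup>+\<omega>. (\<Prod>j\<in>J. \<integral>\<^sup>+u. f j u \<partial>\<pi> (fst j) \<omega>) \<partial>M)"
proof -
  let ?A = "{\<omega> \<in> space M. steps n \<omega> = ys}"
  have meas_\<tau>: "(\<lambda>\<omega>. h (\<tau> (fst j) (snd j) \<omega>)) \<in> borel_measurable M"
    if "j \<in> J" "h \<in> borel_measurable pos_borel" for j and h :: "real \<Rightarrow> ennreal"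
    using that J by (intro measurable_compose[OF \<tau>_measurable]) auto
  have meas_\<pi>: "(\<lambda>\<omega>. \<integral>\<^sup>+u. h u \<partial>\<pi> x \<omega>) \<in> borel_measurable M"
    if "h \<in> borel_measurable pos_borel" for x and h :: "real \<Rightarrow> ennreal"
    by (rule measurable_compose[OF measurable_prob_algebraD[OF \<pi>_measurable] nn_integral_measurable_subprob_algebra[OF that]])
  \<comment> \<open>Indicators are replaced by general functions one coordinate of \<open>J\<close> at a time.\<close>
  have "(\<integral>\<^sup>+\<omega>. indicator ?A \<omega> * (\<Prod>j\<in>J. f j (\<tau> (fst j) (snd j) \<omega>)) \<partial>M)
    = emeasure M ?A * (\<integral>\<^sup>+\<omega>. (\<Prod>j\<in>J. \<integral>\<^sup>+u. f j u \<partial>\<pi> (fst j) \<omega>) \<partial>M)"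
    if "finite K" "K \<subseteq> J" "\<And>j. j \<in> J \<Longrightarrow> f j \<in> borel_measurable pos_borel"
      "\<And>j. j \<in> J - K \<Longrightarrow> \<exists>B\<in>sets pos_borel. f j = indicator B" for K f
    using that
  proof (induction K arbitrary: f rule: finite_induct)
    case empty
    then have "\<forall>j\<in>J. \<exists>B. B \<in> sets pos_borel \<and> f j = indicator B" by blast
    then have "\<exists>B. \<forall>j\<in>J. B j \<in> sets pos_borel \<and> f j = indicator (B j)" by (rule bchoice)
    then obtain B where B: "\<And>j. j \<in> J \<Longrightarrow> B j \<in> sets pos_borel" "\<And>j. j \<in> J \<Longrightarrow> f j = indicator (B j)" by blast
    let ?E = "{\<omega> \<in> space M. steps n \<omega> = ys \<and> (\<forall>j\<in>J. \<tau> (fst j) (snd j) \<omega> \<in> B j)}"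
    have E: "?E = ?A \<inter> (\<Inter>j\<in>J. {\<omega> \<in> space M. \<tau> (fst j) (snd j) \<omega> \<in> B j}) \<inter> space M" by auto
    have "{\<omega> \<in> space M. \<tau> (fst j) (snd j) \<omega> \<in> B j} \<in> events" if "j \<in> J" for j
    proof -
      have "\<tau> (fst j) (snd j) -` B j \<inter> space M \<in> events"
        using that J B by (intro measurable_sets[OF \<tau>_measurable]) auto
      then show ?thesis by (simp add: vimage_def Int_def conj_commute)
    qed
    then have "?E \<in> events"
      unfolding E using J(1) steps_event[of n ys]
      by (cases "J = {}") (auto intro!: sets.Int sets.finite_INT)
    have "(\<integral>\<^sup>+\<omega>. indicator ?A \<omega> * (\<Prod>j\<in>J. f j (\<tau> (fst j) (snd j) \<omega>)) \<partial>M) = (\<integral>\<^sup>+\<omega>. indicator ?E \<omega> \<partial>M)"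
    proof (intro nn_integral_cong)
      fix \<omega> assume \<omega>: "\<omega> \<in> space M"
      have "(\<Prod>j\<in>J. f j (\<tau> (fst j) (snd j) \<omega>)) = (\<Prod>j\<in>J. indicator (B j) (\<tau> (fst j) (snd j) \<omega>))"
        by (intro prod.cong refl) (simp add: B(2))
      also have "\<dots> = (if \<forall>j\<in>J. \<tau> (fst j) (snd j) \<omega> \<in> B j then 1 else 0 :: ennreal)"
        using J(1) by (auto simp: indicator_def)
      finally show "indicator ?A \<omega> * (\<Prod>j\<in>J. f j (\<tau> (fst j) (snd j) \<omega>)) = indicator ?E \<omega>"
        using \<omega> by (auto simp: indicator_def)
    qed
    also have "\<dots> = ennreal (prob ?E)" using \<open>?E \<in> events\<close> by (simp add: emeasure_eq_measure)
    also have "prob ?E = prob ?A * (\<integral>\<omega>. (\<Prod>(x, i)\<in>J. measure (\<pi> x \<omega>) (B (x, i))) \<partial>M)"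
      using prob_steps_traps[OF ys J B(1)] by (simp add: split_beta)
    also have "ennreal \<dots> = ennreal (prob ?A) * ennreal (\<integral>\<omega>. (\<Prod>(x, i)\<in>J. measure (\<pi> x \<omega>) (B (x, i))) \<partial>M)"
      by (rule ennreal_mult) (auto intro!: Bochner_Integration.integral_nonneg prod_nonneg)
    also have "ennreal (\<integral>\<omega>. (\<Prod>(x, i)\<in>J. measure (\<pi> x \<omega>) (B (x, i))) \<partial>M)
      = (\<integral>\<^sup>+\<omega>. ennreal (\<Prod>(x, i)\<in>J. measure (\<pi> x \<omega>) (B (x, i))) \<partial>M)"
    proof (rule nn_integral_eq_integral[symmetric])
      have le: "(\<Prod>(x, i)\<in>J. measure (\<pi> x \<omega>) (B (x, i))) \<le> 1" if "\<omega> \<in> space M" for \<omega>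
      proof (rule prod_le_1)
        fix j assume "j \<in> J"
        interpret p: prob_space "\<pi> (fst j) \<omega>" by (rule space_\<mu>D(1)[OF \<pi>_in_\<mu>[OF that]])
        show "0 \<le> (case j of (x, i) \<Rightarrow> measure (\<pi> x \<omega>) (B (x, i))) \<and> (case j of (x, i) \<Rightarrow> measure (\<pi> x \<omega>) (B (x, i))) \<le> 1"
          by (cases j) (use p.prob_le_1 in simp)
      qed
      have "(\<lambda>\<omega>. \<Prod>(x, i)\<in>J. measure (\<pi> x \<omega>) (B (x, i))) \<in> borel_measurable M"
      proof (intro borel_measurable_prod)
        fix j assume j: "j \<in> J"
        obtain x i where xi: "j = (x, i)" by (cases j)
        show "(\<lambda>\<omega>. case j of (x, i) \<Rightarrow> measure (\<pi> x \<omega>) (B (x, i))) \<in> borel_measurable M"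
          unfolding xi prod.case using B(1)[OF j] xi
          by (intro measurable_compose[OF \<pi>_measurable measurable_measure_prob_algebra]) simp
      qed
      then show "integrable M (\<lambda>\<omega>. \<Prod>(x, i)\<in>J. measure (\<pi> x \<omega>) (B (x, i)))"
      proof (rule integrable_const_bound[where B = 1, rotated])
        show "AE \<omega> in M. norm (\<Prod>(x, i)\<in>J. measure (\<pi> x \<omega>) (B (x, i))) \<le> 1"
        proof (rule AE_I2)
          fix \<omega> assume "\<omega> \<in> space M"
          moreover have "0 \<le> (\<Prod>(x, i)\<in>J. measure (\<pi> x \<omega>) (B (x, i)))" by (intro prod_nonneg) auto
          ultimately show "norm (\<Prod>(x, i)\<in>J. measure (\<pi> x \<omega>) (B (x, i))) \<le> 1" using le by simp
        qed
      qed
    qed (intro AE_I2 prod_nonneg, auto)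
    also have "\<dots> = (\<integral>\<^sup>+\<omega>. (\<Prod>j\<in>J. \<integral>\<^sup>+u. f j u \<partial>\<pi> (fst j) \<omega>) \<partial>M)"
    proof (intro nn_integral_cong)
      fix \<omega> assume \<omega>: "\<omega> \<in> space M"
      have "(\<integral>\<^sup>+u. f j u \<partial>\<pi> (fst j) \<omega>) = ennreal (case j of (x, i) \<Rightarrow> measure (\<pi> x \<omega>) (B (x, i)))" if "j \<in> J" for j
      proof -
        interpret p: prob_space "\<pi> (fst j) \<omega>" by (rule space_\<mu>D(1)[OF \<pi>_in_\<mu>[OF \<omega>]])
        have "B j \<in> sets (\<pi> (fst j) \<omega>)" using B(1)[OF that] space_\<mu>D(2)[OF \<pi>_in_\<mu>[OF \<omega>]] by simp
        then show ?thesis by (simp add: B(2)[OF that] p.emeasure_eq_measure split_beta)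
      qed
      then show "ennreal (\<Prod>(x, i)\<in>J. measure (\<pi> x \<omega>) (B (x, i))) = (\<Prod>j\<in>J. \<integral>\<^sup>+u. f j u \<partial>\<pi> (fst j) \<omega>)"
        by (subst prod_ennreal[symmetric]) auto
    qed
    finally show ?case by (simp add: emeasure_eq_measure)
  next
    case (insert k K)
    have k: "k \<in> J" using insert.prems by auto
    \<comment> \<open>All other factors serve as a density, while the holding time with index
      \<open>k\<close> has the kernel \<open>\<pi> (fst k)\<close>.\<close>
    let ?G = "\<lambda>\<omega>. indicator ?A \<omega> * (\<Prod>j\<in>J - {k}. f j (\<tau> (fst j) (snd j) \<omega>))"
    let ?H = "\<lambda>\<omega>. \<Prod>j\<in>J - {k}. \<integral>\<^sup>+u. f j u \<partial>\<pi> (fst j) \<omega>"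
    have split: "(\<Prod>j\<in>J. g j) = (\<Prod>j\<in>J - {k}. g j) * g k" for g :: "(int ^ 'd) \<times> nat \<Rightarrow> ennreal"
      using J(1) k by (simp add: prod.remove mult.commute)
    have "(\<integral>\<^sup>+\<omega>. ?G \<omega> * f k (\<tau> (fst k) (snd k) \<omega>) \<partial>M)
      = emeasure M ?A * (\<integral>\<^sup>+\<omega>. ?H \<omega> * (\<integral>\<^sup>+u. f k u \<partial>\<pi> (fst k) \<omega>) \<partial>M)"
    proof (rule nn_integral_kernel_extend)
      show "?G \<in> borel_measurable M"
        using steps_event[of n ys] insert.prems(2) by (intro borel_measurable_times_ennreal borel_measurable_prod_ennreal meas_\<tau>) auto
      show "?H \<in> borel_measurable M"
        using insert.prems(2) by (intro borel_measurable_prod_ennreal meas_\<pi>) auto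
      show "\<tau> (fst k) (snd k) \<in> M \<rightarrow>\<^sub>M pos_borel" using J k by (intro \<tau>_measurable) auto
      show "\<pi> (fst k) \<in> M \<rightarrow>\<^sub>M subprob_algebra pos_borel"
        by (rule measurable_prob_algebraD[OF \<pi>_measurable])
      show "space M \<noteq> {}" by (rule not_empty)
      show "f k \<in> borel_measurable pos_borel" using insert.prems(2) k by simp
      fix B assume B: "B \<in> sets pos_borel"
      have eq: "(\<Prod>j\<in>J. (f(k := indicator B)) j (x j)) = (\<Prod>j\<in>J - {k}. f j (x j)) * indicator B (x k)" for x
        unfolding split by simp
      have eq': "(\<Prod>j\<in>J. \<integral>\<^sup>+u. (f(k := indicator B)) j u \<partial>\<pi> (fst j) \<omega>) = ?H \<omega> * emeasure (\<pi> (fst k) \<omega>) B"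
        if "\<omega> \<in> space M" for \<omega>
        unfolding split using B space_\<mu>D(2)[OF \<pi>_in_\<mu>[OF that]] by simp
      have "(\<integral>\<^sup>+\<omega>. indicator ?A \<omega> * (\<Prod>j\<in>J. (f(k := indicator B)) j (\<tau> (fst j) (snd j) \<omega>)) \<partial>M)
        = emeasure M ?A * (\<integral>\<^sup>+\<omega>. (\<Prod>j\<in>J. \<integral>\<^sup>+u. (f(k := indicator B)) j u \<partial>\<pi> (fst j) \<omega>) \<partial>M)"
        using insert.prems B by (intro insert.IH) auto
      also have "(\<integral>\<^sup>+\<omega>. (\<Prod>j\<in>J. \<integral>\<^sup>+u. (f(k := indicator B)) j u \<partial>\<pi> (fst j) \<omega>) \<partial>M)
        = (\<integral>\<^sup>+\<omega>. ?H \<omega> * emeasure (\<pi> (fst k) \<omega>) B \<partial>M)"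
        by (intro nn_integral_cong eq')
      finally show "(\<integral>\<^sup>+\<omega>. ?G \<omega> * indicator B (\<tau> (fst k) (snd k) \<omega>) \<partial>M)
        = emeasure M ?A * (\<integral>\<^sup>+\<omega>. ?H \<omega> * emeasure (\<pi> (fst k) \<omega>) B \<partial>M)"
        by (simp only: eq mult.assoc)
    qed
    then show ?case by (simp only: split mult.assoc)
  qed
  from this[of J f] show ?thesis using J f by auto
qed

text \<open>The factors are grouped by site: within a site they share one trapping law, across sites
  the trapping laws are independent.\<close>

lemma nn_integral_environment:
  assumes ys: "length ys = n" and w: "\<And>k. 0 \<le> w k"
  shows "(\<integral>\<^sup>+\<omega>. (\<Prod>k<n. \<integral>\<^sup>+u. ennreal (exp (- w k * u)) \<partial>\<pi> (pos ys k) \<omega>) \<partial>M) = ennreal (env.W w ys)"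
proof -
  let ?q = "\<lambda>x p. \<Prod>k\<in>visits ys x. q (w k) p"
  have vis: "(\<Union>x\<in>sites ys. visits ys x) = {..<n}" using ys by (auto simp: sites_def visits_def)
  have q01: "0 \<le> ?q x p" "?q x p \<le> 1" if "p \<in> space \<mu>" for x p
    using w env.prod_q_bounds[OF that, of "visits ys x" w] by auto
  have q_meas: "?q x \<in> borel_measurable \<mu>" for x by measurable
  define X where "X x \<omega> = max 0 (?q x (\<pi> x \<omega>))" for x \<omega>
  have X: "X x \<omega> = ?q x (\<pi> x \<omega>)" if "\<omega> \<in> space M" for x \<omega>
    using q01[OF \<pi>_in_\<mu>[OF that], of x] by (simp add: X_def max_def)
  have "(\<integral>\<^sup>+\<omega>. (\<Prod>k<n. \<integral>\<^sup>+u. ennreal (exp (- w k * u)) \<partial>\<pi> (pos ys k) \<omega>) \<partial>M)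
    = (\<integral>\<^sup>+\<omega>. (\<Prod>x\<in>sites ys. ennreal (X x \<omega>)) \<partial>M)"
  proof (intro nn_integral_cong)
    fix \<omega> assume \<omega>: "\<omega> \<in> space M"
    have "(\<Prod>k<n. \<integral>\<^sup>+u. ennreal (exp (- w k * u)) \<partial>\<pi> (pos ys k) \<omega>) = (\<Prod>k<n. ennreal (q (w k) (\<pi> (pos ys k) \<omega>)))"
      by (intro prod.cong refl q_ennreal \<pi>_in_\<mu> \<omega> w)
    also have "\<dots> = (\<Prod>x\<in>sites ys. \<Prod>k\<in>visits ys x. ennreal (q (w k) (\<pi> (pos ys k) \<omega>)))"
      unfolding vis[symmetric] by (rule prod.UNION_disjoint) (auto simp: visits_def)
    also have "\<dots> = (\<Prod>x\<in>sites ys. \<Prod>k\<in>visits ys x. ennreal (q (w k) (\<pi> x \<omega>)))"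
      by (intro prod.cong refl) (simp add: visits_def)
    also have "\<dots> = (\<Prod>x\<in>sites ys. ennreal (X x \<omega>))"
      unfolding X[OF \<omega>] by (intro prod.cong refl prod_ennreal env.q_nonneg \<pi>_in_\<mu> \<omega>)
    finally show "(\<Prod>k<n. \<integral>\<^sup>+u. ennreal (exp (- w k * u)) \<partial>\<pi> (pos ys k) \<omega>) = (\<Prod>x\<in>sites ys. ennreal (X x \<omega>))" .
  qed
  also have "\<dots> = (\<Prod>x\<in>sites ys. \<integral>\<^sup>+\<omega>. ennreal (X x \<omega>) \<partial>M)"
  proof (rule indep_vars_nn_integral)
    have "indep_vars (\<lambda>_. borel) (\<lambda>x. (\<lambda>p. ennreal (max 0 (?q x p))) \<circ> \<pi> x) (sites ys)"
    proof (rule indep_vars_compose[OF indep_vars_subset[OF indep_\<pi>]])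
      have "(\<lambda>p. ennreal (max 0 (?q x p))) \<in> borel_measurable \<mu>" for x using q_meas by measurable
      then show "(\<lambda>p. ennreal (max 0 (?q x p))) \<in> prob_algebra pos_borel \<rightarrow>\<^sub>M borel" for x
        by (subst measurable_cong_sets[OF sets_\<mu>[symmetric] refl])
    qed simp
    then show "indep_vars (\<lambda>_. borel) (\<lambda>x \<omega>. ennreal (X x \<omega>)) (sites ys)"
      by (simp add: comp_def X_def)
  qed auto
  also have "\<dots> = (\<Prod>x\<in>sites ys. ennreal (env.Phi w (visits ys x)))"
  proof (intro prod.cong refl)
    fix x assume "x \<in> sites ys"
    have "(\<integral>\<^sup>+\<omega>. ennreal (X x \<omega>) \<partial>M) = (\<integral>\<^sup>+\<omega>. ennreal (?q x (\<pi> x \<omega>)) \<partial>M)"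
      by (intro nn_integral_cong) (simp add: X)
    also have "\<dots> = (\<integral>\<^sup>+p. ennreal (?q x p) \<partial>distr M \<mu> (\<pi> x))"
      using q_meas by (subst nn_integral_distr[OF \<pi>_measurable_\<mu>]) auto
    also have "distr M \<mu> (\<pi> x) = distr M (prob_algebra pos_borel) (\<pi> x)"
      by (rule distr_cong) (auto simp: sets_\<mu>)
    also have "\<dots> = \<mu>" using distr_\<pi> by simp
    also have "(\<integral>\<^sup>+p. ennreal (?q x p) \<partial>\<mu>) = ennreal (env.Phi w (visits ys x))"
      unfolding env.Phi_def using w q01 by (intro nn_integral_eq_integral env.integrable_prod_q) auto
    finally show "(\<integral>\<^sup>+\<omega>. ennreal (X x \<omega>) \<partial>M) = ennreal (env.Phi w (visits ys x))" .
  qed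
  also have "\<dots> = ennreal (env.W w ys)"
    unfolding env.W_def using w by (intro prod_ennreal env.Phi_bounds)
  finally show ?thesis .
qed

section \<open>The annealed Laplace transform of the clock\<close>

abbreviation weighted_clock :: "(nat \<Rightarrow> real) \<Rightarrow> nat \<Rightarrow> 'w \<Rightarrow> real" where
  "weighted_clock w n \<omega> \<equiv> \<Sum>k<n. w k * \<tau> (walk \<xi> k \<omega>) (local_time \<xi> (walk \<xi> k \<omega>) k \<omega>) \<omega>"

lemma weighted_clock_eq:
  "weighted_clock w n \<omega> = (\<Sum>k<n. w k * \<tau> (fst (trap_index (steps n \<omega>) k)) (snd (trap_index (steps n \<omega>) k)) \<omega>)"
proof (intro sum.cong refl)
  fix k assume "k \<in> {..<n}"
  then have k: "k \<le> n" by simp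
  show "w k * \<tau> (walk \<xi> k \<omega>) (local_time \<xi> (walk \<xi> k \<omega>) k \<omega>) \<omega>
    = w k * \<tau> (fst (trap_index (steps n \<omega>) k)) (snd (trap_index (steps n \<omega>) k)) \<omega>"
    unfolding trap_index_def steps_def fst_conv snd_conv local_time_eq_visits[OF k]
    by (simp only: walk_eq_pos[OF k])
qed

lemma holding_time_measurable:
  assumes "length ys = n" "k < n"
  shows "\<tau> (fst (trap_index ys k)) (snd (trap_index ys k)) \<in> M \<rightarrow>\<^sub>M pos_borel"
  using visits_to_end_pos[of k ys] assms by (intro \<tau>_measurable) (auto simp: trap_index_def)

lemma weighted_clock_measurable: "weighted_clock w n \<in> borel_measurable M"
proof -
  \<comment> \<open>Lists of length other than \<open>n\<close>, which \<open>steps n\<close> never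
    produces, get the default \<open>0\<close>, as \<open>holding_time_measurable\<close> speaks of
    length \<open>n\<close> only.\<close>
  define F where "F ys \<omega> = (if length ys = n then \<Sum>k<n. w k * \<tau> (fst (trap_index ys k)) (snd (trap_index ys k)) \<omega> else 0)"
    for ys \<omega>
  have "F ys \<in> borel_measurable M" for ys
  proof (cases "length ys = n")
    case True
    then show ?thesis
      unfolding F_def[abs_def]
      by (simp, intro borel_measurable_sum borel_measurable_times borel_measurable_const
          measurable_pos_borelD holding_time_measurable) auto
  qed (simp add: F_def[abs_def])
  then have "(\<lambda>\<omega>. F (steps n \<omega>) \<omega>) \<in> borel_measurable M"
    by (rule measurable_compose_countable[OF _ steps_measurable])
  moreover have "F (steps n \<omega>) \<omega> = weighted_clock w n \<omega>" for \<omega>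
    unfolding weighted_clock_eq by (simp add: F_def steps_def)
  ultimately show ?thesis by simp
qed

lemma holding_time_pos:
  assumes "\<omega> \<in> space M"
  shows "0 < \<tau> (walk \<xi> k \<omega>) (local_time \<xi> (walk \<xi> k \<omega>) k \<omega>) \<omega>"
proof -
  have "0 < local_time \<xi> (walk \<xi> k \<omega>) k \<omega>"
    by (auto simp: local_time_def card_gt_0_iff)
  then have "\<tau> (walk \<xi> k \<omega>) (local_time \<xi> (walk \<xi> k \<omega>) k \<omega>) \<in> M \<rightarrow>\<^sub>M pos_borel"
    by (intro \<tau>_measurable) simp
  from measurable_space[OF this assms] show ?thesis by (simp add: space_pos_borel)
qed

text \<open>The expectation is decomposed over the countably many lists of steps. On each of them
  the clock is a sum over nonrandom indices, and averaging over holding times and environment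
  produces \<open>W\<close>.\<close>

lemma Laplace_weighted_clock:
  assumes w: "\<And>k. 0 \<le> w k"
  shows "(\<integral>\<omega>. exp (- weighted_clock w n \<omega>) \<partial>M) = env.Z w n"
proof -
  let ?c = "weighted_clock w n"
  have c: "0 \<le> ?c \<omega>" if "\<omega> \<in> space M" for \<omega>
    using holding_time_pos[OF that] w by (intro sum_nonneg mult_nonneg_nonneg) (auto intro: less_imp_le)
  let ?A = "\<lambda>ys. {\<omega> \<in> space M. steps n \<omega> = ys}"
  let ?F = "\<lambda>ys \<omega>. \<Prod>k<n. ennreal (exp (- w k * \<tau> (fst (trap_index ys k)) (snd (trap_index ys k)) \<omega>))"
  have F: "indicator (?A ys) \<omega> * ennreal (exp (- ?c \<omega>)) = indicator (?A ys) \<omega> * ?F ys \<omega>" for ys \<omega>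
  proof (cases "\<omega> \<in> ?A ys")
    case True
    then have "ennreal (exp (- ?c \<omega>)) = ?F ys \<omega>"
      unfolding weighted_clock_eq by (simp add: sum_negf[symmetric] exp_sum prod_ennreal)
    then show ?thesis by simp
  qed simp
  have each: "(\<integral>\<^sup>+\<omega>. indicator (?A ys) \<omega> * ennreal (exp (- ?c \<omega>)) \<partial>M)
    = ennreal (pmf (replicate_pmf n \<nu>) ys) * ennreal (env.W w ys)" for ys
  proof (cases "length ys = n")
    case True
    let ?t = "trap_index ys"
    have inj: "inj_on ?t {..<n}" using inj_on_trap_index[of ys] True by simp
    \<comment> \<open>Weights belong to steps, but holding times are indexed by site and visit
      number; injectivity of \<open>trap_index ys\<close> recovers the step.\<close>
    define f where "f j u = ennreal (exp (- w (the_inv_into {..<n} ?t j) * u))" for j u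
    have f_t: "f (?t k) = (\<lambda>u. ennreal (exp (- w k * u)))" if "k < n" for k
      using that by (intro ext) (simp add: f_def the_inv_into_f_f[OF inj])
    have "(\<integral>\<^sup>+\<omega>. indicator (?A ys) \<omega> * ennreal (exp (- ?c \<omega>)) \<partial>M)
      = (\<integral>\<^sup>+\<omega>. indicator (?A ys) \<omega> * (\<Prod>j\<in>?t ` {..<n}. f j (\<tau> (fst j) (snd j) \<omega>)) \<partial>M)"
      unfolding F by (simp add: prod.reindex[OF inj] f_t)
    also have "\<dots> = emeasure M (?A ys) * (\<integral>\<^sup>+\<omega>. (\<Prod>j\<in>?t ` {..<n}. \<integral>\<^sup>+u. f j u \<partial>\<pi> (fst j) \<omega>) \<partial>M)"
    proof (rule nn_integral_steps_traps[OF True])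
      show "?t ` {..<n} \<subseteq> UNIV \<times> {1..}"
        using visits_to_end_pos[of _ ys] True by (auto simp: trap_index_def)
      show "f j \<in> borel_measurable pos_borel" if "j \<in> ?t ` {..<n}" for j
        unfolding f_def by (rule borel_measurable_pos_borel) measurable
    qed simp
    also have "(\<integral>\<^sup>+\<omega>. (\<Prod>j\<in>?t ` {..<n}. \<integral>\<^sup>+u. f j u \<partial>\<pi> (fst j) \<omega>) \<partial>M)
      = (\<integral>\<^sup>+\<omega>. (\<Prod>k<n. \<integral>\<^sup>+u. ennreal (exp (- w k * u)) \<partial>\<pi> (pos ys k) \<omega>) \<partial>M)"
    proof -
      have "fst (?t k) = pos ys k" for k by (simp add: trap_index_def)
      then show ?thesis by (simp add: prod.reindex[OF inj] f_t)
    qed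
    also have "\<dots> = ennreal (env.W w ys)" by (rule nn_integral_environment[OF True w])
    finally show ?thesis by (simp add: emeasure_eq_measure prob_steps[OF True])
  next
    case False
    then have "?A ys = {}" "pmf (replicate_pmf n \<nu>) ys = 0"
      by (auto simp: steps_def pmf_eq_0_set_pmf set_replicate_pmf)
    then show ?thesis by simp
  qed
  have c_meas: "?c \<in> borel_measurable M" by (rule weighted_clock_measurable)
  have "(\<integral>\<^sup>+\<omega>. ennreal (exp (- ?c \<omega>)) \<partial>M)
    = (\<integral>\<^sup>+\<omega>. (\<integral>\<^sup>+ys. indicator (?A ys) \<omega> * ennreal (exp (- ?c \<omega>)) \<partial>count_space UNIV) \<partial>M)"
  proof (intro nn_integral_cong)
    fix \<omega> assume "\<omega> \<in> space M"
    then have "(\<integral>\<^sup>+ys. indicator (?A ys) \<omega> * ennreal (exp (- ?c \<omega>)) \<partial>count_space UNIV)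
      = (\<integral>\<^sup>+ys. ennreal (exp (- ?c \<omega>)) * indicator {steps n \<omega>} ys \<partial>count_space UNIV)"
      by (intro nn_integral_cong) (auto simp: indicator_def)
    then show "ennreal (exp (- ?c \<omega>)) = (\<integral>\<^sup>+ys. indicator (?A ys) \<omega> * ennreal (exp (- ?c \<omega>)) \<partial>count_space UNIV)"
      by simp
  qed
  also have "\<dots> = (\<integral>\<^sup>+ys. (\<integral>\<^sup>+\<omega>. indicator (?A ys) \<omega> * ennreal (exp (- ?c \<omega>)) \<partial>M) \<partial>count_space UNIV)"
    using steps_event c_meas
    by (intro nn_integral_count_space_nn_integral borel_measurable_times_ennreal borel_measurable_indicator) auto
  also have "\<dots> = (\<integral>\<^sup>+ys. ennreal (env.W w ys) \<partial>replicate_pmf n \<nu>)"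
    unfolding each nn_integral_measure_pmf ..
  also have "\<dots> = ennreal (env.Z w n)"
    unfolding env.Z_def using env.W_bounds[of _ w] w
    by (intro nn_integral_eq_integral integrable_steps[where B = 1]) auto
  finally have nn: "(\<integral>\<^sup>+\<omega>. ennreal (exp (- ?c \<omega>)) \<partial>M) = ennreal (env.Z w n)" .
  have "(\<integral>\<omega>. exp (- ?c \<omega>) \<partial>M) = enn2real (\<integral>\<^sup>+\<omega>. ennreal (exp (- ?c \<omega>)) \<partial>M)"
    using c_meas by (intro integral_eq_nn_integral) auto
  then show ?thesis using env.Z_bounds[of w n] w by (simp add: nn)
qed

lemma r_eq_no_return: "env.r n = no_return_prob M \<xi> n"
proof -
  have "distr M (count_space UNIV) (steps n) = measure_pmf (replicate_pmf n \<nu>)"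
  proof (rule measure_eqI_countable[of _ UNIV])
    fix ys :: "(int ^ 'd) list"
    have "emeasure (distr M (count_space UNIV) (steps n)) {ys} = ennreal (prob {\<omega> \<in> space M. steps n \<omega> = ys})"
      by (simp add: emeasure_distr[OF steps_measurable] emeasure_eq_measure vimage_def Int_def conj_commute)
    also have "prob {\<omega> \<in> space M. steps n \<omega> = ys} = pmf (replicate_pmf n \<nu>) ys"
    proof (cases "length ys = n")
      case False
      then have "{\<omega> \<in> space M. steps n \<omega> = ys} = {}" "pmf (replicate_pmf n \<nu>) ys = 0"
        by (auto simp: steps_def pmf_eq_0_set_pmf set_replicate_pmf)
      then show ?thesis by (simp only: measure_empty)
    qed (rule prob_steps)
    finally show "emeasure (distr M (count_space UNIV) (steps n)) {ys} = emeasure (measure_pmf (replicate_pmf n \<nu>)) {ys}"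
      by (simp add: emeasure_pmf_single)
  qed auto
  then have "measure (measure_pmf (replicate_pmf n \<nu>)) {ys. no_return n ys} = measure (distr M (count_space UNIV) (steps n)) {ys. no_return n ys}"
    by simp
  also have "\<dots> = prob {\<omega> \<in> space M. no_return n (steps n \<omega>)}"
    by (simp add: measure_distr[OF steps_measurable] vimage_def Int_def conj_commute)
  also have "\<dots> = no_return_prob M \<xi> n"
    unfolding no_return_prob_def no_return_def steps_def
    by (intro arg_cong[where f = prob]) (auto simp: walk_eq_pos[where n = n] pos_def)
  finally have "measure (measure_pmf (replicate_pmf n \<nu>)) {ys. no_return n ys} = no_return_prob M \<xi> n" .
  moreover have "env.r n = measure (measure_pmf (replicate_pmf n \<nu>)) {ys. no_return n ys}"
  proof -
    have "env.r n = expect_steps \<nu> n (indicator {ys. no_return n ys})"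
      unfolding env.r_def by (intro Bochner_Integration.integral_cong) (auto simp: indicator_def)
    then show ?thesis by simp
  qed
  ultimately show ?thesis by simp
qed

end

section \<open>Laplace transforms determine distributions\<close>

text \<open>The Hausdorff moment problem: approximation by polynomials on \<open>{0..1}\<close>
  equates the integrals of bounded continuous functions, in particular of cosines and sines, hence
  the characteristic functions.\<close>

lemma moments_unique:
  assumes "real_distribution M1" "real_distribution M2"
    and supp: "AE x in M1. x \<in> {0..1}" "AE x in M2. x \<in> {0..1}"
    and eq: "\<And>k. (\<integral>x. x ^ k \<partial>M1) = (\<integral>x. x ^ k \<partial>M2)"
  shows "M1 = M2"
proof -
  interpret M1: real_distribution M1 by fact
  interpret M2: real_distribution M2 by fact
  have cont: "(\<integral>x. f x \<partial>M1) = (\<integral>x. f x \<partial>M2)"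
    if f: "continuous_on UNIV f" and bd: "\<And>x. \<bar>f x\<bar> \<le> 1" for f :: "real \<Rightarrow> real"
  proof -
    have f_meas [measurable]: "f \<in> borel_measurable borel" by (rule borel_measurable_continuous_onI[OF f])
    have int_f: "integrable M1 f" "integrable M2 f"
      using bd by (auto intro!: M1.integrable_const_bound[where B = 1] M2.integrable_const_bound[where B = 1])
    have int_pow: "integrable M1 (\<lambda>x. x ^ k)" "integrable M2 (\<lambda>x. x ^ k)" for k
    proof -
      have "AE x in M1. norm (x ^ k) \<le> 1" using supp(1) by eventually_elim (auto intro: power_le_one)
      then show "integrable M1 (\<lambda>x. x ^ k)" by (rule M1.integrable_const_bound) simp
      have "AE x in M2. norm (x ^ k) \<le> 1" using supp(2) by eventually_elim (auto intro: power_le_one)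
      then show "integrable M2 (\<lambda>x. x ^ k)" by (rule M2.integrable_const_bound) simp
    qed
    have close: "\<bar>(\<integral>x. f x \<partial>M1) - (\<integral>x. f x \<partial>M2)\<bar> \<le> 2 * e" if e: "0 < e" for e
    proof -
      obtain g where g: "real_polynomial_function g" "\<And>x. x \<in> {0..1} \<Longrightarrow> \<bar>f x - g x\<bar> < e"
        using Stone_Weierstrass_real_polynomial_function[of "{0..1}" f e] continuous_on_subset[OF f] e by auto
      obtain a n where g_eq: "g = (\<lambda>x. \<Sum>i\<le>n. a i * x ^ i)"
        using g(1) real_polynomial_function_iff_sum by blast
      have int_g: "integrable M1 g" "integrable M2 g"
        using int_pow by (auto simp: g_eq)
      have "(\<integral>x. g x \<partial>M1) = (\<integral>x. g x \<partial>M2)"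
        using int_pow by (simp add: g_eq eq)
      moreover have "\<bar>\<integral>x. f x - g x \<partial>M1\<bar> \<le> e"
      proof -
        have "\<bar>\<integral>x. f x - g x \<partial>M1\<bar> \<le> (\<integral>x. \<bar>f x - g x\<bar> \<partial>M1)" by (rule integral_abs_bound)
        also have "\<dots> \<le> (\<integral>x. e \<partial>M1)"
        proof (rule integral_mono_AE)
          show "AE x in M1. \<bar>f x - g x\<bar> \<le> e"
            using supp(1) by eventually_elim (use g(2) in \<open>auto intro: less_imp_le\<close>)
        qed (use int_f int_g in auto)
        finally show ?thesis by (simp add: M1.prob_space[unfolded M1.space_eq_univ])
      qed
      moreover have "\<bar>\<integral>x. f x - g x \<partial>M2\<bar> \<le> e"
      proof -
        have "\<bar>\<integral>x. f x - g x \<partial>M2\<bar> \<le> (\<integral>x. \<bar>f x - g x\<bar> \<partial>M2)" by (rule integral_abs_bound)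
        also have "\<dots> \<le> (\<integral>x. e \<partial>M2)"
        proof (rule integral_mono_AE)
          show "AE x in M2. \<bar>f x - g x\<bar> \<le> e"
            using supp(2) by eventually_elim (use g(2) in \<open>auto intro: less_imp_le\<close>)
        qed (use int_f int_g in auto)
        finally show ?thesis by (simp add: M2.prob_space[unfolded M2.space_eq_univ])
      qed
      ultimately show ?thesis using int_f int_g by simp
    qed
    have "\<bar>(\<integral>x. f x \<partial>M1) - (\<integral>x. f x \<partial>M2)\<bar> \<le> 0"
    proof (rule field_le_epsilon)
      fix e :: real assume "0 < e"
      then show "\<bar>(\<integral>x. f x \<partial>M1) - (\<integral>x. f x \<partial>M2)\<bar> \<le> 0 + e" using close[of "e / 2"] by simp
    qed
    then show ?thesis by simp
  qed
  have char: "char M t = complex_of_real (\<integral>x. cos (t * x) \<partial>M) + \<i> * complex_of_real (\<integral>x. sin (t * x) \<partial>M)"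
    if "real_distribution M" for M t
  proof -
    interpret M: real_distribution M by fact
    have "integrable M (\<lambda>x. cos (t * x))" "integrable M (\<lambda>x. sin (t * x))"
      by (auto intro!: M.integrable_const_bound[where B = 1])
    note int = this
    have "iexp x = complex_of_real (cos x) + \<i> * complex_of_real (sin x)" for x
      unfolding cis_conv_exp[symmetric] by (simp add: complex_eq_iff)
    then have "char M t = (\<integral>x. complex_of_real (cos (t * x)) + \<i> * complex_of_real (sin (t * x)) \<partial>M)"
      unfolding char_def by (simp only:)
    also have "\<dots> = (\<integral>x. complex_of_real (cos (t * x)) \<partial>M) + (\<integral>x. \<i> * complex_of_real (sin (t * x)) \<partial>M)"
      using int by (intro Bochner_Integration.integral_add integrable_mult_right integrable_of_real)
    also have "(\<integral>x. \<i> * complex_of_real (sin (t * x)) \<partial>M) = \<i> * (\<integral>x. complex_of_real (sin (t * x)) \<partial>M)"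
      by (rule integral_mult_right_zero)
    finally show ?thesis by (simp only: integral_complex_of_real)
  qed
  show ?thesis
  proof (rule Levy_uniqueness[OF assms(1,2)], rule ext)
    fix t
    have "(\<integral>x. cos (t * x) \<partial>M1) = (\<integral>x. cos (t * x) \<partial>M2)" "(\<integral>x. sin (t * x) \<partial>M1) = (\<integral>x. sin (t * x) \<partial>M2)"
      by (rule cont; auto intro!: continuous_intros)+
    then show "char M1 t = char M2 t" by (simp add: char assms(1,2))
  qed
qed

text \<open>Reweighting \<open>P\<close> by \<open>Y\<close> gives a probability measure under which
  \<open>X\<close> has the Laplace transform of \<open>X'\<close>; at integer arguments this equates
  the moments of \<open>exp (- X)\<close> and \<open>exp (- X')\<close>. The weight \<open>Y\<close>
  prepares \<open>indep_vars_Laplace\<close>, where it is the product over the other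
  coordinates.\<close>

lemma Laplace_determines:
  fixes X :: "'a \<Rightarrow> real" and X' :: "'b \<Rightarrow> real"
  assumes "prob_space P" "prob_space P'"
    and [measurable]: "X \<in> borel_measurable P" "X' \<in> borel_measurable P'" "Y \<in> borel_measurable P"
    and X: "AE \<omega> in P. 0 \<le> X \<omega>" and X': "AE \<omega> in P'. 0 \<le> X' \<omega>"
    and Y: "AE \<omega> in P. 0 \<le> Y \<omega> \<and> Y \<omega> \<le> (1::real)"
    and eq: "\<And>\<theta>. 0 \<le> \<theta> \<Longrightarrow> (\<integral>\<omega>. Y \<omega> * exp (- \<theta> * X \<omega>) \<partial>P) = (\<integral>\<omega>. Y \<omega> \<partial>P) * (\<integral>\<omega>. exp (- \<theta> * X' \<omega>) \<partial>P')"
    and B [measurable]: "B \<in> sets borel"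
  shows "(\<integral>\<omega>. Y \<omega> * indicator B (X \<omega>) \<partial>P) = (\<integral>\<omega>. Y \<omega> \<partial>P) * measure P' (X' -` B \<inter> space P')"
proof -
  interpret P: prob_space P by fact
  interpret P': prob_space P' by fact
  let ?c = "\<integral>\<omega>. Y \<omega> \<partial>P"
  have Y0: "AE \<omega> in P. 0 \<le> Y \<omega>" using Y by eventually_elim simp
  have int_Y: "integrable P Y"
  proof (rule P.integrable_const_bound[where B = 1])
    show "AE \<omega> in P. norm (Y \<omega>) \<le> 1" using Y by eventually_elim simp
  qed measurable
  show ?thesis
  proof (cases "?c = 0")
    \<comment> \<open>A weight without mass cannot be normalized, but then both sides
      vanish.\<close>
    case True
    then have "AE \<omega> in P. Y \<omega> = 0" using integral_nonneg_eq_0_iff_AE[OF int_Y Y0] by simp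
    then have "(\<integral>\<omega>. Y \<omega> * indicator B (X \<omega>) \<partial>P) = (\<integral>\<omega>. 0 \<partial>P)"
      by (intro integral_cong_AE) (auto elim!: eventually_mono)
    then show ?thesis using True by simp
  next
    case False
    have "0 \<le> ?c" using Y0 by (rule integral_nonneg_AE)
    with False have c: "0 < ?c" by simp
    define Q where "Q = density P (\<lambda>\<omega>. ennreal (Y \<omega> / ?c))"
    have Yc: "AE \<omega> in P. 0 \<le> Y \<omega> / ?c" using Y0 by eventually_elim (use c in simp)
    have "emeasure Q (space Q) = (\<integral>\<^sup>+\<omega>. ennreal (Y \<omega> / ?c) \<partial>P)"
      unfolding Q_def by (subst emeasure_density) (auto intro!: nn_integral_cong)
    also have "\<dots> = ennreal (\<integral>\<omega>. Y \<omega> / ?c \<partial>P)"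
      using int_Y Yc by (intro nn_integral_eq_integral) auto
    also have "\<dots> = 1" using c by simp
    finally have "prob_space Q" by (rule prob_spaceI)
    then interpret Q: prob_space Q .
    have sets_Q [measurable_cong]: "sets Q = sets P" by (simp add: Q_def)
    have Q_int: "(\<integral>\<omega>. f \<omega> \<partial>Q) = (\<integral>\<omega>. Y \<omega> * f \<omega> \<partial>P) / ?c" if [measurable]: "f \<in> borel_measurable P" for f :: "_ \<Rightarrow> real"
    proof -
      have "(\<integral>\<omega>. f \<omega> \<partial>Q) = (\<integral>\<omega>. Y \<omega> / ?c * f \<omega> \<partial>P)"
        unfolding Q_def using Yc by (subst integral_density) auto
      then show ?thesis by (simp add: field_simps)
    qed
    have AE_Q: "AE \<omega> in Q. 0 \<le> X \<omega>"
      unfolding Q_def using X by (subst AE_density) (auto elim: eventually_mono)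
    let ?M1 = "distr Q borel (\<lambda>\<omega>. exp (- X \<omega>))" and ?M2 = "distr P' borel (\<lambda>\<omega>. exp (- X' \<omega>))"
    have "?M1 = ?M2"
    proof (rule moments_unique)
      show "real_distribution ?M1" by (rule Q.real_distribution_distr) measurable
      show "real_distribution ?M2" by (rule P'.real_distribution_distr) measurable
      show "AE x in ?M1. x \<in> {0..1}" using AE_Q by (subst AE_distr_iff) (auto elim: eventually_mono)
      show "AE x in ?M2. x \<in> {0..1}" using X' by (subst AE_distr_iff) (auto elim: eventually_mono)
      fix k
      have pow: "exp (- x) ^ k = exp (- real k * x)" for x :: real
        by (simp add: exp_of_nat_mult[symmetric])
      have "(\<integral>x. x ^ k \<partial>?M1) = (\<integral>\<omega>. exp (- real k * X \<omega>) \<partial>Q)"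
        by (subst integral_distr) (auto simp: pow)
      also have "\<dots> = (\<integral>\<omega>. exp (- real k * X' \<omega>) \<partial>P')"
        using c eq[of "real k"] by (subst Q_int) auto
      also have "\<dots> = (\<integral>x. x ^ k \<partial>?M2)"
        by (subst integral_distr) (auto simp: pow)
      finally show "(\<integral>x. x ^ k \<partial>?M1) = (\<integral>x. x ^ k \<partial>?M2)" .
    qed
    \<comment> \<open>The event \<open>X \<in> B\<close>, expressed through
      \<open>exp (- X)\<close>.\<close>
    let ?C = "(\<lambda>u. - ln u) -` B \<inter> space borel"
    have C: "?C \<in> sets borel" by measurable
    have "measure ?M1 ?C = measure Q (X -` B \<inter> space Q)"
      using C by (subst measure_distr) (auto intro!: arg_cong[where f = "measure Q"])
    moreover have "measure ?M2 ?C = measure P' (X' -` B \<inter> space P')"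
      using C by (subst measure_distr) (auto intro!: arg_cong[where f = "measure P'"])
    moreover have "measure Q (X -` B \<inter> space Q) = (\<integral>\<omega>. indicator B (X \<omega>) \<partial>Q)"
    proof -
      have "(\<integral>\<omega>. indicator B (X \<omega>) \<partial>Q) = (\<integral>\<omega>. indicator (X -` B \<inter> space Q) \<omega> \<partial>Q :: real)"
        by (intro Bochner_Integration.integral_cong) (auto simp: indicator_def)
      then show ?thesis by simp
    qed
    moreover have "(\<integral>\<omega>. indicator B (X \<omega>) \<partial>Q) = (\<integral>\<omega>. Y \<omega> * indicator B (X \<omega>) \<partial>P) / ?c"
      by (rule Q_int) measurable
    ultimately have "(\<integral>\<omega>. Y \<omega> * indicator B (X \<omega>) \<partial>P) / ?c = measure P' (X' -` B \<inter> space P')"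
      using \<open>?M1 = ?M2\<close> by simp
    then show ?thesis using c by (simp add: field_simps)
  qed
qed

lemma Laplace_unique:
  fixes X :: "'a \<Rightarrow> real" and X' :: "'b \<Rightarrow> real"
  assumes "prob_space P" "prob_space P'"
    and [measurable]: "X \<in> borel_measurable P" "X' \<in> borel_measurable P'"
    and X: "AE \<omega> in P. 0 \<le> X \<omega>" and X': "AE \<omega> in P'. 0 \<le> X' \<omega>"
    and eq: "\<And>\<theta>. 0 \<le> \<theta> \<Longrightarrow> (\<integral>\<omega>. exp (- \<theta> * X \<omega>) \<partial>P) = (\<integral>\<omega>. exp (- \<theta> * X' \<omega>) \<partial>P')"
  shows "distr P borel X = distr P' borel X'"
proof (rule measure_eqI)
  interpret P: prob_space P by fact
  interpret P': prob_space P' by fact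
  fix B assume "B \<in> sets (distr P borel X)"
  then have B [measurable]: "B \<in> sets borel" by simp
  have "measure P (X -` B \<inter> space P) = (\<integral>\<omega>. 1 * indicator B (X \<omega>) \<partial>P)"
  proof -
    have "(\<integral>\<omega>. 1 * indicator B (X \<omega>) \<partial>P) = (\<integral>\<omega>. indicator (X -` B \<inter> space P) \<omega> \<partial>P :: real)"
      by (intro Bochner_Integration.integral_cong) (auto simp: indicator_def)
    then show ?thesis by simp
  qed
  also have "\<dots> = (\<integral>\<omega>. 1 \<partial>P) * measure P' (X' -` B \<inter> space P')"
    by (rule Laplace_determines[OF assms(1,2), where Y = "\<lambda>_. 1" and X = X and X' = X' and B = B])
      (use assms in \<open>auto simp: P.prob_space\<close>)
  finally show "emeasure (distr P borel X) B = emeasure (distr P' borel X') B"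
    by (simp add: emeasure_distr P.emeasure_eq_measure P'.emeasure_eq_measure P.prob_space)
qed simp

lemma (in prob_space) indep_vars_Laplace:
  fixes X :: "nat \<Rightarrow> 'a \<Rightarrow> real"
  assumes X_meas: "\<And>i. i < n \<Longrightarrow> X i \<in> borel_measurable M"
    and nonneg: "\<And>i. i < n \<Longrightarrow> AE \<omega> in M. 0 \<le> X i \<omega>"
    and eq: "\<And>\<theta>. (\<And>i. 0 \<le> \<theta> i) \<Longrightarrow>
      (\<integral>\<omega>. (\<Prod>i<n. exp (- \<theta> i * X i \<omega>)) \<partial>M) = (\<Prod>i<n. \<integral>\<omega>. exp (- \<theta> i * X i \<omega>) \<partial>M)"
  shows "indep_vars (\<lambda>_. borel) X {..<n}"
proof -
  define L where "L f \<longleftrightarrow> (\<exists>\<theta>\<ge>0. f = (\<lambda>x::real. exp (- \<theta> * x)))" for f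
  define J where "J f \<longleftrightarrow> (\<exists>B\<in>sets borel. f = (indicator B :: real \<Rightarrow> real))" for f
  have LJ_meas: "f \<in> borel_measurable borel" if "L f \<or> J f" for f
    using that by (auto simp: L_def J_def)
  have LJ_bounds: "0 \<le> f x" "0 \<le> x \<Longrightarrow> f x \<le> 1" if "L f \<or> J f" for f x
    using that by (auto simp: L_def J_def indicator_def)
  \<comment> \<open>Laplace kernels are replaced by indicators one coordinate at a time.\<close>
  have key: "(\<integral>\<omega>. (\<Prod>i<n. f i (X i \<omega>)) \<partial>M) = (\<Prod>i<n. \<integral>\<omega>. f i (X i \<omega>) \<partial>M)"
    if "finite K" "K \<subseteq> {..<n}" "\<And>i. i \<in> K \<Longrightarrow> J (f i)" "\<And>i. i \<in> {..<n} - K \<Longrightarrow> L (f i)" for K f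
    using that
  proof (induction K arbitrary: f rule: finite_induct)
    case empty
    then have "\<forall>i\<in>{..<n}. \<exists>\<theta>\<ge>0. f i = (\<lambda>x. exp (- \<theta> * x))" by (auto simp: L_def)
    then obtain \<theta> where \<theta>: "\<And>i. i < n \<Longrightarrow> 0 \<le> \<theta> i \<and> f i = (\<lambda>x. exp (- \<theta> i * x))"
      by (metis lessThan_iff)
    define \<theta>' where "\<theta>' i = (if i < n then \<theta> i else 0)" for i
    have f: "f i = (\<lambda>x. exp (- \<theta>' i * x))" if "i < n" for i using \<theta>[OF that] that by (simp add: \<theta>'_def)
    have "(\<integral>\<omega>. (\<Prod>i<n. f i (X i \<omega>)) \<partial>M) = (\<integral>\<omega>. (\<Prod>i<n. exp (- \<theta>' i * X i \<omega>)) \<partial>M)"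
      by (simp add: f)
    also have "\<dots> = (\<Prod>i<n. \<integral>\<omega>. exp (- \<theta>' i * X i \<omega>) \<partial>M)"
      by (rule eq) (use \<theta> in \<open>auto simp: \<theta>'_def\<close>)
    finally show ?case by (simp add: f)
  next
    case (insert k K)
    have k: "k < n" "k \<notin> K" using insert by auto
    obtain B where B: "B \<in> sets borel" "f k = indicator B" using insert.prems(2)[of k] by (auto simp: J_def)
    define Y where "Y \<omega> = (\<Prod>i\<in>{..<n} - {k}. f i (X i \<omega>))" for \<omega>
    have split: "(\<Prod>i<n. g i) = (\<Prod>i\<in>{..<n} - {k}. g i) * g k" for g :: "nat \<Rightarrow> real"
      using k by (simp add: prod.remove mult.commute)
    have LJ: "L (f i) \<or> J (f i)" if "i < n" for i using insert.prems(2,3)[of i] that by blast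
    have Y_meas: "Y \<in> borel_measurable M"
      unfolding Y_def using LJ
      by (intro borel_measurable_prod measurable_compose[OF X_meas LJ_meas]) auto
    \<comment> \<open>The induction hypothesis is used with a Laplace kernel of arbitrary \<theta>
      at coordinate \<open>k\<close>, which supplies the premise of
      \<open>Laplace_determines\<close>.\<close>
    have Y_eq: "(\<integral>\<omega>. Y \<omega> * exp (- \<theta> * X k \<omega>) \<partial>M) =
        (\<Prod>i\<in>{..<n} - {k}. \<integral>\<omega>. f i (X i \<omega>) \<partial>M) * (\<integral>\<omega>. exp (- \<theta> * X k \<omega>) \<partial>M)" if "0 \<le> \<theta>" for \<theta>
    proof -
      let ?f = "f(k := \<lambda>x. exp (- \<theta> * x))"
      have "(\<integral>\<omega>. (\<Prod>i<n. ?f i (X i \<omega>)) \<partial>M) = (\<Prod>i<n. \<integral>\<omega>. ?f i (X i \<omega>) \<partial>M)"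
      proof (rule insert.IH)
        show "J (?f i)" if "i \<in> K" for i using that k insert.prems(2)[of i] by auto
        show "L (?f i)" if "i \<in> {..<n} - K" for i
          using that insert.prems(3)[of i] \<open>0 \<le> \<theta>\<close> by (auto simp: L_def)
      qed (use insert.prems in auto)
      then show ?thesis by (simp add: split Y_def)
    qed
    have Y_mean: "(\<integral>\<omega>. Y \<omega> \<partial>M) = (\<Prod>i\<in>{..<n} - {k}. \<integral>\<omega>. f i (X i \<omega>) \<partial>M)"
      using Y_eq[of 0] by (simp add: prob_space)
    have "(\<integral>\<omega>. Y \<omega> * indicator B (X k \<omega>) \<partial>M) = (\<integral>\<omega>. Y \<omega> \<partial>M) * measure M (X k -` B \<inter> space M)"
    proof (rule Laplace_determines)
      have "AE \<omega> in M. \<forall>i\<in>{..<n}. 0 \<le> X i \<omega>" using nonneg by (intro AE_finite_allI) auto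
      then show "AE \<omega> in M. 0 \<le> Y \<omega> \<and> Y \<omega> \<le> 1"
        unfolding Y_def by eventually_elim (use LJ LJ_bounds in \<open>auto intro!: prod_nonneg prod_le_1\<close>)
      show "(\<integral>\<omega>. Y \<omega> * exp (- \<theta> * X k \<omega>) \<partial>M) = (\<integral>\<omega>. Y \<omega> \<partial>M) * (\<integral>\<omega>. exp (- \<theta> * X k \<omega>) \<partial>M)"
        if "0 \<le> \<theta>" for \<theta> using Y_eq[OF that] Y_mean by simp
    qed (use X_meas nonneg k Y_meas B prob_space_axioms in auto)
    moreover have "measure M (X k -` B \<inter> space M) = (\<integral>\<omega>. f k (X k \<omega>) \<partial>M)"
    proof -
      have "(\<integral>\<omega>. f k (X k \<omega>) \<partial>M) = (\<integral>\<omega>. indicator (X k -` B \<inter> space M) \<omega> \<partial>M :: real)"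
        unfolding B(2) by (intro Bochner_Integration.integral_cong) (auto simp: indicator_def)
      then show ?thesis by simp
    qed
    ultimately show ?case by (simp add: split Y_mean) (simp add: B(2) Y_def)
  qed
  show ?thesis
    unfolding indep_vars_def2
  proof (intro conjI ballI indep_setsI)
    show "X i \<in> borel_measurable M" if "i \<in> {..<n}" for i using X_meas that by simp
    show "{X i -` A \<inter> space M |A. A \<in> sets borel} \<subseteq> events" if "i \<in> {..<n}" for i
      using X_meas[of i] that by (auto intro: measurable_sets)
    fix A K assume K: "K \<noteq> {}" "K \<subseteq> {..<n}" "finite K"
      and A: "\<forall>j\<in>K. A j \<in> {X j -` A \<inter> space M |A. A \<in> sets borel}"
    then obtain B where B: "\<And>j. j \<in> K \<Longrightarrow> B j \<in> sets borel \<and> A j = X j -` B j \<inter> space M"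
      by (simp only: mem_Collect_eq Bex_def) metis
    \<comment> \<open>Coordinates outside \<open>K\<close> get the sure event, so one factorization
      over \<open>{..<n}\<close> covers every subset.\<close>
    define f :: "nat \<Rightarrow> real \<Rightarrow> real" where "f i = indicator (if i \<in> K then B i else UNIV)" for i
    have f: "f i (X i \<omega>) = (if i \<in> K then indicator (A i) \<omega> else 1)" if "\<omega> \<in> space M" for i \<omega>
      using B[of i] that by (auto simp: f_def indicator_def)
    have "(\<integral>\<omega>. (\<Prod>i<n. f i (X i \<omega>)) \<partial>M) = (\<Prod>i<n. \<integral>\<omega>. f i (X i \<omega>) \<partial>M)"
    proof (rule key[of "{..<n}"])
      show "J (f i)" if "i \<in> {..<n}" for i
        unfolding J_def f_def by (rule bexI[of _ "if i \<in> K then B i else UNIV"]) (use B in auto)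
    qed auto
    moreover have "(\<integral>\<omega>. (\<Prod>i<n. f i (X i \<omega>)) \<partial>M) = prob (\<Inter>j\<in>K. A j)"
    proof -
      have "(\<Prod>i<n. f i (X i \<omega>)) = indicator (\<Inter>j\<in>K. A j) \<omega>" if "\<omega> \<in> space M" for \<omega>
      proof -
        have "(\<Prod>i<n. f i (X i \<omega>)) = (\<Prod>i\<in>K. indicator (A i) \<omega>)"
          using K by (subst prod.mono_neutral_cong_left[of "{..<n}" K]) (auto simp: f that)
        also have "\<dots> = indicator (\<Inter>j\<in>K. A j) \<omega>"
          using K by (auto simp: indicator_def)
        finally show ?thesis .
      qed
      then have "(\<integral>\<omega>. (\<Prod>i<n. f i (X i \<omega>)) \<partial>M) = (\<integral>\<omega>. indicator (\<Inter>j\<in>K. A j) \<omega> \<partial>M)"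
        by (intro Bochner_Integration.integral_cong) auto
      also have "\<dots> = prob ((\<Inter>j\<in>K. A j) \<inter> space M)" by simp
      also have "(\<Inter>j\<in>K. A j) \<inter> space M = (\<Inter>j\<in>K. A j)" using K(1) B by fast
      finally show ?thesis .
    qed
    moreover have "(\<Prod>i<n. \<integral>\<omega>. f i (X i \<omega>) \<partial>M) = (\<Prod>j\<in>K. prob (A j))"
    proof -
      have "(\<integral>\<omega>. f i (X i \<omega>) \<partial>M) = (if i \<in> K then prob (A i) else 1)" if "i < n" for i
      proof -
        have "(\<integral>\<omega>. f i (X i \<omega>) \<partial>M) = (\<integral>\<omega>. (if i \<in> K then indicator (A i) \<omega> else 1) \<partial>M)"
          by (intro Bochner_Integration.integral_cong) (auto simp: f)
        also have "\<dots> = (if i \<in> K then prob (A i \<inter> space M) else 1)" by (simp add: prob_space)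
        also have "\<dots> = (if i \<in> K then prob (A i) else 1)" using B[of i] by (auto intro!: arg_cong[where f = prob])
        finally show ?thesis .
      qed
      then have "(\<Prod>i<n. \<integral>\<omega>. f i (X i \<omega>) \<partial>M) = (\<Prod>i<n. if i \<in> K then prob (A i) else 1)" by simp
      also have "\<dots> = (\<Prod>j\<in>K. prob (A j))"
        using K by (intro prod.mono_neutral_cong_right) auto
      finally show ?thesis .
    qed
    ultimately show "prob (\<Inter>j\<in>K. A j) = (\<Prod>j\<in>K. prob (A j))" by simp
  qed
qed

lemma tendsto_expectation:
  fixes g :: "real \<Rightarrow> 'v \<Rightarrow> real"
  assumes "prob_space P"
    and meas: "\<And>s. s \<in> A \<Longrightarrow> g s \<in> borel_measurable P" "g0 \<in> borel_measurable P"
    and bound: "\<And>s. s \<in> A \<Longrightarrow> AE \<omega> in P. \<bar>g s \<omega>\<bar> \<le> 1"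
    and lim: "AE \<omega> in P. ((\<lambda>s. g s \<omega>) \<longlongrightarrow> g0 \<omega>) (at x within A)"
  shows "((\<lambda>s. \<integral>\<omega>. g s \<omega> \<partial>P) \<longlongrightarrow> (\<integral>\<omega>. g0 \<omega> \<partial>P)) (at x within A)"
  unfolding tendsto_at_iff_sequentially comp_def
proof (intro allI impI)
  interpret P: prob_space P by fact
  fix s assume s: "\<forall>i. s i \<in> A - {x}" "s \<longlonglongrightarrow> x"
  show "(\<lambda>i. \<integral>\<omega>. g (s i) \<omega> \<partial>P) \<longlonglongrightarrow> (\<integral>\<omega>. g0 \<omega> \<partial>P)"
  proof (rule integral_dominated_convergence[where w = "\<lambda>_. 1"])
    show "AE \<omega> in P. (\<lambda>i. g (s i) \<omega>) \<longlonglongrightarrow> g0 \<omega>"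
      using lim by eventually_elim (use s in \<open>auto simp: tendsto_at_iff_sequentially comp_def\<close>)
  qed (use s meas bound in auto)
qed

section \<open>The limit process\<close>

lemma fdd_convD:
  fixes f :: "(real \<Rightarrow> real) \<Rightarrow> real"
  assumes "fdd_conv T M X M' Y" "finite I" "I \<subseteq> T" "continuous_on UNIV f" "bounded (range f)"
  shows "(\<lambda>N. \<integral>\<omega>. f (\<lambda>t. if t \<in> I then X N t \<omega> else 0) \<partial>M)
    \<longlonglongrightarrow> (\<integral>\<omega>. f (\<lambda>t. if t \<in> I then Y t \<omega> else 0) \<partial>M')"
  using assms unfolding fdd_conv_def by blast

locale clock_limit = rtrw_process M \<nu> \<mu> \<pi> \<xi> \<tau>
  for M :: "'w measure" and \<nu> :: "(int ^ 'd::finite) pmf" and \<mu> :: "real measure measure"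
    and \<pi> :: "int ^ 'd \<Rightarrow> 'w \<Rightarrow> real measure"
    and \<xi> :: "nat \<Rightarrow> 'w \<Rightarrow> int ^ 'd" and \<tau> :: "int ^ 'd \<Rightarrow> nat \<Rightarrow> 'w \<Rightarrow> real" +
  fixes lstar a :: "nat \<Rightarrow> real" and M' :: "'v measure" and S :: "real \<Rightarrow> 'v \<Rightarrow> real" and D :: "real set"
  assumes lstar_sv: "slowly_varying lstar" and lstar_ge_1: "\<And>n. 1 \<le> lstar n"
    and no_return_eq: "\<And>n. no_return_prob M \<xi> n = 1 / lstar n"
    and a_top: "filterlim a at_top sequentially"
    and prob_space_M': "prob_space M'" and cadlag_S: "cadlag_process M' S"
    and S_nonneg: "\<And>t \<omega>. 0 \<le> t \<Longrightarrow> \<omega> \<in> space M' \<Longrightarrow> 0 \<le> S t \<omega>"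
    and S_unbounded: "AE \<omega> in M'. Limsup at_top (\<lambda>t. ereal (S t \<omega>)) = \<infinity>"
    and countable_D: "countable D"
    and weak_conv: "\<And>t. 0 \<le> t \<Longrightarrow> t \<notin> D \<Longrightarrow>
      weak_conv_m (\<lambda>N. distr M borel (rescaled_clock a \<xi> \<tau> N t)) (distr M' borel (S t))"
begin

sublocale limit: prob_space M' by (rule prob_space_M')

definition \<phi> :: "real \<Rightarrow> real \<Rightarrow> real" where
  "\<phi> t \<eta> = (\<integral>\<omega>. exp (- \<eta> * S t \<omega>) \<partial>M')"

lemma S_meas: "0 \<le> t \<Longrightarrow> S t \<in> borel_measurable M'"
  using cadlag_S by (simp add: cadlag_process_def)

lemma S_right_cont: "AE \<omega> in M'. \<forall>t\<ge>0. ((\<lambda>s. S s \<omega>) \<longlongrightarrow> S t \<omega>) (at_right t)"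
  using cadlag_S unfolding cadlag_process_def cadlag_def by (auto elim: eventually_mono)

lemma clock_measurable: "clock \<xi> \<tau> n \<in> borel_measurable M"
  using weighted_clock_measurable[of "\<lambda>_. 1" n] by (simp add: clock_def[abs_def])

lemma clock_mono:
  assumes "\<omega> \<in> space M" "m \<le> n"
  shows "clock \<xi> \<tau> m \<omega> \<le> clock \<xi> \<tau> n \<omega>"
  unfolding clock_def using assms holding_time_pos[OF assms(1)]
  by (intro sum_mono2) (auto intro: less_imp_le)

lemma clock_nonneg: "\<omega> \<in> space M \<Longrightarrow> 0 \<le> clock \<xi> \<tau> n \<omega>"
  using clock_mono[of \<omega> 0 n] by (simp add: clock_def)

lemma rescaled_clock_measurable: "rescaled_clock a \<xi> \<tau> N t \<in> borel_measurable M"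
  unfolding rescaled_clock_def[abs_def] using clock_measurable by simp

lemma Laplace_rescaled_clock:
  assumes "0 \<le> \<eta>" "0 < a N"
  shows "(\<integral>\<omega>. exp (- \<eta> * rescaled_clock a \<xi> \<tau> N t \<omega>) \<partial>M) = env.Z (\<lambda>_. \<eta> / a N) (nat \<lfloor>real N * t\<rfloor>)"
proof -
  have "- \<eta> * rescaled_clock a \<xi> \<tau> N t \<omega> = - weighted_clock (\<lambda>_. \<eta> / a N) (nat \<lfloor>real N * t\<rfloor>) \<omega>" for \<omega>
    by (simp add: rescaled_clock_def clock_def sum_distrib_left sum_divide_distrib sum_negf)
  then show ?thesis using Laplace_weighted_clock[of "\<lambda>_. \<eta> / a N"] assms by simp
qed

lemma a_pos: "\<forall>\<^sub>F N in sequentially. 0 < a N"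
  using a_top by (auto simp: filterlim_at_top_dense)

lemma exp_S_bounds:
  assumes "0 \<le> t" "0 \<le> \<eta>" "\<omega> \<in> space M'"
  shows "exp (- \<eta> * S t \<omega>) \<le> 1"
  using S_nonneg[of t \<omega>] assms by simp

lemma integrable_exp_S:
  assumes "0 \<le> t" "0 \<le> \<eta>"
  shows "integrable M' (\<lambda>\<omega>. exp (- \<eta> * S t \<omega>))"
proof (rule limit.integrable_const_bound[where B = 1])
  show "AE \<omega> in M'. norm (exp (- \<eta> * S t \<omega>)) \<le> 1"
    using exp_S_bounds[OF assms] by (intro AE_I2) simp
  show "(\<lambda>\<omega>. exp (- \<eta> * S t \<omega>)) \<in> borel_measurable M'"
    using S_meas[OF assms(1)] by measurable
qed

lemma exp_S_meas: "0 \<le> t \<Longrightarrow> (\<lambda>\<omega>. exp (- \<eta> * S t \<omega>)) \<in> borel_measurable M'"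
  using S_meas[of t] by measurable

lemma conv_Laplace:
  assumes t: "0 \<le> t" "t \<notin> D" and \<eta>: "0 \<le> \<eta>"
  shows "(\<lambda>N. env.Z (\<lambda>_. \<eta> / a N) (nat \<lfloor>real N * t\<rfloor>)) \<longlonglongrightarrow> \<phi> t \<eta>"
proof -
  \<comment> \<open>Weak convergence asks for a test function bounded on the whole line; the
    truncation at \<open>0\<close> is invisible to the nonnegative clock and limit.\<close>
  let ?f = "\<lambda>x. exp (- \<eta> * max 0 x)"
  have "(\<lambda>N. \<integral>x. ?f x \<partial>distr M borel (rescaled_clock a \<xi> \<tau> N t)) \<longlonglongrightarrow> (\<integral>x. ?f x \<partial>distr M' borel (S t))"
  proof (rule weak_conv_imp_integral_bdd_continuous_conv)
    show "real_distribution (distr M borel (rescaled_clock a \<xi> \<tau> N t))" for N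
      by (rule real_distribution_distr[OF rescaled_clock_measurable])
    show "real_distribution (distr M' borel (S t))"
      by (rule limit.real_distribution_distr[OF S_meas[OF t(1)]])
    show "isCont ?f x" for x by (intro continuous_intros)
    show "norm (?f x) \<le> 1" for x using \<eta> by simp
  qed (rule weak_conv[OF t])
  also have "(\<integral>x. ?f x \<partial>distr M' borel (S t)) = \<phi> t \<eta>"
    unfolding \<phi>_def using S_nonneg[OF t(1)]
    by (subst integral_distr[OF S_meas[OF t(1)]]) (auto intro!: Bochner_Integration.integral_cong)
  finally show ?thesis
  proof (rule Lim_transform_eventually)
    show "\<forall>\<^sub>F N in sequentially. (\<integral>x. ?f x \<partial>distr M borel (rescaled_clock a \<xi> \<tau> N t))
        = env.Z (\<lambda>_. \<eta> / a N) (nat \<lfloor>real N * t\<rfloor>)"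
      using a_pos
    proof eventually_elim
      case (elim N)
      have "(\<integral>x. ?f x \<partial>distr M borel (rescaled_clock a \<xi> \<tau> N t))
          = (\<integral>\<omega>. exp (- \<eta> * rescaled_clock a \<xi> \<tau> N t \<omega>) \<partial>M)"
        using clock_nonneg elim
        by (subst integral_distr[OF rescaled_clock_measurable])
           (auto intro!: Bochner_Integration.integral_cong simp: rescaled_clock_def)
      then show ?case using Laplace_rescaled_clock[OF \<eta> elim] by simp
    qed
  qed
qed

lemma trap_walk_limit:
  assumes "countable D'" "D \<subseteq> D'"
  shows "trap_walk_limit \<mu> q \<nu> a D' \<phi>"
proof (unfold trap_walk_limit_def trap_walk_limit_axioms_def, intro conjI allI impI env.trap_walk_axioms)
  have r: "env.r n = 1 / lstar n" for n by (simp add: r_eq_no_return no_return_eq)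
  have lpos: "0 < lstar n" for n using lstar_ge_1[of n] by simp
  show "0 < env.r n" for n using lpos by (simp add: r)
  show "(\<lambda>n. env.r (nat \<lfloor>c * real n\<rfloor>) / env.r n) \<longlonglongrightarrow> 1" if "0 < c" for c
  proof -
    have "(\<lambda>n. lstar (nat \<lfloor>c * real n\<rfloor>) / lstar n) \<longlonglongrightarrow> 1"
      using lstar_sv that by (simp add: slowly_varying_def)
    then have "(\<lambda>n. 1 / (lstar (nat \<lfloor>c * real n\<rfloor>) / lstar n)) \<longlonglongrightarrow> 1 / 1" by (intro tendsto_intros) auto
    then show ?thesis by (simp add: r)
  qed
  show "filterlim a at_top sequentially" by (rule a_top)
  show "countable D'" by fact
  show "(\<lambda>N. env.Z (\<lambda>_. \<eta> / a N) (nat \<lfloor>real N * t\<rfloor>)) \<longlonglongrightarrow> \<phi> t \<eta>" if "0 \<le> t" "t \<notin> D'" "0 \<le> \<eta>" for t \<eta>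
    using that assms(2) by (intro conv_Laplace) auto
  show "0 < \<phi> t \<eta>" if "0 \<le> t" "0 \<le> \<eta>" for t \<eta>
  proof -
    have "\<phi> t \<eta> \<noteq> 0"
    proof
      assume "\<phi> t \<eta> = 0"
      then have "AE \<omega> in M'. exp (- \<eta> * S t \<omega>) = 0"
        unfolding \<phi>_def using integral_nonneg_eq_0_iff_AE[OF integrable_exp_S[OF that]] by simp
      then show False by simp
    qed
    moreover have "0 \<le> \<phi> t \<eta>" unfolding \<phi>_def by simp
    ultimately show ?thesis by simp
  qed
  show "(\<phi> t \<longlongrightarrow> 1) (at_right 0)" if "0 \<le> t" for t
  proof -
    have "((\<lambda>\<eta>. \<integral>\<omega>. exp (- \<eta> * S t \<omega>) \<partial>M') \<longlongrightarrow> (\<integral>\<omega>. exp (- 0 * S t \<omega>) \<partial>M')) (at_right 0)"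
    proof (rule tendsto_expectation[OF prob_space_M'])
      show "AE \<omega> in M'. \<bar>exp (- \<eta> * S t \<omega>)\<bar> \<le> 1" if "\<eta> \<in> {0<..}" for \<eta>
        using that exp_S_bounds[OF \<open>0 \<le> t\<close>, of \<eta>] by (intro AE_I2) auto
      show "AE \<omega> in M'. ((\<lambda>\<eta>. exp (- \<eta> * S t \<omega>)) \<longlongrightarrow> exp (- 0 * S t \<omega>)) (at_right 0)"
        by (intro AE_I2 tendsto_intros)
    qed (use exp_S_meas[OF that] in auto)
    then show ?thesis by (simp add: \<phi>_def[abs_def] limit.prob_space)
  qed
  show "((\<lambda>s. \<phi> s \<eta>) \<longlongrightarrow> \<phi> t \<eta>) (at_right t)" if t: "0 \<le> t" and \<eta>: "0 \<le> \<eta>" for t \<eta>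
    unfolding \<phi>_def
  proof (rule tendsto_expectation[OF prob_space_M'])
    show "AE \<omega> in M'. \<bar>exp (- \<eta> * S s \<omega>)\<bar> \<le> 1" if "s \<in> {t<..}" for s
      using that t exp_S_bounds[OF _ \<eta>, of s] by (intro AE_I2) auto
    show "AE \<omega> in M'. ((\<lambda>s. exp (- \<eta> * S s \<omega>)) \<longlongrightarrow> exp (- \<eta> * S t \<omega>)) (at_right t)"
      using S_right_cont by eventually_elim (use t in \<open>auto intro!: tendsto_intros\<close>)
  qed (use t exp_S_meas in auto)
qed

sublocale L: trap_walk_limit \<mu> q \<nu> a D \<phi>
  by (rule trap_walk_limit[OF countable_D order_refl])

section \<open>Marginals of the limit and properties of its exponent\<close>

lemma S_linear:
  assumes "\<And>t. 0 \<le> t \<Longrightarrow> AE \<omega> in M'. S t \<omega> = m * t"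
  shows "AE \<omega> in M'. \<forall>t\<ge>0. S t \<omega> = m * t"
proof -
  \<comment> \<open>Null sets are collected over the countable grid only; right continuity then
    reaches all times on one event.\<close>
  have "AE \<omega> in M'. \<forall>t\<in>L.grid. S t \<omega> = m * t"
    using L.countable_grid L.grid_pos by (subst AE_ball_countable) (auto intro!: assms less_imp_le)
  with S_right_cont show ?thesis
  proof eventually_elim
    case (elim \<omega>)
    show ?case
    proof (intro allI impI)
      fix t :: real assume t: "0 \<le> t"
      have "(\<lambda>k. S (L.grid_above k t) \<omega>) \<longlonglongrightarrow> S t \<omega>"
        using elim(1) t by (intro filterlim_compose[OF _ L.grid_above_at_right]) auto
      moreover have "S (L.grid_above k t) \<omega> = m * L.grid_above k t" for k
        using elim(2) L.grid_above_in_grid[OF t] by blast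
      ultimately have "(\<lambda>k. m * L.grid_above k t) \<longlonglongrightarrow> S t \<omega>" by simp
      moreover have "(\<lambda>k. m * L.grid_above k t) \<longlonglongrightarrow> m * t" by (intro tendsto_intros L.grid_above_tendsto)
      ultimately show "S t \<omega> = m * t" by (rule LIMSEQ_unique)
    qed
  qed
qed

lemma Laplace_variance:
  assumes t: "0 \<le> t"
  shows "integrable M' (\<lambda>\<omega>. (exp (- S t \<omega>) - \<phi> t 1)\<^sup>2)"
    and "(\<integral>\<omega>. (exp (- S t \<omega>) - \<phi> t 1)\<^sup>2 \<partial>M') = \<phi> t 2 - (\<phi> t 1)\<^sup>2"
proof -
  let ?e = "\<lambda>\<omega>. exp (- S t \<omega>)" and ?m = "\<phi> t 1"
  have sq: "exp (- 2 * S t \<omega>) = (?e \<omega>)\<^sup>2" for \<omega>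
    by (simp add: power2_eq_square exp_add[symmetric])
  have i: "integrable M' ?e" "integrable M' (\<lambda>\<omega>. (?e \<omega>)\<^sup>2)"
    using integrable_exp_S[OF t, of 1] integrable_exp_S[OF t, of 2] by (simp_all add: sq[simplified])
  have expand: "(?e \<omega> - ?m)\<^sup>2 = (?e \<omega>)\<^sup>2 - 2 * ?m * ?e \<omega> + ?m\<^sup>2" for \<omega>
    by (simp add: power2_diff algebra_simps)
  show "integrable M' (\<lambda>\<omega>. (?e \<omega> - ?m)\<^sup>2)" unfolding expand using i by simp
  have "(\<integral>\<omega>. (?e \<omega>)\<^sup>2 - 2 * ?m * ?e \<omega> + ?m\<^sup>2 \<partial>M') = \<phi> t 2 - 2 * ?m * ?m + ?m\<^sup>2"
    using i by (simp add: \<phi>_def sq[simplified] limit.prob_space)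
  then show "(\<integral>\<omega>. (?e \<omega> - ?m)\<^sup>2 \<partial>M') = \<phi> t 2 - ?m\<^sup>2"
    unfolding expand by (simp add: power2_eq_square)
qed

text \<open>By \<open>Laplace_variance\<close>, \<open>exp (- S t)\<close> then has variance
  zero.\<close>

lemma S_eq_of_Laplace:
  assumes t: "0 \<le> t" and eq: "\<phi> t 2 = (\<phi> t 1)\<^sup>2"
  shows "AE \<omega> in M'. S t \<omega> = - ln (\<phi> t 1)"
proof -
  have "AE \<omega> in M'. (exp (- S t \<omega>) - \<phi> t 1)\<^sup>2 = 0"
    using integral_nonneg_eq_0_iff_AE[OF Laplace_variance(1)[OF t]] Laplace_variance(2)[OF t] eq by simp
  then show ?thesis
  proof eventually_elim
    case (elim \<omega>)
    then have "exp (- S t \<omega>) = \<phi> t 1" by simp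
    then show ?case by (metis ln_exp minus_minus)
  qed
qed

lemma \<phi>_double:
  assumes "0 \<le> t"
  shows "(\<phi> t 1)\<^sup>2 \<le> \<phi> t 2"
proof -
  have "0 \<le> (\<integral>\<omega>. (exp (- S t \<omega>) - \<phi> t 1)\<^sup>2 \<partial>M')" by simp
  then show ?thesis using Laplace_variance(2)[OF assms] by simp
qed

lemma \<psi>_0: "L.\<psi> 0 = 0"
  by (simp add: L.\<psi>_def \<phi>_def limit.prob_space)

text \<open>Otherwise \<open>\<phi> t 1 = 1\<close> for every \<open>t\<close>, so that almost every
  path vanishes identically, against the infinite upper limit.\<close>

lemma S_nontrivial: "0 < L.\<psi> 1"
proof (rule ccontr)
  assume "\<not> 0 < L.\<psi> 1"
  then have \<psi>1: "L.\<psi> 1 = 0" using L.\<psi>_nonneg[of 1] by simp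
  have "AE \<omega> in M'. S t \<omega> = 0 * t" if t: "0 \<le> t" for t
  proof -
    have one: "\<phi> t 1 = 1" using L.\<phi>_eq[OF t, of 1] \<psi>1 by simp
    have "\<phi> t 2 \<le> (\<integral>\<omega>. 1 \<partial>M')"
      unfolding \<phi>_def using exp_S_bounds[OF t] by (intro integral_mono integrable_exp_S t) auto
    then have "\<phi> t 2 = (\<phi> t 1)\<^sup>2" using \<phi>_double[OF t] one by (simp add: limit.prob_space)
    from S_eq_of_Laplace[OF t this] show ?thesis by (simp add: one)
  qed
  then have "AE \<omega> in M'. \<forall>t\<ge>0. S t \<omega> = 0 * t" by (rule S_linear)
  with S_unbounded have "AE \<omega> in M'. False"
  proof eventually_elim
    case (elim \<omega>)
    have "Limsup at_top (\<lambda>t. ereal (S t \<omega>)) = Limsup at_top (\<lambda>t::real. ereal 0)"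
    proof (rule Limsup_eq)
      show "\<forall>\<^sub>F t in at_top. ereal (S t \<omega>) = ereal 0"
        using eventually_ge_at_top[of 0] by eventually_elim (use elim(2) in simp)
    qed
    also have "\<dots> = 0" by (simp add: Limsup_const)
    finally show ?case using elim(1) by simp
  qed
  then show False by simp
qed

text \<open>Failure would make \<open>exp (- x * S 1)\<close> and \<open>exp (- y * S 1)\<close>
  agree almost surely, hence \<open>S 1 = 0\<close>, against \<open>S_nontrivial\<close>.\<close>

lemma \<psi>_strict:
  assumes "0 \<le> x" "x < y"
  shows "L.\<psi> x < L.\<psi> y"
proof (rule ccontr)
  assume "\<not> L.\<psi> x < L.\<psi> y"
  then have le: "\<phi> 1 x \<le> \<phi> 1 y" using L.\<phi>_eq[of 1 x] L.\<phi>_eq[of 1 y] assms by simp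
  have int: "integrable M' (\<lambda>\<omega>. exp (- x * S 1 \<omega>) - exp (- y * S 1 \<omega>))"
    using assms by (intro Bochner_Integration.integrable_diff integrable_exp_S) auto
  have nonneg: "0 \<le> exp (- x * S 1 \<omega>) - exp (- y * S 1 \<omega>)" if "\<omega> \<in> space M'" for \<omega>
    using assms S_nonneg[of 1 \<omega>] that by (simp add: mult_right_mono)
  have "(\<integral>\<omega>. exp (- x * S 1 \<omega>) - exp (- y * S 1 \<omega>) \<partial>M') = \<phi> 1 x - \<phi> 1 y"
    unfolding \<phi>_def using assms by (intro Bochner_Integration.integral_diff integrable_exp_S) auto
  moreover have "0 \<le> (\<integral>\<omega>. exp (- x * S 1 \<omega>) - exp (- y * S 1 \<omega>) \<partial>M')"
    using nonneg by (rule Bochner_Integration.integral_nonneg)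
  ultimately have "(\<integral>\<omega>. exp (- x * S 1 \<omega>) - exp (- y * S 1 \<omega>) \<partial>M') = 0" using le by simp
  then have "AE \<omega> in M'. exp (- x * S 1 \<omega>) - exp (- y * S 1 \<omega>) = 0"
    using integral_nonneg_eq_0_iff_AE[OF int] nonneg by auto
  then have "AE \<omega> in M'. exp (- 1 * S 1 \<omega>) = 1"
    by eventually_elim (use assms in auto)
  then have "\<phi> 1 1 = (\<integral>\<omega>. 1 \<partial>M')"
    unfolding \<phi>_def using exp_S_meas[of 1 1] by (intro integral_cong_AE) auto
  then have "L.\<psi> 1 = 0" by (simp add: L.\<psi>_def limit.prob_space)
  then show False using S_nontrivial by simp
qed

lemma \<psi>_cont: "continuous_on {0..} L.\<psi>"
proof -
  have "continuous_on {0..} (\<phi> 1)"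
    unfolding continuous_on_def \<phi>_def
  proof (intro ballI tendsto_expectation[OF prob_space_M'])
    fix x :: real assume "x \<in> {0..}"
    show "AE \<omega> in M'. \<bar>exp (- \<eta> * S 1 \<omega>)\<bar> \<le> 1" if "\<eta> \<in> {0..}" for \<eta>
      using that exp_S_bounds[of 1 \<eta>] by (intro AE_I2) auto
    show "AE \<omega> in M'. ((\<lambda>\<eta>. exp (- \<eta> * S 1 \<omega>)) \<longlongrightarrow> exp (- x * S 1 \<omega>)) (at x within {0..})"
      by (intro AE_I2 tendsto_intros)
  qed (use exp_S_meas[of 1] in auto)
  then show ?thesis
    unfolding L.\<psi>_def[abs_def] using L.\<phi>_pos[of 1]
    by (intro continuous_on_minus continuous_on_ln) (auto simp: less_imp_neq[symmetric])
qed

text \<open>Jensen's inequality for \<open>exp (- S 1)\<close>; through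
  \<open>regular_variation\<close> this is the reason for \<open>\<alpha> \<le> 1\<close>.\<close>

lemma \<psi>_double: "L.\<psi> 2 \<le> 2 * L.\<psi> 1"
proof -
  have "2 * ln (\<phi> 1 1) = ln ((\<phi> 1 1)\<^sup>2)" using L.\<phi>_pos[of 1 1] by (simp add: ln_realpow)
  also have "\<dots> \<le> ln (\<phi> 1 2)" using \<phi>_double[of 1] L.\<phi>_pos[of 1 1] L.\<phi>_pos[of 1 2] by simp
  finally show ?thesis by (simp add: L.\<psi>_def)
qed

lemma slowly_varying_normalization:
  assumes "0 < \<beta>" and lim: "\<And>c. 0 < c \<Longrightarrow> (\<lambda>N. a (nat \<lfloor>c * real N\<rfloor>) / a N) \<longlonglongrightarrow> c powr \<beta>"
  shows "slowly_varying (\<lambda>N. a N / real N powr \<beta>)"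
  unfolding slowly_varying_def
proof (intro conjI allI impI)
  show "\<forall>\<^sub>F N in sequentially. 0 < a N / real N powr \<beta>"
    using a_pos eventually_gt_at_top[of 0] by eventually_elim simp
  fix c :: real assume c: "0 < c"
  let ?n = "\<lambda>N. nat \<lfloor>c * real N\<rfloor>"
  have "(\<lambda>N. real (?n N) / real N) \<longlonglongrightarrow> c" using floor_mult_ratio[of c] c by (simp add: mult.commute)
  then have "(\<lambda>N. (a (?n N) / a N) / (real (?n N) / real N) powr \<beta>) \<longlonglongrightarrow> c powr \<beta> / c powr \<beta>"
    using c by (intro tendsto_intros lim) auto
  then have "(\<lambda>N. (a (?n N) / a N) / (real (?n N) / real N) powr \<beta>) \<longlonglongrightarrow> 1" using c by simp
  then show "(\<lambda>N. a (?n N) / real (?n N) powr \<beta> / (a N / real N powr \<beta>)) \<longlonglongrightarrow> 1"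
    by (simp add: powr_divide field_simps)
qed

section \<open>Independent and stationary increments under joint convergence\<close>

lemma weighted_clock_block_weight:
  assumes t: "mono t"
  shows "weighted_clock (L.block_weight t \<theta> j N) (nat \<lfloor>real N * t j\<rfloor>) \<omega>
    = (\<Sum>i<j. \<theta> i * (rescaled_clock a \<xi> \<tau> N (t (Suc i)) \<omega> - rescaled_clock a \<xi> \<tau> N (t i) \<omega>))"
proof -
  let ?x = "\<lambda>k. \<tau> (walk \<xi> k \<omega>) (local_time \<xi> (walk \<xi> k \<omega>) k \<omega>) \<omega>"
  define n where "n i = nat \<lfloor>real N * t i\<rfloor>" for i
  have n_mono: "n i \<le> n i'" if "i \<le> i'" for i i'
    unfolding n_def using monoD[OF t that] by (intro nat_mono floor_mono mult_left_mono) auto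
  have "weighted_clock (L.block_weight t \<theta> j N) (n j) \<omega>
    = (\<Sum>k<n j. \<Sum>i<j. if n i \<le> k \<and> k < n (Suc i) then \<theta> i / a N * ?x k else 0)"
    unfolding L.block_weight_def n_def sum_distrib_right by (intro sum.cong refl) auto
  also have "\<dots> = (\<Sum>i<j. \<Sum>k<n j. if n i \<le> k \<and> k < n (Suc i) then \<theta> i / a N * ?x k else 0)"
    by (rule sum.swap)
  also have "\<dots> = (\<Sum>i<j. \<theta> i * ((clock \<xi> \<tau> (n (Suc i)) \<omega> - clock \<xi> \<tau> (n i) \<omega>) / a N))"
  proof (intro sum.cong refl)
    fix i assume "i \<in> {..<j}"
    then have le: "n (Suc i) \<le> n j" by (intro n_mono) simp
    have "(\<Sum>k<n j. if n i \<le> k \<and> k < n (Suc i) then \<theta> i / a N * ?x k else 0)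
      = (\<Sum>k\<in>{n i..<n (Suc i)}. \<theta> i / a N * ?x k)"
      using le by (subst sum.inter_filter[symmetric]) (auto intro!: sum.cong)
    also have "\<dots> = \<theta> i / a N * (\<Sum>k\<in>{n i..<n (Suc i)}. ?x k)" by (simp add: sum_distrib_left)
    also have "(\<Sum>k\<in>{n i..<n (Suc i)}. ?x k) = clock \<xi> \<tau> (n (Suc i)) \<omega> - clock \<xi> \<tau> (n i) \<omega>"
      using sum_diff_nat_ivl[of 0 "n i" "n (Suc i)" ?x] n_mono[of i "Suc i"]
      by (simp add: clock_def lessThan_atLeast0)
    finally show "(\<Sum>k<n j. if n i \<le> k \<and> k < n (Suc i) then \<theta> i / a N * ?x k else 0)
      = \<theta> i * ((clock \<xi> \<tau> (n (Suc i)) \<omega> - clock \<xi> \<tau> (n i) \<omega>) / a N)" by simp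
  qed
  finally show ?thesis
    by (simp add: n_def rescaled_clock_def diff_divide_distrib)
qed

text \<open>Joint convergence passes the product form of \<open>joint_limit\<close> on to the
  increments of the limit. Independence and stationarity are both read off from this one formula,
  since Laplace transforms determine laws.\<close>

lemma subordinator_of_fdd_conv:
  assumes fdd: "fdd_conv ({0..} - D2) M (rescaled_clock a \<xi> \<tau>) M' S" and D2: "countable D2"
  shows "subordinator M' S"
proof -
  \<comment> \<open>The grid has to avoid both exceptional sets. The exponent depends on
    \<open>\<phi>\<close> only, so \<open>G.\<psi>\<close> and \<open>L.\<psi>\<close>
    coincide.\<close>
  interpret G: trap_walk_limit \<mu> q \<nu> a "D \<union> D2" \<phi>
    by (rule trap_walk_limit) (use countable_D D2 in auto)
  have grid_T: "t \<in> {0..} - D2" if "t \<in> G.grid" for t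
    using G.grid_pos[OF that] G.grid_D[OF that] by auto
  have le_grid: "AE \<omega> in M'. S s \<omega> \<le> S t \<omega>" if s: "s \<in> G.grid" and t: "t \<in> G.grid" and st: "s \<le> t" for s t
  proof -
    \<comment> \<open>A bounded continuous functional that vanishes exactly when the two values are
      ordered. The clock is monotone, so its mean is eventually \<open>0\<close> along the sequence,
      hence also in the limit.\<close>
    let ?f = "\<lambda>v :: real \<Rightarrow> real. min 1 (max 0 (v s - v t))"
    have "continuous_on UNIV ?f" by (intro continuous_intros continuous_on_product_coordinates)
    moreover have "bounded (range ?f)" by (rule boundedI[where B = 1]) auto
    ultimately have "(\<lambda>N. \<integral>\<omega>. ?f (\<lambda>u. if u \<in> {s, t} then rescaled_clock a \<xi> \<tau> N u \<omega> else 0) \<partial>M)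
        \<longlonglongrightarrow> (\<integral>\<omega>. ?f (\<lambda>u. if u \<in> {s, t} then S u \<omega> else 0) \<partial>M')"
      using grid_T[OF s] grid_T[OF t] by (intro fdd_convD[OF fdd]) auto
    moreover have "\<forall>\<^sub>F N in sequentially.
        (\<integral>\<omega>. ?f (\<lambda>u. if u \<in> {s, t} then rescaled_clock a \<xi> \<tau> N u \<omega> else 0) \<partial>M) = 0"
      using a_pos
    proof eventually_elim
      case (elim N)
      have "rescaled_clock a \<xi> \<tau> N s \<omega> \<le> rescaled_clock a \<xi> \<tau> N t \<omega>" if "\<omega> \<in> space M" for \<omega>
        unfolding rescaled_clock_def using elim st that
        by (intro divide_right_mono clock_mono nat_mono floor_mono mult_left_mono) auto
      then have "(\<integral>\<omega>. ?f (\<lambda>u. if u \<in> {s, t} then rescaled_clock a \<xi> \<tau> N u \<omega> else 0) \<partial>M) = (\<integral>\<omega>. 0 \<partial>M)"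
        by (intro Bochner_Integration.integral_cong) auto
      then show ?case by simp
    qed
    ultimately have "(\<lambda>N. 0) \<longlonglongrightarrow> (\<integral>\<omega>. min 1 (max 0 (S s \<omega> - S t \<omega>)) \<partial>M')"
      by (simp add: Lim_transform_eventually)
    then have "(\<integral>\<omega>. min 1 (max 0 (S s \<omega> - S t \<omega>)) \<partial>M') = 0"
      using LIMSEQ_unique tendsto_const by blast
    moreover have "integrable M' (\<lambda>\<omega>. min 1 (max 0 (S s \<omega> - S t \<omega>)))"
      using S_meas[of s] S_meas[of t] G.grid_pos[OF s] G.grid_pos[OF t]
      by (intro limit.integrable_const_bound[where B = 1]) auto
    ultimately have "AE \<omega> in M'. min 1 (max 0 (S s \<omega> - S t \<omega>)) = 0"
      by (subst (asm) integral_nonneg_eq_0_iff_AE) auto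
    then show ?thesis by eventually_elim (auto simp: min_def max_def split: if_splits)
  qed
  have "AE \<omega> in M'. \<forall>p\<in>{p \<in> G.grid \<times> G.grid. fst p \<le> snd p}. S (fst p) \<omega> \<le> S (snd p) \<omega>"
    using le_grid G.countable_grid
    by (subst AE_ball_countable) (auto intro!: countable_subset[OF Collect_restrict] countable_SIGMA)
  then have mono_all: "AE \<omega> in M'. \<forall>s\<ge>0. \<forall>t\<ge>s. S s \<omega> \<le> S t \<omega>"
    using S_right_cont
  proof eventually_elim
    case (elim \<omega>)
    show ?case
    proof (intro allI impI)
      fix s t :: real assume st: "0 \<le> s" "s \<le> t"
      have "(\<lambda>k. S (G.grid_above k u) \<omega>) \<longlonglongrightarrow> S u \<omega>" if "0 \<le> u" for u
        using elim(2) that by (intro filterlim_compose[OF _ G.grid_above_at_right]) auto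
      moreover have "S (G.grid_above k s) \<omega> \<le> S (G.grid_above k t) \<omega>" for k
        using elim(1) G.grid_above_in_grid[of s k] G.grid_above_in_grid[of t k] G.grid_above_mono[of s t k] st by auto
      ultimately show "S s \<omega> \<le> S t \<omega>"
        using st by (intro LIMSEQ_le[of "\<lambda>k. S (G.grid_above k s) \<omega>" _ "\<lambda>k. S (G.grid_above k t) \<omega>"]) auto
    qed
  qed
  have joint_grid: "(\<integral>\<omega>. exp (- (\<Sum>i<n. \<theta> i * (S (t (Suc i)) \<omega> - S (t i) \<omega>))) \<partial>M')
      = (\<Prod>i<n. exp (- (t (Suc i) - t i) * G.\<psi> (\<theta> i)))"
    if t: "mono t" "\<And>i. t i \<in> G.grid" and \<theta>: "\<And>i. 0 \<le> \<theta> i" for n t \<theta>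
  proof -
    \<comment> \<open>The truncation keeps the functional bounded on all vectors; on the
      nondecreasing paths of the clock and of the limit it has no effect.\<close>
    let ?f = "\<lambda>v :: real \<Rightarrow> real. exp (- (\<Sum>i<n. \<theta> i * max 0 (v (t (Suc i)) - v (t i))))"
    let ?I = "t ` {..n}"
    have "continuous_on UNIV ?f" by (intro continuous_intros continuous_on_product_coordinates)
    moreover have "bounded (range ?f)"
      using \<theta> by (intro boundedI[where B = 1]) (auto intro!: sum_nonneg)
    moreover have "finite ?I" "?I \<subseteq> {0..} - D2" using grid_T t(2) by auto
    ultimately have "(\<lambda>N. \<integral>\<omega>. ?f (\<lambda>u. if u \<in> ?I then rescaled_clock a \<xi> \<tau> N u \<omega> else 0) \<partial>M)
        \<longlonglongrightarrow> (\<integral>\<omega>. ?f (\<lambda>u. if u \<in> ?I then S u \<omega> else 0) \<partial>M')"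
      by (intro fdd_convD[OF fdd])
    moreover have "\<forall>\<^sub>F N in sequentially.
        (\<integral>\<omega>. ?f (\<lambda>u. if u \<in> ?I then rescaled_clock a \<xi> \<tau> N u \<omega> else 0) \<partial>M)
        = env.Z (G.block_weight t \<theta> n N) (nat \<lfloor>real N * t n\<rfloor>)"
      using a_pos
    proof eventually_elim
      case (elim N)
      have "?f (\<lambda>u. if u \<in> ?I then rescaled_clock a \<xi> \<tau> N u \<omega> else 0)
          = exp (- weighted_clock (G.block_weight t \<theta> n N) (nat \<lfloor>real N * t n\<rfloor>) \<omega>)" if \<omega>: "\<omega> \<in> space M" for \<omega>
      proof -
        have "rescaled_clock a \<xi> \<tau> N (t i) \<omega> \<le> rescaled_clock a \<xi> \<tau> N (t (Suc i)) \<omega>" for i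
          unfolding rescaled_clock_def using elim monoD[OF t(1), of i "Suc i"] \<omega>
          by (intro divide_right_mono clock_mono nat_mono floor_mono mult_left_mono) auto
        then show ?thesis
          unfolding weighted_clock_block_weight[OF t(1)] by (intro arg_cong[where f = exp] arg_cong[where f = uminus] sum.cong) auto
      qed
      then have "(\<integral>\<omega>. ?f (\<lambda>u. if u \<in> ?I then rescaled_clock a \<xi> \<tau> N u \<omega> else 0) \<partial>M)
          = (\<integral>\<omega>. exp (- weighted_clock (G.block_weight t \<theta> n N) (nat \<lfloor>real N * t n\<rfloor>) \<omega>) \<partial>M)"
        by (intro Bochner_Integration.integral_cong) auto
      also have "\<dots> = env.Z (G.block_weight t \<theta> n N) (nat \<lfloor>real N * t n\<rfloor>)"
        by (rule Laplace_weighted_clock) (use \<theta> elim in \<open>auto simp: G.block_weight_def intro!: sum_nonneg\<close>)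
      finally show ?case .
    qed
    ultimately have "(\<lambda>N. env.Z (G.block_weight t \<theta> n N) (nat \<lfloor>real N * t n\<rfloor>))
        \<longlonglongrightarrow> (\<integral>\<omega>. ?f (\<lambda>u. if u \<in> ?I then S u \<omega> else 0) \<partial>M')"
      by (rule Lim_transform_eventually)
    moreover have "(\<lambda>N. env.Z (G.block_weight t \<theta> n N) (nat \<lfloor>real N * t n\<rfloor>))
        \<longlonglongrightarrow> (\<Prod>i<n. exp (- (t (Suc i) - t i) * G.\<psi> (\<theta> i)))"
      using G.grid_pos[OF t(2)] by (intro G.joint_limit t \<theta>) (simp add: less_imp_le)
    ultimately have "(\<integral>\<omega>. ?f (\<lambda>u. if u \<in> ?I then S u \<omega> else 0) \<partial>M')
        = (\<Prod>i<n. exp (- (t (Suc i) - t i) * G.\<psi> (\<theta> i)))" by (rule LIMSEQ_unique)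
    moreover have "(\<integral>\<omega>. ?f (\<lambda>u. if u \<in> ?I then S u \<omega> else 0) \<partial>M')
        = (\<integral>\<omega>. exp (- (\<Sum>i<n. \<theta> i * (S (t (Suc i)) \<omega> - S (t i) \<omega>))) \<partial>M')"
    proof (rule integral_cong_AE)
      have t0: "0 \<le> t i" for i using G.grid_pos[OF t(2)] by (simp add: less_imp_le)
      show "AE \<omega> in M'. ?f (\<lambda>u. if u \<in> ?I then S u \<omega> else 0) = exp (- (\<Sum>i<n. \<theta> i * (S (t (Suc i)) \<omega> - S (t i) \<omega>)))"
        using mono_all
      proof eventually_elim
        case (elim \<omega>)
        have "S (t i) \<omega> \<le> S (t (Suc i)) \<omega>" for i using elim t0 monoD[OF t(1), of i "Suc i"] by auto
        then show ?case
          by (intro arg_cong[where f = exp] arg_cong[where f = uminus] sum.cong) auto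
      qed
      show "(\<lambda>\<omega>. exp (- (\<Sum>i<n. \<theta> i * (S (t (Suc i)) \<omega> - S (t i) \<omega>)))) \<in> borel_measurable M'"
        using S_meas[OF t0] by measurable
      have "(\<lambda>\<omega>. if u \<in> ?I then S u \<omega> else 0) \<in> borel_measurable M'" for u
        using S_meas t0 by (cases "u \<in> ?I") auto
      then show "(\<lambda>\<omega>. ?f (\<lambda>u. if u \<in> ?I then S u \<omega> else 0)) \<in> borel_measurable M'"
        by (intro borel_measurable_exp[THEN measurable_compose[rotated]] borel_measurable_uminus borel_measurable_sum
            borel_measurable_times borel_measurable_const borel_measurable_max borel_measurable_diff)
    qed
    ultimately show ?thesis by simp
  qed
  have joint: "(\<integral>\<omega>. exp (- (\<Sum>i<n. \<theta> i * (S (t (Suc i)) \<omega> - S (t i) \<omega>))) \<partial>M')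
      = (\<Prod>i<n. exp (- (t (Suc i) - t i) * L.\<psi> (\<theta> i)))"
    if t: "mono t" "0 \<le> t 0" and \<theta>: "\<And>i. 0 \<le> \<theta> i" for n t \<theta>
  proof -
    have t0: "0 \<le> t i" for i using t(2) monoD[OF t(1), of 0 i] by simp
    \<comment> \<open>For fixed \<open>k\<close> the approximating times are again ordered grid
      times, so \<open>joint_grid\<close> applies to them.\<close>
    let ?g = "\<lambda>k i. G.grid_above k (t i)"
    have g0: "0 \<le> ?g k i" for k i using G.grid_pos[OF G.grid_above_in_grid[OF t0]] by (simp add: less_imp_le)
    have g_mono: "mono (?g k)" for k
      using t(1) by (auto simp: mono_def intro: G.grid_above_mono)
    have "(\<lambda>k. \<integral>\<omega>. exp (- (\<Sum>i<n. \<theta> i * (S (?g k (Suc i)) \<omega> - S (?g k i) \<omega>))) \<partial>M')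
        \<longlonglongrightarrow> (\<integral>\<omega>. exp (- (\<Sum>i<n. \<theta> i * (S (t (Suc i)) \<omega> - S (t i) \<omega>))) \<partial>M')"
    proof (rule integral_dominated_convergence[where w = "\<lambda>_. 1"])
      show "AE \<omega> in M'. (\<lambda>k. exp (- (\<Sum>i<n. \<theta> i * (S (?g k (Suc i)) \<omega> - S (?g k i) \<omega>))))
          \<longlonglongrightarrow> exp (- (\<Sum>i<n. \<theta> i * (S (t (Suc i)) \<omega> - S (t i) \<omega>)))"
        using S_right_cont
      proof eventually_elim
        case (elim \<omega>)
        have "(\<lambda>k. S (?g k i) \<omega>) \<longlonglongrightarrow> S (t i) \<omega>" for i
          using elim t0 by (intro filterlim_compose[OF _ G.grid_above_at_right]) auto
        then show ?case by (intro tendsto_intros)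
      qed
      show "AE \<omega> in M'. norm (exp (- (\<Sum>i<n. \<theta> i * (S (?g k (Suc i)) \<omega> - S (?g k i) \<omega>)))) \<le> 1" for k
        using mono_all
      proof eventually_elim
        case (elim \<omega>)
        have "0 \<le> \<theta> i * (S (?g k (Suc i)) \<omega> - S (?g k i) \<omega>)" for i
          using elim g0[of k i] monoD[OF g_mono[of k], of i "Suc i"] \<theta> by (intro mult_nonneg_nonneg) auto
        then show ?case by (auto intro!: sum_nonneg)
      qed
      show "(\<lambda>\<omega>. exp (- (\<Sum>i<n. \<theta> i * (S (?g k (Suc i)) \<omega> - S (?g k i) \<omega>)))) \<in> borel_measurable M'" for k
        using S_meas[OF g0[of k]] by measurable
      show "(\<lambda>\<omega>. exp (- (\<Sum>i<n. \<theta> i * (S (t (Suc i)) \<omega> - S (t i) \<omega>)))) \<in> borel_measurable M'"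
        using S_meas[OF t0] by measurable
    qed simp
    moreover have "(\<integral>\<omega>. exp (- (\<Sum>i<n. \<theta> i * (S (?g k (Suc i)) \<omega> - S (?g k i) \<omega>))) \<partial>M')
        = (\<Prod>i<n. exp (- (?g k (Suc i) - ?g k i) * L.\<psi> (\<theta> i)))" for k
      by (rule joint_grid[OF g_mono G.grid_above_in_grid[OF t0] \<theta>])
    moreover have "(\<lambda>k. \<Prod>i<n. exp (- (?g k (Suc i) - ?g k i) * L.\<psi> (\<theta> i)))
        \<longlonglongrightarrow> (\<Prod>i<n. exp (- (t (Suc i) - t i) * L.\<psi> (\<theta> i)))"
      by (intro tendsto_intros G.grid_above_tendsto)
    ultimately show ?thesis using LIMSEQ_unique by simp
  qed
  have single: "(\<integral>\<omega>. exp (- \<eta> * (S v \<omega> - S u \<omega>)) \<partial>M') = exp (- (v - u) * L.\<psi> \<eta>)"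
    if "0 \<le> u" "u \<le> v" "0 \<le> \<eta>" for u v \<eta>
    using joint[of "\<lambda>i. if i = 0 then u else v" "\<lambda>_. \<eta>" 1] that by (auto simp: mono_def)
  have S_0: "AE \<omega> in M'. S 0 \<omega> = 0"
  proof -
    have one: "\<phi> 0 1 = 1" "\<phi> 0 2 = 1" using L.\<phi>_eq[of 0 1] L.\<phi>_eq[of 0 2] by simp_all
    then show ?thesis using S_eq_of_Laplace[of 0] by simp
  qed
  show ?thesis
    unfolding subordinator_def
  proof (intro conjI allI impI)
    show "AE \<omega> in M'. mono_on {0..} (\<lambda>t. S t \<omega>)"
      using mono_all by eventually_elim (auto simp: mono_on_def)
    fix n and t :: "nat \<Rightarrow> real" assume t: "0 \<le> t 0 \<and> mono t"
    then have t0: "0 \<le> t i" for i using monoD[of t 0 i] by simp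
    have t_Suc: "t i \<le> t (Suc i)" for i using t monoD[of t i "Suc i"] by simp
    show "limit.indep_vars (\<lambda>_. borel) (\<lambda>i \<omega>. S (t (Suc i)) \<omega> - S (t i) \<omega>) {..<n}"
    proof (rule limit.indep_vars_Laplace)
      show "(\<lambda>\<omega>. S (t (Suc i)) \<omega> - S (t i) \<omega>) \<in> borel_measurable M'" for i
        using S_meas[OF t0] by measurable
      show "AE \<omega> in M'. 0 \<le> S (t (Suc i)) \<omega> - S (t i) \<omega>" for i
        using mono_all by eventually_elim (use t0 t_Suc in auto)
      fix \<theta> :: "nat \<Rightarrow> real" assume \<theta>: "\<And>i. 0 \<le> \<theta> i"
      have "(\<integral>\<omega>. (\<Prod>i<n. exp (- \<theta> i * (S (t (Suc i)) \<omega> - S (t i) \<omega>))) \<partial>M')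
          = (\<Prod>i<n. exp (- (t (Suc i) - t i) * L.\<psi> (\<theta> i)))"
        using joint[of t \<theta> n] t \<theta> by (simp add: exp_sum sum_negf[symmetric])
      then show "(\<integral>\<omega>. (\<Prod>i<n. exp (- \<theta> i * (S (t (Suc i)) \<omega> - S (t i) \<omega>))) \<partial>M')
          = (\<Prod>i<n. \<integral>\<omega>. exp (- \<theta> i * (S (t (Suc i)) \<omega> - S (t i) \<omega>)) \<partial>M')"
        by (simp only: single[OF t0 t_Suc \<theta>])
    qed
  next
    fix s t :: real assume st: "0 \<le> s" "0 \<le> t"
    show "distr M' borel (\<lambda>\<omega>. S (s + t) \<omega> - S s \<omega>) = distr M' borel (S t)"
    proof (rule Laplace_unique[OF prob_space_M' prob_space_M'])
      show "(\<lambda>\<omega>. S (s + t) \<omega> - S s \<omega>) \<in> borel_measurable M'" "S t \<in> borel_measurable M'"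
        using S_meas[of "s + t"] S_meas[of s] S_meas[of t] st by auto
      show "AE \<omega> in M'. 0 \<le> S (s + t) \<omega> - S s \<omega>"
        using mono_all by eventually_elim (use st in auto)
      show "AE \<omega> in M'. 0 \<le> S t \<omega>" using S_nonneg[OF st(2)] by (intro AE_I2) auto
      show "(\<integral>\<omega>. exp (- \<eta> * (S (s + t) \<omega> - S s \<omega>)) \<partial>M') = (\<integral>\<omega>. exp (- \<eta> * S t \<omega>) \<partial>M')" if "0 \<le> \<eta>" for \<eta>
        using single[of s "s + t" \<eta>] L.\<phi>_eq[OF st(2) that] st that by (simp add: \<phi>_def)
    qed
  qed (use prob_space_M' cadlag_S S_0 in auto)
qed

end

section \<open>The dichotomy between linear and stable limits\<close>

theorem theorem1p1:
  fixes M :: "'w measure" and M' :: "'v measure"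
    and \<nu> :: "(int ^ 'd::finite) pmf" and \<mu> :: "real measure measure"
    and \<pi> :: "int ^ 'd \<Rightarrow> 'w \<Rightarrow> real measure"
    and \<xi> :: "nat \<Rightarrow> 'w \<Rightarrow> int ^ 'd"
    and \<tau> :: "int ^ 'd \<Rightarrow> nat \<Rightarrow> 'w \<Rightarrow> real"
    and lstar a :: "nat \<Rightarrow> real"
    and \<S> :: "real \<Rightarrow> 'v \<Rightarrow> real"
  assumes "rtrw M \<nu> \<mu> \<pi> \<xi> \<tau>" and "\<nu> \<noteq> return_pmf 0"
    and "slowly_varying lstar" and "\<forall>n. lstar n \<ge> 1"
    and "\<forall>n. no_return_prob M \<xi> n = 1 / lstar n"
    and "mono_on {1..} a" and "filterlim a at_top sequentially"
    and "prob_space M'" and "cadlag_process M' \<S>"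
    and "\<forall>t\<ge>0. \<forall>\<omega>\<in>space M'. \<S> t \<omega> \<ge> 0"
    and "AE \<omega> in M'. Limsup at_top (\<lambda>t. ereal (\<S> t \<omega>)) = \<infinity>"
    and "\<exists>D. countable D \<and> (\<forall>t\<in>{0..} - D.
           weak_conv_m (\<lambda>N. distr M borel (rescaled_clock a \<xi> \<tau> N t)) (distr M' borel (\<S> t)))"
  shows
    "(\<exists>m>0. \<exists>l. slowly_varying l \<and> (\<forall>N\<ge>1. a N = real N * l N) \<and>
        (AE \<omega> in M'. \<forall>t\<ge>0. \<S> t \<omega> = m * t))
     \<or>
     (\<exists>\<alpha>\<in>{0<..<1}. \<exists>l. slowly_varying l \<and> (\<forall>N\<ge>1. a N = real N powr (1 / \<alpha>) * l N) \<and>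
        stable_marginals \<alpha> M' \<S> \<and>
        ((\<exists>D. countable D \<and> fdd_conv ({0..} - D) M (rescaled_clock a \<xi> \<tau>) M' \<S>) \<longrightarrow>
           stable_subordinator \<alpha> M' \<S>))"
proof -
  obtain D where D: "countable D" "\<And>t. t \<in> {0..} - D \<Longrightarrow>
      weak_conv_m (\<lambda>N. distr M borel (rescaled_clock a \<xi> \<tau> N t)) (distr M' borel (\<S> t))"
    using assms(12) by blast
  interpret clock_limit M \<nu> \<mu> \<pi> \<xi> \<tau> lstar a M' \<S> D
  proof (intro clock_limit.intro rtrw_process.intro clock_limit_axioms.intro)
    show "1 \<le> lstar n" "no_return_prob M \<xi> n = 1 / lstar n" for n using assms(4,5) by blast+
    show "0 \<le> \<S> t \<omega>" if "0 \<le> t" "\<omega> \<in> space M'" for t \<omega> using assms(10) that by blast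
    show "weak_conv_m (\<lambda>N. distr M borel (rescaled_clock a \<xi> \<tau> N t)) (distr M' borel (\<S> t))"
      if "0 \<le> t" "t \<notin> D" for t using D(2)[of t] that by simp
  qed (fact assms(1,3,7-9,11) D(1))+
  obtain \<alpha> where \<alpha>: "0 < \<alpha>" "\<alpha> \<le> 1" "\<And>x. 0 \<le> x \<Longrightarrow> L.\<psi> x = L.\<psi> 1 * x powr \<alpha>"
    "\<And>c. 0 < c \<Longrightarrow> (\<lambda>N. a (nat \<lfloor>c * real N\<rfloor>) / a N) \<longlonglongrightarrow> c powr (1 / \<alpha>)"
  proof (rule L.regular_variation[OF \<psi>_cont _ \<psi>_0 \<psi>_double])
    show "L.\<psi> x < L.\<psi> y" if "0 \<le> x" "x < y" for x y using that by (rule \<psi>_strict)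
  qed (rule that)
  define l where "l N = a N / real N powr (1 / \<alpha>)" for N
  have l: "slowly_varying l"
    unfolding l_def[abs_def] using \<alpha> by (intro slowly_varying_normalization) auto
  have a_eq: "a N = real N powr (1 / \<alpha>) * l N" if "N \<ge> 1" for N using that by (simp add: l_def)
  show ?thesis
  proof (cases "\<alpha> = 1")
    case True
    have "AE \<omega> in M'. \<S> t \<omega> = L.\<psi> 1 * t" if t: "0 \<le> t" for t
    proof -
      \<comment> \<open>With exponent \<open>1\<close> the function \<open>\<psi>\<close> is linear,
        which is the case of zero variance.\<close>
      have "\<phi> t 2 = (\<phi> t 1)\<^sup>2"
        using L.\<phi>_eq[OF t] \<alpha>(3)[of 2] True by (simp add: power2_eq_square exp_add[symmetric])
      from S_eq_of_Laplace[OF t this] show ?thesis using L.\<phi>_eq[OF t, of 1] by (simp add: mult.commute)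
    qed
    then have "AE \<omega> in M'. \<forall>t\<ge>0. \<S> t \<omega> = L.\<psi> 1 * t" by (rule S_linear)
    then show ?thesis using S_nontrivial l a_eq True by (intro disjI1 exI[of _ "L.\<psi> 1"]) auto
  next
    case False
    have marginals: "stable_marginals \<alpha> M' \<S>"
      unfolding stable_marginals_def
    proof (intro exI conjI allI impI)
      show "0 < L.\<psi> 1" by (rule S_nontrivial)
      fix t \<theta> :: real assume "0 \<le> t" "0 \<le> \<theta>"
      then show "(\<integral>\<omega>. exp (- \<theta> * \<S> t \<omega>) \<partial>M') = exp (- L.\<psi> 1 * t * \<theta> powr \<alpha>)"
        using L.\<phi>_eq[of t \<theta>] \<alpha>(3)[of \<theta>] by (simp add: \<phi>_def mult_ac)
    qed
    \<comment> \<open>Joint convergence enters only here; the marginals above come from convergence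
      at single times.\<close>
    moreover have "stable_subordinator \<alpha> M' \<S>"
      if "countable D2" "fdd_conv ({0..} - D2) M (rescaled_clock a \<xi> \<tau>) M' \<S>" for D2
      using subordinator_of_fdd_conv[OF that(2,1)] marginals by (simp add: stable_subordinator_def)
    moreover have "\<alpha> \<in> {0<..<1}" using \<alpha> False by simp
    ultimately show ?thesis using l a_eq by blast
  qed
qed

end
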